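(* Let $\mathfrak{S} \subseteq \mathrm{C}^*(\mathfrak{S})$ be a selfadjoint operator space. Suppose there is a C*-algebra $A \subseteq \mathfrak{S}$ such that $A \cdot \mathfrak{S} \subseteq \mathfrak{S}$, and an approximate unit $(u_\lambda)_\lambda$ for $A$ such that $\lim_\lambda u_\lambda s = s$ for every $s\in \mathfrak{S}$. Then every $\varphi \in \mathrm{CCP}(M_n(\mathfrak{S}), \mathbb{C})$ attains an extension to a $\widetilde{\varphi} \in \mathrm{CCP}(M_n(\mathrm{C}^*(\mathfrak{S})), \mathbb{C})$ with $\|\widetilde{\varphi}\| = \|\varphi\|$, for any $n \in \mathbb{N}$. Consequently, the inclusion $\mathfrak{S} \subseteq \mathrm{C}^*(\mathfrak{S})$ is an embedding.
   Context: A selfadjoint operator space is a selfadjoint norm-closed subspace of some $\mathcal{B}(H)$, with the inherited matrix norms and matrix order (positivity in $M_n(\mathfrak{S})\subseteq M_n(\mathcal{B}(H))$); $\mathrm{C}^*(\mathfrak{S})$ is the C*-algebra generated by $\mathfrak{S}$, and $A$ is a C*-subalgebra of it contained in $\mathfrak{S}$, with products taken in $\mathrm{C}^*(\mathfrak{S})$. Approximate units consist of positive contractions and limits are in norm. A linear map between selfadjoint operator spaces is positive if it is selfadjoint ($*$-preserving) and maps positive elements to positive elements; it is completely positive if all its matrix amplifications are positive. A complete order embedding is a completely positive map that is invertible onto its image with completely positive inverse. $\mathrm{CCP}(M_n(\mathfrak{S}),\mathbb{C})$ is the set of completely contractive completely positive maps $M_n(\mathfrak{S})\to\mathbb{C}$.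 An operator system is a unital selfadjoint norm-closed subspace of some $\mathcal{B}(H)$. Werner's unitisation $\mathfrak{S}^\#$ of $\mathfrak{S}$ is the space $\mathfrak{S}\oplus\mathbb{C}$ with involution $(s,\alpha)^*=(s^*,\overline{\alpha})$, unit $(0,1)$, and matrix order in which a selfadjoint $(s,\alpha)\in M_n(\mathfrak{S}^\#)=M_n(\mathfrak{S})\oplus M_n(\mathbb{C})$ is positive if $\alpha\ge0$ and $\varphi(\alpha_\varepsilon^{-1/2}s\,\alpha_\varepsilon^{-1/2})\ge-1$ for all $\varepsilon>0$ and all $\varphi\in\mathrm{CCP}(M_n(\mathfrak{S}),\mathbb{C})$, where $\alpha_\varepsilon:=\alpha+\varepsilon I_{M_n}$. This makes $\mathfrak{S}^\#$ an operator system. A map $\phi\colon\mathfrak{S}\to\mathfrak{T}$ of selfadjoint operator spaces is an embedding if it is a completely isometric complete order embedding and its unitisation $\phi^\#\colon\mathfrak{S}^\#\to\mathfrak{T}^\#$, $(s,\lambda)\mapsto(\phi(s),\lambda)$, is a complete order embedding of operator systems. *)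

theory Defs
  imports
    "HOL-Analysis.Analysis"
    "Jordan_Normal_Form.Matrix"
begin

section \<open>Complex Hilbert spaces and bounded operators\<close>

text \<open>The inner product is linear in its first argument.  Completeness comes from the
  superclass, and positive definiteness from \<open>cinner_norm\<close>.\<close>

class chilbert_space = banach +
  fixes scaleC :: "complex \<Rightarrow> 'a \<Rightarrow> 'a"  (infixr "*\<^sub>C" 75)
    and cinner :: "'a \<Rightarrow> 'a \<Rightarrow> complex"
  assumes scaleC_add_right: "c *\<^sub>C (x + y) = c *\<^sub>C x + c *\<^sub>C y"
    and scaleC_add_left: "(c + d) *\<^sub>C x = c *\<^sub>C x + d *\<^sub>C x"
    and scaleC_scaleC: "c *\<^sub>C (d *\<^sub>C x) = (c * d) *\<^sub>C x"
    and scaleR_scaleC: "r *\<^sub>R x = complex_of_real r *\<^sub>C x"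
    and cinner_add_left: "cinner (x + y) z = cinner x z + cinner y z"
    and cinner_scaleC_left: "cinner (c *\<^sub>C x) y = c * cinner x y"
    and cinner_commute: "cinner x y = cnj (cinner y x)"
    and cinner_norm: "cinner x x = complex_of_real ((norm x)\<^sup>2)"

instantiation complex :: chilbert_space
begin

definition scaleC_complex :: "complex \<Rightarrow> complex \<Rightarrow> complex"
  where "scaleC_complex c z = c * z"

definition cinner_complex :: "complex \<Rightarrow> complex \<Rightarrow> complex"
  where "cinner_complex z w = z * cnj w"

instance
  by standard
    (auto simp: scaleC_complex_def cinner_complex_def algebra_simps scaleR_conv_of_real
      complex_norm_square[symmetric] simp del: of_real_power)

end

lemma norm_scaleC: "norm (c *\<^sub>C x) = cmod c * norm (x :: 'a::chilbert_space)"
proof -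
  have "complex_of_real ((norm (c *\<^sub>C x))\<^sup>2) = c * cnj (c * cinner x x)"
    by (metis cinner_norm cinner_scaleC_left cinner_commute)
  also have "\<dots> = c * cnj c * complex_of_real ((norm x)\<^sup>2)"
    by (simp add: cinner_norm mult.assoc)
  also have "\<dots> = complex_of_real ((cmod c * norm x)\<^sup>2)"
    by (simp add: complex_norm_square[symmetric] power_mult_distrib)
  finally have "(norm (c *\<^sub>C x))\<^sup>2 = (cmod c * norm x)\<^sup>2"
    using of_real_eq_iff by blast
  then show ?thesis by simp
qed

lemma bounded_linear_scaleC: "bounded_linear (\<lambda>x :: 'a::chilbert_space. c *\<^sub>C x)"
proof (rule bounded_linear_intro)
  show "norm (c *\<^sub>C x) \<le> norm x * cmod c" for x :: 'a
    by (simp add: norm_scaleC mult.commute)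
qed (auto simp: scaleC_add_right scaleR_scaleC scaleC_scaleC mult.commute)

text \<open>The library's bounded operators are only real-linear, so \<open>\<B>(H)\<close> is the
  set of complex-linear ones among them.  Composition is \<open>o\<^sub>L\<close>, the norm is the
  operator norm.\<close>

definition bounded_ops :: "('h::chilbert_space \<Rightarrow>\<^sub>L 'h) set"
  where "bounded_ops = {T :: 'h \<Rightarrow>\<^sub>L 'h. \<forall>c x. T (c *\<^sub>C x) = c *\<^sub>C T x}"

definition scalar_op :: "complex \<Rightarrow> ('h::chilbert_space \<Rightarrow>\<^sub>L 'h)"
  where "scalar_op c = Blinfun (\<lambda>x. c *\<^sub>C x)"

lemma scalar_op_apply [simp]: "scalar_op c x = c *\<^sub>C x"
  by (simp add: scalar_op_def bounded_linear_Blinfun_apply bounded_linear_scaleC)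

definition op_scale :: "complex \<Rightarrow> ('h::chilbert_space \<Rightarrow>\<^sub>L 'h) \<Rightarrow> ('h \<Rightarrow>\<^sub>L 'h)"
  where "op_scale c T = scalar_op c o\<^sub>L T"

definition op_adj :: "('h::chilbert_space \<Rightarrow>\<^sub>L 'h) \<Rightarrow> ('h \<Rightarrow>\<^sub>L 'h)"
  where "op_adj T = (THE T' :: 'h \<Rightarrow>\<^sub>L 'h. \<forall>x y. cinner (T x) y = cinner x (T' y))"

definition op_positive :: "('h::chilbert_space \<Rightarrow>\<^sub>L 'h) \<Rightarrow> bool"
  where "op_positive T \<longleftrightarrow> T \<in> bounded_ops \<and> (\<forall>x. cinner (T x) x \<in> \<real>\<^sub>\<ge>\<^sub>0)"

text \<open>Norm and positivity on \<open>M\<^sub>n(\<B>(H)) = \<B>(H\<^sup>n)\<close>; a vector of \<open>H\<^sup>n\<close> is given by the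
  first \<open>n\<close> values of a sequence.\<close>

definition op_mat_norm :: "('h::chilbert_space \<Rightarrow>\<^sub>L 'h) mat \<Rightarrow> real"
  where "op_mat_norm X =
    (SUP x \<in> {x :: nat \<Rightarrow> 'h. L2_set (\<lambda>j. norm (x j)) {..<dim_col X} \<le> 1}.
      L2_set (\<lambda>i. norm (\<Sum>j<dim_col X. (X $$ (i, j)) (x j))) {..<dim_row X})"

definition op_mat_pos :: "('h::chilbert_space \<Rightarrow>\<^sub>L 'h) mat \<Rightarrow> bool"
  where "op_mat_pos X \<longleftrightarrow>
    (\<forall>x :: nat \<Rightarrow> 'h.
      (\<Sum>i<dim_row X. cinner (\<Sum>j<dim_col X. (X $$ (i, j)) (x j)) (x i)) \<in> \<real>\<^sub>\<ge>\<^sub>0)"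


section \<open>Selfadjoint operator spaces and C*-algebras of operators\<close>

definition selfadjoint_operator_space :: "('h::chilbert_space \<Rightarrow>\<^sub>L 'h) set \<Rightarrow> bool"
  where "selfadjoint_operator_space S \<longleftrightarrow>
    S \<subseteq> bounded_ops \<and> 0 \<in> S \<and>
    (\<forall>s\<in>S. \<forall>t\<in>S. s + t \<in> S) \<and>
    (\<forall>c. \<forall>s\<in>S. op_scale c s \<in> S) \<and>
    (\<forall>s\<in>S. op_adj s \<in> S) \<and>
    closed S"

definition cstar_algebra :: "('h::chilbert_space \<Rightarrow>\<^sub>L 'h) set \<Rightarrow> bool"
  where "cstar_algebra A \<longleftrightarrow>
    selfadjoint_operator_space A \<and> (\<forall>a\<in>A. \<forall>b\<in>A. a o\<^sub>L b \<in> A)"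

definition cstar_generated :: "('h::chilbert_space \<Rightarrow>\<^sub>L 'h) set \<Rightarrow> ('h \<Rightarrow>\<^sub>L 'h) set"
  where "cstar_generated S = \<Inter>{A. cstar_algebra A \<and> S \<subseteq> A}"

text \<open>A net is a family together with a proper filter on its index type, for a directed index
  set the filter generated by its tails.\<close>

definition approximate_unit ::
    "('h::chilbert_space \<Rightarrow>\<^sub>L 'h) set \<Rightarrow> 'i filter \<Rightarrow> ('i \<Rightarrow> ('h \<Rightarrow>\<^sub>L 'h)) \<Rightarrow> bool"
  where "approximate_unit A F u \<longleftrightarrow>
    F \<noteq> bot \<and>
    (\<forall>i. u i \<in> A \<and> op_positive (u i) \<and> norm (u i) \<le> 1) \<and>
    (\<forall>a\<in>A. ((\<lambda>i. u i o\<^sub>L a) \<longlongrightarrow> a) F \<and> ((\<lambda>i. a o\<^sub>L u i) \<longlongrightarrow> a) F)"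


section \<open>Matrix ordered and matrix normed spaces\<close>

text \<open>The data of a selfadjoint operator space, of \<open>M\<^sub>n\<close> of one, of \<open>\<complex>\<close>, and (without
  norms) of a unitisation, so that complete positivity is defined once for maps between any
  of them.  The fields \<open>mpos\<close> and \<open>mnorm\<close> are the matrix order and the matrix norms at
  all levels; the level is the dimension of the argument.\<close>

record 'v mat_ordered =
  elems :: "'v set"
  vadd :: "'v \<Rightarrow> 'v \<Rightarrow> 'v"
  vscale :: "complex \<Rightarrow> 'v \<Rightarrow> 'v"
  vstar :: "'v \<Rightarrow> 'v"
  mpos :: "'v mat \<Rightarrow> bool"

record 'v mat_normed = "'v mat_ordered" +
  mnorm :: "'v mat \<Rightarrow> real"

definition mats :: "('v, 'e) mat_ordered_scheme \<Rightarrow> nat \<Rightarrow> 'v mat set"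
  where "mats V n = {X \<in> carrier_mat n n. \<forall>i<n. \<forall>j<n. X $$ (i, j) \<in> elems V}"

definition mstar :: "('v, 'e) mat_ordered_scheme \<Rightarrow> 'v mat \<Rightarrow> 'v mat"
  where "mstar V X = mat (dim_col X) (dim_row X) (\<lambda>(i, j). vstar V (X $$ (j, i)))"

definition vnorm :: "'v mat_normed \<Rightarrow> 'v \<Rightarrow> real"
  where "vnorm V x = mnorm V (mat 1 1 (\<lambda>_. x))"

definition operator_space :: "('h::chilbert_space \<Rightarrow>\<^sub>L 'h) set \<Rightarrow> ('h \<Rightarrow>\<^sub>L 'h) mat_normed"
  where "operator_space S =
    \<lparr>elems = S, vadd = (+), vscale = op_scale, vstar = op_adj,
     mpos = op_mat_pos, mnorm = op_mat_norm\<rparr>"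

text \<open>The matrix order and norms of \<open>\<complex>\<close> are those of \<open>\<B>(\<complex>)\<close>.\<close>

definition scalars :: "complex mat_normed"
  where "scalars =
    \<lparr>elems = UNIV, vadd = (+), vscale = (*), vstar = cnj,
     mpos = (\<lambda>a. op_mat_pos (map_mat (scalar_op :: complex \<Rightarrow> complex \<Rightarrow>\<^sub>L complex) a)),
     mnorm = (\<lambda>a. op_mat_norm (map_mat (scalar_op :: complex \<Rightarrow> complex \<Rightarrow>\<^sub>L complex) a))\<rparr>"

text \<open>The identification \<open>M\<^sub>k(M\<^sub>n(V)) = M\<^sub>k\<^sub>n(V)\<close>.\<close>

definition flatten_mat :: "nat \<Rightarrow> 'v mat mat \<Rightarrow> 'v mat"
  where "flatten_mat n X =
    mat (dim_row X * n) (dim_col X * n)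
      (\<lambda>(i, j). X $$ (i div n, j div n) $$ (i mod n, j mod n))"

definition matrix_space :: "nat \<Rightarrow> 'v mat_normed \<Rightarrow> 'v mat mat_normed"
  where "matrix_space n V =
    \<lparr>elems = mats V n,
     vadd = (\<lambda>X Y. mat n n (\<lambda>ij. vadd V (X $$ ij) (Y $$ ij))),
     vscale = (\<lambda>c X. map_mat (vscale V c) X),
     vstar = mstar V,
     mpos = (\<lambda>X. mpos V (flatten_mat n X)),
     mnorm = (\<lambda>X. mnorm V (flatten_mat n X))\<rparr>"


section \<open>Completely positive maps\<close>

definition linear_map ::
    "('v, 'd) mat_ordered_scheme \<Rightarrow> ('w, 'e) mat_ordered_scheme \<Rightarrow> ('v \<Rightarrow> 'w) \<Rightarrow> bool"
  where "linear_map V W f \<longleftrightarrow>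
    f ` elems V \<subseteq> elems W \<and>
    (\<forall>x\<in>elems V. \<forall>y\<in>elems V. f (vadd V x y) = vadd W (f x) (f y)) \<and>
    (\<forall>c. \<forall>x\<in>elems V. f (vscale V c x) = vscale W c (f x))"

text \<open>Positivity of the \<open>n\<close>-th amplification \<open>map_mat f\<close>: it is selfadjoint and maps positive
  elements to positive elements.\<close>

definition amplification_positive ::
    "('v, 'd) mat_ordered_scheme \<Rightarrow> ('w, 'e) mat_ordered_scheme \<Rightarrow> ('v \<Rightarrow> 'w) \<Rightarrow> nat \<Rightarrow> bool"
  where "amplification_positive V W f n \<longleftrightarrow>
    (\<forall>X\<in>mats V n. map_mat f (mstar V X) = mstar W (map_mat f X)) \<and>
    (\<forall>X\<in>mats V n. mpos V X \<longrightarrow> mpos W (map_mat f X))"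

definition completely_positive ::
    "('v, 'd) mat_ordered_scheme \<Rightarrow> ('w, 'e) mat_ordered_scheme \<Rightarrow> ('v \<Rightarrow> 'w) \<Rightarrow> bool"
  where "completely_positive V W f \<longleftrightarrow>
    linear_map V W f \<and> (\<forall>n\<ge>1. amplification_positive V W f n)"

definition completely_contractive :: "'v mat_normed \<Rightarrow> 'w mat_normed \<Rightarrow> ('v \<Rightarrow> 'w) \<Rightarrow> bool"
  where "completely_contractive V W f \<longleftrightarrow>
    linear_map V W f \<and> (\<forall>n\<ge>1. \<forall>X\<in>mats V n. mnorm W (map_mat f X) \<le> mnorm V X)"

definition completely_isometric :: "'v mat_normed \<Rightarrow> 'w mat_normed \<Rightarrow> ('v \<Rightarrow> 'w) \<Rightarrow> bool"
  where "completely_isometric V W f \<longleftrightarrow>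
    linear_map V W f \<and> (\<forall>n\<ge>1. \<forall>X\<in>mats V n. mnorm W (map_mat f X) = mnorm V X)"

definition CCP :: "'v mat_normed \<Rightarrow> 'w mat_normed \<Rightarrow> ('v \<Rightarrow> 'w) set"
  where "CCP V W = {f. completely_contractive V W f \<and> completely_positive V W f}"

definition map_norm :: "'v mat_normed \<Rightarrow> 'w mat_normed \<Rightarrow> ('v \<Rightarrow> 'w) \<Rightarrow> real"
  where "map_norm V W f = (SUP x \<in> {x \<in> elems V. vnorm V x \<le> 1}. vnorm W (f x))"

definition complete_order_embedding ::
    "('v, 'd) mat_ordered_scheme \<Rightarrow> ('w, 'e) mat_ordered_scheme \<Rightarrow> ('v \<Rightarrow> 'w) \<Rightarrow> bool"
  where "complete_order_embedding V W f \<longleftrightarrow>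
    completely_positive V W f \<and>
    inj_on f (elems V) \<and>
    completely_positive (W\<lparr>elems := f ` elems V\<rparr>) V (inv_into (elems V) f)"


section \<open>Werner's unitisation and embeddings\<close>

text \<open>\<open>a\<^sup>-\<^sup>1\<^sup>/\<^sup>2\<close> for a strictly positive complex matrix: the positive matrix whose square is
  inverse to \<open>a\<close>.\<close>

definition inv_sqrt_mat :: "complex mat \<Rightarrow> complex mat"
  where "inv_sqrt_mat a =
    (THE b. b \<in> carrier_mat (dim_row a) (dim_row a) \<and> mpos scalars b \<and>
      inverts_mat (b * b) a \<and> inverts_mat a (b * b))"

text \<open>The product \<open>b s b\<close> of a complex matrix \<open>b\<close> and an operator matrix \<open>s\<close>.\<close>

definition compress_mat ::
    "complex mat \<Rightarrow> ('h::chilbert_space \<Rightarrow>\<^sub>L 'h) mat \<Rightarrow> ('h \<Rightarrow>\<^sub>L 'h) mat"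
  where "compress_mat b s =
    mat (dim_row b) (dim_col b) (\<lambda>(i, j).
      \<Sum>k<dim_row s. \<Sum>l<dim_col s. op_scale (b $$ (i, k) * b $$ (l, j)) (s $$ (k, l)))"

text \<open>Elements of \<open>CCP(M\<^sub>n(S), \<complex>)\<close> are selfadjoint and are evaluated at a selfadjoint element
  below, so the value is real.\<close>

definition unitisation_pos :: "('h::chilbert_space \<Rightarrow>\<^sub>L 'h) set \<Rightarrow>
    nat \<Rightarrow> ('h \<Rightarrow>\<^sub>L 'h) mat \<Rightarrow> complex mat \<Rightarrow> bool"
  where "unitisation_pos S n s \<alpha> \<longleftrightarrow>
    mpos scalars \<alpha> \<and>
    (\<forall>\<epsilon>>0. \<forall>\<phi>\<in>CCP (matrix_space n (operator_space S)) scalars.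
      Re (\<phi> (compress_mat (inv_sqrt_mat (\<alpha> + complex_of_real \<epsilon> \<cdot>\<^sub>m 1\<^sub>m n)) s)) \<ge> -1)"

definition unitisation_star :: "('h::chilbert_space \<Rightarrow>\<^sub>L 'h) \<times> complex \<Rightarrow> ('h \<Rightarrow>\<^sub>L 'h) \<times> complex"
  where "unitisation_star = (\<lambda>(s, \<alpha>). (op_adj s, cnj \<alpha>))"

definition unitisation ::
    "('h::chilbert_space \<Rightarrow>\<^sub>L 'h) set \<Rightarrow> (('h \<Rightarrow>\<^sub>L 'h) \<times> complex) mat_ordered"
  where "unitisation S =
    \<lparr>elems = S \<times> UNIV,
     vadd = (+),
     vscale = (\<lambda>c (s, \<alpha>). (op_scale c s, c * \<alpha>)),
     vstar = unitisation_star,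
     mpos = (\<lambda>X.
       X = mat (dim_col X) (dim_row X) (\<lambda>(i, j). unitisation_star (X $$ (j, i))) \<and>
       unitisation_pos S (dim_row X) (map_mat fst X) (map_mat snd X))\<rparr>"

definition unitised_map :: "('v \<Rightarrow> 'w) \<Rightarrow> 'v \<times> complex \<Rightarrow> 'w \<times> complex"
  where "unitised_map \<phi> = (\<lambda>(s, \<alpha>). (\<phi> s, \<alpha>))"

definition is_embedding ::
    "('h::chilbert_space \<Rightarrow>\<^sub>L 'h) set \<Rightarrow> ('k::chilbert_space \<Rightarrow>\<^sub>L 'k) set \<Rightarrow>
      (('h \<Rightarrow>\<^sub>L 'h) \<Rightarrow> ('k \<Rightarrow>\<^sub>L 'k)) \<Rightarrow> bool"
  where "is_embedding S T \<phi> \<longleftrightarrow>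
    completely_isometric (operator_space S) (operator_space T) \<phi> \<and>
    complete_order_embedding (operator_space S) (operator_space T) \<phi> \<and>
    complete_order_embedding (unitisation S) (unitisation T) (unitised_map \<phi>)"

end

theory Submission
  imports
    Defs
    "HOL-Analysis.Finite_Function_Topology"
    "Jordan_Normal_Form.Determinant"
begin

text \<open>
  Let \<open>\<phi>\<close> be a completely contractive completely positive functional on \<open>M\<^sub>n(S)\<close> and \<open>c\<close> its norm.  Every
  extension of \<open>\<phi>\<close> given by the Hahn--Banach theorem has a norm bound, but it must also be positive.  Both
  are obtained at once by choosing the dominating sublinear functional well: \<open>c * N X\<close>, where \<open>N X\<close> is the
  supremum of \<open>Re \<langle>X x, x\<rangle>\<close> over the unit ball.  It is at most the norm of \<open>X\<close>, and it is zero if \<open>X\<close> is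
  negative or antiselfadjoint, so a real-linear functional below it has norm at most \<open>c\<close>, is positive
  and selfadjoint (\<open>dominated_functional_extension\<close>).

  The approximate unit enters through the domination \<open>Re (\<phi> X) \<le> c * N X\<close> on \<open>M\<^sub>n(S)\<close>
  (\<open>approximate_unit_domination\<close>).  The selfadjoint matrix \<open>N X - Re X\<close> is positive but need not lie in
  \<open>M\<^sub>n(S)\<close>, because \<open>S\<close> need not contain the unit.  Its compression \<open>(N X) u\<^sup>2 - u (Re X) u\<close> does, for \<open>u\<close> in
  the approximate unit placed on the diagonal, and positivity of \<open>\<phi>\<close> gives
  \<open>Re (\<phi> (u X u)) \<le> N X * \<phi> (u\<^sup>2) \<le> N X * c\<close>.  As \<open>u X u\<close> tends to \<open>X\<close>, the bound follows in the limit.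

  For functionals, positivity and boundedness imply their complete versions (\<open>CCP_functionalI\<close>), so the
  extension to all operator matrices, restricted to those over the generated C*-algebra, is the one
  wanted.  That this algebra consists of complex-linear operators, and that adjoints exist at all, rests
  on the Riesz representation theorem.

  The order of the unitisation is defined by testing against functionals, so the extension property makes
  the orders of the two unitisations agree on matrices over \<open>S\<close>.  The remaining point is that the
  compression by an inverse square root in this definition stays in \<open>M\<^sub>n(S)\<close>, which amounts to existence
  and uniqueness of positive inverse square roots of complex matrices.  Existence is proved by the power
  series of \<open>(1 - K) powr (- 1 / 2)\<close> (\<open>inverse_sqrt_of_one_minus\<close>), uniqueness by a trace argument
  (\<open>psd_square_cancel\<close>).
\<close>

section \<open>Adjoints of bounded operators\<close>

text \<open>The expression is the value of a sesquilinear form at \<open>t x + y\<close>, so this is the common source of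
  hermitian symmetry and of the Cauchy--Schwarz inequality for nonnegative forms.  Symmetry comes from
  \<open>t = 1, - 1, \<i>\<close>, the inequality from real multiples of \<open>t = - cnj \<beta>\<close>.\<close>

lemma psd_hermitian_coefficients:
  fixes P \<beta> \<gamma> R :: complex
  assumes pos: "\<And>t. P + t * \<beta> + cnj t * \<gamma> + t * cnj t * R \<in> \<real>\<^sub>\<ge>\<^sub>0"
  shows "\<gamma> = cnj \<beta>" and "(cmod \<beta>)\<^sup>2 \<le> Re P * Re R"
proof -
  have P: "Im P = 0" "Re P \<ge> 0"
    using pos[of 0] by (auto simp: complex_nonneg_Reals_iff)
  have im: "Im (\<beta> + \<gamma>) + Im R = 0" "Im R - Im (\<beta> + \<gamma>) = 0" "Re (\<beta> - \<gamma>) + Im R = 0"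
    using pos[of 1] pos[of "-1"] pos[of \<i>] P by (auto simp: complex_nonneg_Reals_iff)
  have R: "Im R = 0"
    using im by simp
  show g: "\<gamma> = cnj \<beta>"
    using im R by (auto simp: complex_eq_iff)
  have quad: "0 \<le> Re P + 2 * Re (t * \<beta>) + (cmod t)\<^sup>2 * Re R" for t
  proof -
    have "Re (t * cnj t * R) = (cmod t)\<^sup>2 * Re R"
      by (simp add: complex_norm_square[symmetric] del: of_real_power)
    moreover have "Re (cnj t * cnj \<beta>) = Re (t * \<beta>)"
      by simp
    ultimately show ?thesis
      using pos[of t] unfolding g complex_nonneg_Reals_iff by (simp only: plus_complex.sel) linarith
  qed
  have Rpos: "Re R \<ge> 0"
  proof (rule ccontr)
    assume neg: "\<not> Re R \<ge> 0"
    \<comment> \<open>Large real \<open>t\<close> of both signs would make the quadratic term prevail.\<close>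
    define s where "s = sqrt ((Re P + 1) / (- Re R))"
    have s: "s\<^sup>2 * Re R = - (Re P + 1)"
      using neg P by (simp add: s_def field_simps)
    have "0 \<le> Re P + 2 * Re (s * \<beta>) + s\<^sup>2 * Re R" "0 \<le> Re P - 2 * Re (s * \<beta>) + s\<^sup>2 * Re R"
      using quad[of s] quad[of "- s"] by simp_all
    then show False using s by linarith
  qed
  have quad': "0 \<le> Re P - 2 * s * (cmod \<beta>)\<^sup>2 + s\<^sup>2 * (cmod \<beta>)\<^sup>2 * Re R" for s
  proof -
    have "Re (- complex_of_real s * cnj \<beta> * \<beta>) = - s * (cmod \<beta>)\<^sup>2"
      unfolding cmod_power2 by (simp add: power2_eq_square algebra_simps)
    then show ?thesis
      using quad[of "- complex_of_real s * cnj \<beta>"] by (simp add: norm_mult power_mult_distrib)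
  qed
  show "(cmod \<beta>)\<^sup>2 \<le> Re P * Re R"
  proof (cases "Re R = 0")
    case False
    then have "Re R > 0" using Rpos by simp
    then show ?thesis
      using quad'[of "1 / Re R"] by (simp add: field_simps power2_eq_square)
  next
    case True
    have "(cmod \<beta>)\<^sup>2 = 0"
    proof (rule ccontr)
      assume "(cmod \<beta>)\<^sup>2 \<noteq> 0"
      then have "Re P - 2 * ((Re P + 1) / (cmod \<beta>)\<^sup>2) * (cmod \<beta>)\<^sup>2 = - Re P - 2"
        by (simp add: field_simps)
      then show False
        using quad'[of "(Re P + 1) / (cmod \<beta>)\<^sup>2"] True P by simp
    qed
    then show ?thesis using True by simp
  qed
qed

lemma cinner_add_right: "cinner (x::'h::chilbert_space) (y + z) = cinner x y + cinner x z"
  by (metis cinner_commute cinner_add_left complex_cnj_add)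

lemma cinner_scaleC_right: "cinner (x::'h::chilbert_space) (c *\<^sub>C y) = cnj c * cinner x y"
  by (metis cinner_commute cinner_scaleC_left complex_cnj_mult)

lemma cinner_zero_left [simp]: "cinner (0::'h::chilbert_space) y = 0"
  using cinner_add_left[of 0 0 y] by simp

lemma cinner_zero_right [simp]: "cinner (x::'h::chilbert_space) 0 = 0"
  using cinner_add_right[of x 0 0] by simp

lemma cinner_minus_left: "cinner (- x::'h::chilbert_space) y = - cinner x y"
  using cinner_add_left[of x "- x" y] by (simp add: add_eq_0_iff2)

lemma cinner_minus_right: "cinner (x::'h::chilbert_space) (- y) = - cinner x y"
  using cinner_add_right[of x y "- y"] by (simp add: add_eq_0_iff2)

lemma cinner_diff_left: "cinner (x - z::'h::chilbert_space) y = cinner x y - cinner z y"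
  using cinner_add_left[of x "- z" y] by (simp add: cinner_minus_left)

lemma cinner_diff_right: "cinner (x::'h::chilbert_space) (y - z) = cinner x y - cinner x z"
  using cinner_add_right[of x y "- z"] by (simp add: cinner_minus_right)

lemma cinner_sum_left: "cinner (\<Sum>i\<in>I. f i::'h::chilbert_space) y = (\<Sum>i\<in>I. cinner (f i) y)"
  by (induction I rule: infinite_finite_induct) (auto simp: cinner_add_left)

lemma cinner_scaleR_left: "cinner (r *\<^sub>R x::'h::chilbert_space) y = r * cinner x y"
  by (simp add: scaleR_scaleC cinner_scaleC_left)

lemma cinner_scaleR_right: "cinner (x::'h::chilbert_space) (r *\<^sub>R y) = r * cinner x y"
  by (simp add: scaleR_scaleC cinner_scaleC_right)

lemma scaleC_zero_right [simp]: "c *\<^sub>C (0::'h::chilbert_space) = 0"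
  using bounded_linear_scaleC linear_0 bounded_linear.linear by blast

lemma scaleC_zero_left [simp]: "0 *\<^sub>C (x::'h::chilbert_space) = 0"
  using scaleR_scaleC[of 0 x] by simp

lemma scaleC_sum_right: "c *\<^sub>C (\<Sum>i\<in>I. f i::'h::chilbert_space) = (\<Sum>i\<in>I. c *\<^sub>C f i)"
  using bounded_linear_scaleC bounded_linear.linear linear_sum by blast

lemma cinner_eqI:
  assumes "\<And>y. cinner (x::'h::chilbert_space) y = cinner x' y"
  shows "x = x'"
  using assms[of "x - x'"] cinner_norm[of "x - x'"] by (simp add: cinner_diff_left)

lemma cinner_eqI_right:
  assumes "\<And>y. cinner y (x::'h::chilbert_space) = cinner y x'"
  shows "x = x'"
  by (rule cinner_eqI) (metis assms cinner_commute)

lemma cinner_Cauchy_Schwarz: "cmod (cinner x y) \<le> norm x * norm (y::'h::chilbert_space)"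
proof -
  have "(cmod (cinner x y))\<^sup>2 \<le> Re (cinner y y) * Re (cinner x x)"
  proof (rule psd_hermitian_coefficients(2))
    fix t
    have "cinner y y + t * cinner x y + cnj t * cinner y x + t * cnj t * cinner x x
        = cinner (t *\<^sub>C x + y) (t *\<^sub>C x + y)"
      by (simp add: cinner_add_left cinner_add_right cinner_scaleC_left cinner_scaleC_right
          algebra_simps)
    also have "\<dots> \<in> \<real>\<^sub>\<ge>\<^sub>0"
      by (simp add: cinner_norm)
    finally show "cinner y y + t * cinner x y + cnj t * cinner y x + t * cnj t * cinner x x \<in> \<real>\<^sub>\<ge>\<^sub>0" .
  qed
  also have "\<dots> = (norm x * norm y)\<^sup>2"
    by (simp add: cinner_norm power_mult_distrib del: of_real_power)
  finally show ?thesis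
    using power2_le_imp_le by fastforce
qed

lemma parallelogram_law:
  "(norm (x - y :: 'h::chilbert_space))\<^sup>2 = 2 * (norm x)\<^sup>2 + 2 * (norm y)\<^sup>2 - (norm (x + y))\<^sup>2"
proof -
  have "cinner (x - y) (x - y) = 2 * cinner x x + 2 * cinner y y - cinner (x + y) (x + y)"
    by (simp add: cinner_diff_left cinner_diff_right cinner_add_left cinner_add_right)
  then have "complex_of_real ((norm (x - y))\<^sup>2)
      = complex_of_real (2 * (norm x)\<^sup>2 + 2 * (norm y)\<^sup>2 - (norm (x + y))\<^sup>2)"
    unfolding cinner_norm by simp
  then show ?thesis
    by (simp only: of_real_eq_iff)
qed

text \<open>The Riesz representation theorem.  The representing vector minimises
  \<open>norm y ^ 2 - 2 * Re (f y)\<close>: a minimising sequence is Cauchy by the parallelogram law,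
  and the vanishing of the first variation at the minimum is the required identity.\<close>

lemma riesz_representation:
  fixes f :: "'h::chilbert_space \<Rightarrow> complex"
  assumes f: "bounded_linear f" and fC: "\<And>c x. f (c *\<^sub>C x) = c * f x"
  shows "\<exists>y. \<forall>x. f x = cinner x y"
proof -
  interpret f: bounded_linear f by fact
  define G where "G y = (norm y)\<^sup>2 - 2 * Re (f y)" for y
  obtain B where B: "\<And>x. norm (f x) \<le> norm x * B" "B > 0"
    using f.pos_bounded by blast
  have lower: "G y \<ge> - B\<^sup>2" for y
  proof -
    have "Re (f y) \<le> norm y * B"
      using B(1)[of y] complex_Re_le_cmod[of "f y"] by linarith
    moreover have "0 \<le> (norm y - B)\<^sup>2" by simp
    ultimately show ?thesis
      unfolding G_def power2_diff by linarith
  qed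
  define m where "m = (INF y. G y)"
  have bdd: "bdd_below (range G)"
    using lower by (meson bdd_belowI2)
  have mle: "m \<le> G y" for y
    unfolding m_def using bdd by (simp add: cINF_lower)
  have "\<exists>y. G y < m + 1 / real (Suc k)" for k
  proof (rule ccontr)
    assume "\<nexists>y. G y < m + 1 / real (Suc k)"
    then have "m + 1 / real (Suc k) \<le> m"
      unfolding m_def by (intro cINF_greatest) (auto simp: not_less m_def)
    then show False by simp
  qed
  then obtain Y where Y: "\<And>k. G (Y k) < m + 1 / real (Suc k)"
    by metis
  have close: "(norm (x - y))\<^sup>2 \<le> 2 * (G x - m) + 2 * (G y - m)" for x y
  proof -
    let ?z = "(1/2) *\<^sub>R (x + y)"
    have "G ?z = (norm (x + y))\<^sup>2 / 4 - Re (f x) - Re (f y)"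
      by (simp add: G_def f.scaleR f.add power_divide add_divide_distrib)
    then show ?thesis
      using mle[of ?z] parallelogram_law[of x y] unfolding G_def by simp
  qed
  have "Cauchy Y"
  proof (rule metric_CauchyI)
    fix e :: real assume e: "e > 0"
    obtain N where "inverse (real (Suc N)) < e\<^sup>2 / 4"
      using reals_Archimedean[of "e\<^sup>2 / 4"] e by auto
    moreover define d where "d = 1 / real (Suc N)"
    ultimately have d: "4 * d < e\<^sup>2"
      by (simp add: inverse_eq_divide)
    have "dist (Y k) (Y l) < e" if "k \<ge> N" "l \<ge> N" for k l
    proof -
      have "G (Y j) < m + d" if "j \<ge> N" for j
        unfolding d_def by (rule less_le_trans[OF Y]) (use that in \<open>auto intro!: divide_left_mono\<close>)
      then have "G (Y k) - m < d" "G (Y l) - m < d"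
        using that by (simp_all add: less_diff_eq diff_less_eq add.commute)
      then have "2 * (G (Y k) - m) + 2 * (G (Y l) - m) < 2 * d + 2 * d"
        by (intro add_strict_mono) auto
      also have "\<dots> < e\<^sup>2"
        using d by simp
      finally have "(norm (Y k - Y l))\<^sup>2 < e\<^sup>2"
        using close[of "Y k" "Y l"] by (rule le_less_trans[rotated])
      then show ?thesis
        using e power_less_imp_less_base by (fastforce simp: dist_norm)
    qed
    then show "\<exists>M. \<forall>k\<ge>M. \<forall>l\<ge>M. dist (Y k) (Y l) < e" by blast
  qed
  then obtain y where y: "Y \<longlonglongrightarrow> y"
    using Cauchy_convergent convergent_def by blast
  have "G y \<le> m"
  proof (rule tendsto_le[OF sequentially_bot])
    show "(\<lambda>k. m + 1 / real (Suc k)) \<longlonglongrightarrow> m"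
      using LIMSEQ_inverse_real_of_nat_add[of m] by (simp add: inverse_eq_divide)
    show "(\<lambda>k. G (Y k)) \<longlonglongrightarrow> G y"
      unfolding G_def by (intro tendsto_intros f.tendsto y)
    show "eventually (\<lambda>k. G (Y k) \<le> m + 1 / real (Suc k)) sequentially"
      using Y by (simp add: less_imp_le)
  qed
  then have min: "G y \<le> G z" for z
    using mle[of z] by simp
  have "Re (f x) = Re (cinner x y)" for x
  proof -
    have expand: "G (y + s *\<^sub>R x) = G y + 2 * s * (Re (cinner x y) - Re (f x)) + s\<^sup>2 * (norm x)\<^sup>2" for s
    proof -
      have "complex_of_real ((norm (y + s *\<^sub>R x))\<^sup>2) =
          cinner y y + s * (cinner x y + cinner y x) + s\<^sup>2 * cinner x x"
        unfolding cinner_norm[symmetric]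
        by (simp add: cinner_add_left cinner_add_right cinner_scaleR_left cinner_scaleR_right
            algebra_simps power2_eq_square)
      then have "(norm (y + s *\<^sub>R x))\<^sup>2 =
          Re (cinner y y + s * (cinner x y + cinner y x) + s\<^sup>2 * cinner x x)"
        by (metis Re_complex_of_real)
      also have "\<dots> = (norm y)\<^sup>2 + 2 * s * Re (cinner x y) + s\<^sup>2 * (norm x)\<^sup>2"
        using cinner_commute[of y x]
        by (simp add: cinner_norm algebra_simps del: of_real_power flip: of_real_mult)
      finally show ?thesis
        by (simp add: G_def f.add f.scaleR algebra_simps)
    qed
    define d where "d = Re (cinner x y) - Re (f x)"
    have "0 \<le> 2 * s * d + s\<^sup>2 * (norm x)\<^sup>2" for s
      using min[of "y + s *\<^sub>R x"] expand[of s] by (simp add: d_def)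
    note variation = this
    define t where "t = 1 / ((norm x)\<^sup>2 + 1)"
    have "(norm x)\<^sup>2 + 1 > 0"
      by (simp add: add_nonneg_pos)
    then have t: "t > 0" "t * (norm x)\<^sup>2 \<le> 1"
      by (simp_all add: t_def)
    have "(t * d\<^sup>2) * (t * (norm x)\<^sup>2) \<le> (t * d\<^sup>2) * 1"
      using t by (intro mult_left_mono) auto
    moreover have "0 \<le> - 2 * (t * d\<^sup>2) + (t * d\<^sup>2) * (t * (norm x)\<^sup>2)"
      using variation[of "- t * d"] by (simp add: power2_eq_square mult_ac)
    ultimately have "t * d\<^sup>2 \<le> 0"
      by linarith
    then have "d = 0"
      using t(1) by (simp add: mult_le_0_iff)
    then show ?thesis by (simp add: d_def)
  qed
  \<comment> \<open>The imaginary part is the real part at \<open>\<i> *\<^sub>C x\<close>.\<close>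
  then have "f x = cinner x y" for x
    using fC[of \<i> x] cinner_scaleC_left[of \<i> x y]
    by (metis Re_i_times complex_eq_iff neg_equal_iff_equal)
  then show ?thesis by blast
qed

lemma bounded_ops_apply: "T \<in> bounded_ops \<Longrightarrow> T (c *\<^sub>C x) = c *\<^sub>C T x"
  by (simp add: bounded_ops_def)

text \<open>The adjoint is defined by a description, which says nothing about it until an adjoint is known to
  exist.\<close>

lemma adjoint_exists:
  fixes T :: "'h::chilbert_space \<Rightarrow>\<^sub>L 'h"
  assumes T: "T \<in> bounded_ops"
  shows "\<exists>T' :: 'h \<Rightarrow>\<^sub>L 'h. \<forall>x y. cinner (T x) y = cinner x (T' y)"
proof -
  have "\<exists>z. \<forall>x. cinner (T x) y = cinner x z" for y
  proof (rule riesz_representation)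
    show "bounded_linear (\<lambda>x. cinner (T x) y)"
    proof (rule bounded_linear_intro)
      show "norm (cinner (T x) y) \<le> norm x * (norm T * norm y)" for x
      proof -
        have "norm (cinner (T x) y) \<le> norm (T x) * norm y"
          by (rule cinner_Cauchy_Schwarz)
        also have "\<dots> \<le> (norm T * norm x) * norm y"
          by (intro mult_right_mono norm_blinfun) auto
        finally show ?thesis by (simp add: mult_ac)
      qed
    qed (simp_all add: blinfun.add_right cinner_add_left blinfun.scaleR_right cinner_scaleR_left scaleR_conv_of_real)
  qed (simp add: bounded_ops_apply[OF T] cinner_scaleC_left)
  then obtain h where h: "\<And>x y. cinner (T x) y = cinner x (h y)"
    by metis
  have "bounded_linear h"
  proof (rule bounded_linear_intro)
    show "h (x + y) = h x + h y" for x y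
      by (rule cinner_eqI_right) (simp add: cinner_add_right flip: h)
    show "h (r *\<^sub>R x) = r *\<^sub>R h x" for r x
      by (rule cinner_eqI_right) (simp add: cinner_scaleR_right flip: h)
    show "norm (h y) \<le> norm y * norm T" for y
    proof -
      have "(norm (h y))\<^sup>2 = cmod (cinner (T (h y)) y)"
        by (simp add: h cinner_norm del: of_real_power)
      also have "\<dots> \<le> norm (T (h y)) * norm y"
        by (rule cinner_Cauchy_Schwarz)
      also have "\<dots> \<le> (norm T * norm (h y)) * norm y"
        by (intro mult_right_mono norm_blinfun) auto
      finally have "norm (h y) * norm (h y) \<le> norm (h y) * (norm y * norm T)"
        by (simp add: power2_eq_square mult_ac)
      then show ?thesis
        by (cases "norm (h y) = 0") auto
    qed
  qed
  then have "\<forall>x y. cinner (T x) y = cinner x (Blinfun h y)"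
    by (simp add: bounded_linear_Blinfun_apply h)
  then show ?thesis by blast
qed

lemma op_adj_eqI:
  fixes T T' :: "'h::chilbert_space \<Rightarrow>\<^sub>L 'h"
  assumes "\<And>x y. cinner (T x) y = cinner x (T' y)"
  shows "op_adj T = T'"
  unfolding op_adj_def
proof (rule the_equality)
  fix R :: "'h \<Rightarrow>\<^sub>L 'h"
  assume R: "\<forall>x y. cinner (T x) y = cinner x (R y)"
  have "blinfun_apply R y = T' y" for y
  proof (rule cinner_eqI_right)
    show "cinner x (R y) = cinner x (T' y)" for x
      using R assms[of x y] by simp
  qed
  then show "R = T'" by (rule blinfun_eqI)
qed (use assms in blast)

lemma op_adj_right:
  assumes "T \<in> bounded_ops"
  shows "cinner x (op_adj T y) = cinner (T x) y"
proof -
  obtain T' :: "'a \<Rightarrow>\<^sub>L 'a" where T': "\<And>x y. cinner (T x) y = cinner x (T' y)"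
    using adjoint_exists[OF assms] by blast
  then have "op_adj T = T'" by (rule op_adj_eqI)
  then show ?thesis using T' by simp
qed

lemma op_adj_left:
  assumes "T \<in> bounded_ops"
  shows "cinner (op_adj T x) y = cinner x (T y)"
  using op_adj_right[OF assms, of y x] cinner_commute[of "op_adj T x" y] cinner_commute[of "T y" x]
  by simp

lemma op_adj_bounded_ops: "T \<in> bounded_ops \<Longrightarrow> op_adj T \<in> bounded_ops"
proof -
  assume T: "T \<in> bounded_ops"
  have "op_adj T (c *\<^sub>C x) = c *\<^sub>C op_adj T x" for c x
    by (rule cinner_eqI) (simp add: op_adj_left[OF T] cinner_scaleC_left)
  then show ?thesis by (simp add: bounded_ops_def)
qed

lemma op_adj_op_adj: "T \<in> bounded_ops \<Longrightarrow> op_adj (op_adj T) = T"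
  by (rule op_adj_eqI) (simp add: op_adj_left)

lemma op_adj_compose:
  "T \<in> bounded_ops \<Longrightarrow> R \<in> bounded_ops \<Longrightarrow> op_adj (T o\<^sub>L R) = op_adj R o\<^sub>L op_adj T"
  by (rule op_adj_eqI) (simp add: op_adj_right)

lemma op_adj_diff:
  "T \<in> bounded_ops \<Longrightarrow> R \<in> bounded_ops \<Longrightarrow> op_adj (T - R) = op_adj T - op_adj R"
  by (rule op_adj_eqI) (simp add: op_adj_right cinner_diff_left cinner_diff_right blinfun.diff_left)

lemma norm_op_adj_le:
  assumes T: "T \<in> bounded_ops"
  shows "norm (op_adj T) \<le> norm (T :: 'h::chilbert_space \<Rightarrow>\<^sub>L 'h)"
proof (rule norm_blinfun_bound)
  fix y :: 'h
  let ?z = "op_adj T y"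
  have "(norm ?z)\<^sup>2 = cmod (cinner ?z ?z)"
    by (simp add: cinner_norm del: of_real_power)
  also have "\<dots> = cmod (cinner (T ?z) y)"
    by (simp add: op_adj_right T)
  also have "\<dots> \<le> norm (T ?z) * norm y"
    by (rule cinner_Cauchy_Schwarz)
  also have "\<dots> \<le> (norm T * norm ?z) * norm y"
    by (intro mult_right_mono norm_blinfun) auto
  finally have "norm ?z * norm ?z \<le> norm ?z * (norm T * norm y)"
    by (simp add: power2_eq_square mult_ac)
  then show "norm ?z \<le> norm T * norm y"
    by (cases "norm ?z = 0") auto
qed simp

lemma op_scale_apply [simp]: "op_scale c T x = c *\<^sub>C T x"
  by (simp add: op_scale_def)

lemma op_scale_of_real: "op_scale (complex_of_real r) T = r *\<^sub>R T"
  by (rule blinfun_eqI) (simp add: scaleR_scaleC blinfun.scaleR_left)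

lemma op_scale_op_scale: "op_scale c (op_scale d T) = op_scale (c * d) T"
  by (rule blinfun_eqI) (simp add: scaleC_scaleC)

lemma op_scale_add_left: "op_scale (c + d) T = op_scale c T + op_scale d T"
  by (rule blinfun_eqI) (simp add: scaleC_add_left blinfun.add_left)

lemma op_scale_zero_left [simp]: "op_scale 0 T = 0"
  by (rule blinfun_eqI) simp

lemma op_scale_one: "op_scale 1 T = T"
  using op_scale_of_real[of 1 T] by simp

lemma op_scale_minus_one: "op_scale (- 1) T = - T"
  using op_scale_of_real[of "- 1" T] by simp

text \<open>This makes the intersection defining the generated C*-algebra one of a nonempty family, so that its
  elements are complex-linear operators.\<close>

lemma cstar_algebra_bounded_ops: "cstar_algebra (bounded_ops :: ('h::chilbert_space \<Rightarrow>\<^sub>L 'h) set)"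
proof -
  have "closed (bounded_ops :: ('h \<Rightarrow>\<^sub>L 'h) set)"
    unfolding bounded_ops_def
    by (intro closed_Collect_all closed_Collect_eq continuous_intros
        bounded_linear.continuous_on[OF bounded_linear_scaleC])
  moreover have "T + R \<in> bounded_ops" if "T \<in> bounded_ops" "R \<in> bounded_ops" for T R :: "'h \<Rightarrow>\<^sub>L 'h"
    using that by (simp add: bounded_ops_def blinfun.add_left scaleC_add_right)
  ultimately show ?thesis
    unfolding cstar_algebra_def selfadjoint_operator_space_def
    by (auto simp: op_adj_bounded_ops)
       (auto simp: bounded_ops_def scaleC_scaleC mult.commute)
qed

lemma cstar_generated_superset: "S \<subseteq> cstar_generated S"
  by (auto simp: cstar_generated_def)

lemma cstar_generated_bounded_ops: "S \<subseteq> bounded_ops \<Longrightarrow> cstar_generated S \<subseteq> bounded_ops"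
  using cstar_algebra_bounded_ops by (auto simp: cstar_generated_def)

section \<open>The Hahn--Banach theorem\<close>

definition sublinear :: "('a::real_vector \<Rightarrow> real) \<Rightarrow> bool"
  where "sublinear p \<longleftrightarrow>
    (\<forall>x y. p (x + y) \<le> p x + p y) \<and> (\<forall>r\<ge>0. \<forall>x. p (r *\<^sub>R x) = r * p x)"

lemma sublinear_add: "sublinear p \<Longrightarrow> p (x + y) \<le> p x + p y"
  by (simp add: sublinear_def)

lemma sublinear_scaleR: "sublinear p \<Longrightarrow> 0 \<le> r \<Longrightarrow> p (r *\<^sub>R x) = r * p x"
  by (simp add: sublinear_def)

lemma sublinear_zero: "sublinear p \<Longrightarrow> p 0 = 0"
  using sublinear_scaleR[of p 0 0] by simp

lemma sublinear_lower: "sublinear p \<Longrightarrow> - p (- x) \<le> p x"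
  using sublinear_add[of p x "- x"] by (simp add: sublinear_zero)

lemma sublinearI:
  assumes add: "\<And>x y. p (x + y) \<le> p x + p y"
    and scale: "\<And>r x. 0 < r \<Longrightarrow> p (r *\<^sub>R x) \<le> r * p x"
    and zero: "p 0 = 0"
  shows "sublinear p"
  unfolding sublinear_def
proof (intro conjI allI impI)
  fix r :: real and x
  assume "0 \<le> r"
  show "p (r *\<^sub>R x) = r * p x"
  proof (cases "r = 0")
    case False
    with \<open>0 \<le> r\<close> have r: "r > 0" by simp
    then have "p ((1 / r) *\<^sub>R r *\<^sub>R x) \<le> 1 / r * p (r *\<^sub>R x)"
      by (intro scale) simp
    then have "r * p x \<le> p (r *\<^sub>R x)"
      using r by (simp add: field_simps)
    then show ?thesis
      using scale[OF r, of x] by simp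
  qed (simp add: zero)
qed (rule add)

lemma le_cINF_add:
  fixes f :: "'i \<Rightarrow> real" and g :: "'j \<Rightarrow> real"
  assumes "I \<noteq> {}" "J \<noteq> {}" and le: "\<And>i j. i \<in> I \<Longrightarrow> j \<in> J \<Longrightarrow> z \<le> f i + g j"
  shows "z \<le> (INF i\<in>I. f i) + (INF j\<in>J. g j)"
proof -
  have "z - f i \<le> (INF j\<in>J. g j)" if "i \<in> I" for i
    using le[OF that] assms(2) by (intro cINF_greatest) (auto simp: algebra_simps)
  then have "z - (INF j\<in>J. g j) \<le> (INF i\<in>I. f i)"
    using assms(1) by (intro cINF_greatest) (auto simp: algebra_simps)
  then show ?thesis by simp
qed

lemma le_cINF_mult:
  fixes f :: "'i \<Rightarrow> real"
  assumes "I \<noteq> {}" "0 < r" and le: "\<And>i. i \<in> I \<Longrightarrow> z \<le> r * f i"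
  shows "z \<le> r * (INF i\<in>I. f i)"
proof -
  have "z / r \<le> (INF i\<in>I. f i)"
    using assms by (intro cINF_greatest) (auto simp: field_simps)
  then show ?thesis using assms(2) by (simp add: field_simps)
qed

text \<open>If \<open>q\<close> is minimal then it equals the sublinear functional
  \<open>\<lambda>x. INF t\<ge>0. q (x + t *\<^sub>R y) - t * q y\<close> below it; taking \<open>t = 1\<close> shows that \<open>q\<close> is
  superadditive.\<close>

lemma minimal_sublinear_linear:
  assumes q: "sublinear q" and min: "\<And>q'. sublinear q' \<Longrightarrow> (\<And>x. q' x \<le> q x) \<Longrightarrow> q' = q"
  shows "linear q"
proof -
  have super: "q x + q y \<le> q (x + y)" for x y
  proof -
    define f where "f x t = q (x + t *\<^sub>R y) - t * q y" for x t
    define q' where "q' x = (INF t\<in>{0..}. f x t)" for x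
    have lower: "- q (- x) \<le> f x t" if "0 \<le> t" for x t
      using sublinear_add[OF q, of "x + t *\<^sub>R y" "- x"] sublinear_scaleR[OF q that, of y]
      by (simp add: f_def)
    have q'_le: "q' x \<le> f x t" if "0 \<le> t" for x t
      unfolding q'_def using lower that by (intro cINF_lower bdd_belowI2[of _ "- q (- x)"]) auto
    have ne: "{0::real..} \<noteq> {}" by auto
    have "sublinear q'"
    proof (rule sublinearI)
      fix x z
      show "q' (x + z) \<le> q' x + q' z"
        unfolding q'_def[of x] q'_def[of z]
      proof (rule le_cINF_add[OF ne ne])
        fix s t :: real assume "s \<in> {0..}" "t \<in> {0..}"
        then have "q' (x + z) \<le> f (x + z) (s + t)" by (intro q'_le) auto
        also have "\<dots> \<le> f x s + f z t"
          using sublinear_add[OF q, of "x + s *\<^sub>R y" "z + t *\<^sub>R y"]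
          by (simp add: f_def algebra_simps)
        finally show "q' (x + z) \<le> f x s + f z t" .
      qed
    next
      fix r :: real and x assume r: "0 < r"
      show "q' (r *\<^sub>R x) \<le> r * q' x"
        unfolding q'_def[of x]
      proof (rule le_cINF_mult[OF ne r])
        fix t :: real assume "t \<in> {0..}"
        then have "q' (r *\<^sub>R x) \<le> f (r *\<^sub>R x) (r * t)"
          using r by (intro q'_le) auto
        also have "\<dots> = r * f x t"
          using sublinear_scaleR[OF q, of r "x + t *\<^sub>R y"] r by (simp add: f_def algebra_simps)
        finally show "q' (r *\<^sub>R x) \<le> r * f x t" .
      qed
    next
      have "0 \<le> q' 0"
        unfolding q'_def using lower[of _ 0] sublinear_zero[OF q] by (intro cINF_greatest) auto
      moreover have "q' 0 \<le> 0"
        using q'_le[of 0 0] sublinear_zero[OF q] by (simp add: f_def)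
      ultimately show "q' 0 = 0" by simp
    qed
    moreover have "q' x \<le> q x" for x
      using q'_le[of 0 x] by (simp add: f_def)
    ultimately have "q' = q" by (rule min)
    then show ?thesis
      using q'_le[of 1 x] by (simp add: f_def)
  qed
  then have add: "q (x + y) = q x + q y" for x y
    using sublinear_add[OF q] by (simp add: antisym)
  have neg: "q (- x) = - q x" for x
    using add[of x "- x"] sublinear_zero[OF q] by simp
  show ?thesis
  proof (rule linearI)
    show "q (r *\<^sub>R x) = r *\<^sub>R q x" for r x
    proof (cases "0 \<le> r")
      case False
      then have "q ((- r) *\<^sub>R x) = (- r) * q x"
        by (intro sublinear_scaleR[OF q]) simp
      then show ?thesis using neg[of "r *\<^sub>R x"] by simp
    qed (simp add: sublinear_scaleR[OF q])
  qed (rule add)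
qed

text \<open>A minimal sublinear functional below \<open>p\<close> exists by Zorn's lemma: the pointwise infimum of a chain
  is finite because every member is at least \<open>- p (- x)\<close> at \<open>x\<close>, and it is subadditive because of two
  members one lies below the other.\<close>

lemma linear_below_sublinear:
  assumes p: "sublinear p"
  shows "\<exists>g. linear g \<and> (\<forall>x. g x \<le> p x)"
proof -
  define A where "A = {q. sublinear q \<and> (\<forall>x. q x \<le> p x)}"
  define P where "P q r \<longleftrightarrow> (\<forall>x. r x \<le> q x)" for q r :: "'a \<Rightarrow> real"
  have "\<exists>m\<in>A. \<forall>a\<in>A. P m a \<longrightarrow> a = m"
  proof (rule predicate_Zorn)
    show "partial_order_on A (relation_of P A)"
      by (rule partial_order_on_relation_ofI) (auto simp: P_def fun_eq_iff intro: order_trans antisym)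
    fix C assume C: "C \<in> Chains (relation_of P A)"
    then have CA: "C \<subseteq> A" and tot: "\<And>q r. q \<in> C \<Longrightarrow> r \<in> C \<Longrightarrow> P q r \<or> P r q"
      unfolding Chains_def relation_of_def by blast+
    show "\<exists>u\<in>A. \<forall>a\<in>C. P a u"
    proof (cases "C = {}")
      case True
      then show ?thesis using p by (auto simp: A_def)
    next
      case False
      define u where "u x = (INF q\<in>C. q x)" for x
      have sub: "sublinear q" and le_p: "q x \<le> p x" if "q \<in> C" for q x
        using that CA by (auto simp: A_def)
      have "- p (- x) \<le> q x" if "q \<in> C" for q x
        using sublinear_lower[OF sub[OF that], of x] le_p[OF that, of "- x"] by simp
      then have u_le: "u x \<le> q x" if "q \<in> C" for q x
        unfolding u_def using that by (intro cINF_lower bdd_belowI2[of _ "- p (- x)"]) auto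
      have "sublinear u"
      proof (rule sublinearI)
        fix x y
        show "u (x + y) \<le> u x + u y"
          unfolding u_def[of x] u_def[of y]
        proof (rule le_cINF_add[OF False False])
          fix q r assume q: "q \<in> C" and r: "r \<in> C"
          obtain m where m: "m \<in> C" "P q m" "P r m"
            using tot[OF q r] q r by (auto simp: P_def)
          have "u (x + y) \<le> m x + m y"
            using u_le[OF m(1)] sublinear_add[OF sub[OF m(1)]] by (rule order_trans)
          also have "\<dots> \<le> q x + r y"
            using m(2,3) by (intro add_mono) (auto simp: P_def)
          finally show "u (x + y) \<le> q x + r y" .
        qed
      next
        fix r :: real and x assume r: "0 < r"
        show "u (r *\<^sub>R x) \<le> r * u x"
          unfolding u_def[of x]
        proof (rule le_cINF_mult[OF False r])
          fix q assume "q \<in> C"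
          then show "u (r *\<^sub>R x) \<le> r * q x"
            using u_le[of q "r *\<^sub>R x"] sublinear_scaleR[OF sub, of q r x] r by simp
        qed
      next
        show "u 0 = 0"
        proof -
          have "(\<lambda>q. q 0) ` C = {0}"
            using False sublinear_zero[OF sub] by force
          then show ?thesis by (simp add: u_def)
        qed
      qed
      moreover have "u x \<le> p x" for x
        using False u_le le_p order_trans by blast
      ultimately show ?thesis
        using u_le by (auto simp: A_def P_def)
    qed
  qed
  then obtain m where m: "m \<in> A" and min: "\<And>a. a \<in> A \<Longrightarrow> P m a \<Longrightarrow> a = m"
    by blast
  have "linear m"
  proof (rule minimal_sublinear_linear)
    fix q' assume "sublinear q'" "\<And>x. q' x \<le> m x"
    moreover from this have "q' \<in> A"
      using m unfolding A_def by (blast intro: order_trans)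
    ultimately show "q' = m"
      by (intro min) (auto simp: P_def)
  qed (use m in \<open>simp add: A_def\<close>)
  then show ?thesis
    using m by (auto simp: A_def)
qed

text \<open>The dominated extension of \<open>f\<close> is any linear functional below the sublinear functional
  \<open>\<lambda>x. INF v\<in>V. f v + p (x - v)\<close>, which is at most \<open>p\<close> everywhere and at most \<open>f\<close> on \<open>V\<close>.\<close>

theorem hahn_banach:
  fixes p :: "'a::real_vector \<Rightarrow> real"
  assumes p: "sublinear p" and V: "subspace V"
    and f_add: "\<And>x y. x \<in> V \<Longrightarrow> y \<in> V \<Longrightarrow> f (x + y) = f x + f y"
    and f_scale: "\<And>r x. x \<in> V \<Longrightarrow> f (r *\<^sub>R x) = r * f x"
    and f_le: "\<And>x. x \<in> V \<Longrightarrow> f x \<le> p x"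
  shows "\<exists>g. linear g \<and> (\<forall>x\<in>V. g x = f x) \<and> (\<forall>x. g x \<le> p x)"
proof -
  define h where "h x v = f v + p (x - v)" for x v
  define p' where "p' x = (INF v\<in>V. h x v)" for x
  have ne: "V \<noteq> {}"
    using subspace_0[OF V] by auto
  have f_minus: "f (- v) = - f v" if "v \<in> V" for v
    using f_scale[OF that, of "-1"] by simp
  have lower: "- p (- x) \<le> h x v" if "v \<in> V" for x v
    using f_le[OF subspace_neg[OF V that]] sublinear_add[OF p, of "- x" "x - v"]
    by (simp add: h_def f_minus[OF that])
  have p'_le: "p' x \<le> h x v" if "v \<in> V" for x v
    unfolding p'_def using lower that by (intro cINF_lower bdd_belowI2[of _ "- p (- x)"]) auto
  have "sublinear p'"
  proof (rule sublinearI)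
    fix x y
    show "p' (x + y) \<le> p' x + p' y"
      unfolding p'_def[of x] p'_def[of y]
    proof (rule le_cINF_add[OF ne ne])
      fix v w assume vw: "v \<in> V" "w \<in> V"
      then have "p' (x + y) \<le> h (x + y) (v + w)"
        by (intro p'_le subspace_add[OF V])
      also have "\<dots> \<le> h x v + h y w"
        using sublinear_add[OF p, of "x - v" "y - w"] by (simp add: h_def f_add vw algebra_simps)
      finally show "p' (x + y) \<le> h x v + h y w" .
    qed
  next
    fix r :: real and x assume r: "0 < r"
    show "p' (r *\<^sub>R x) \<le> r * p' x"
      unfolding p'_def[of x]
    proof (rule le_cINF_mult[OF ne r])
      fix v assume v: "v \<in> V"
      then have "p' (r *\<^sub>R x) \<le> h (r *\<^sub>R x) (r *\<^sub>R v)"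
        by (intro p'_le subspace_scale[OF V])
      also have "\<dots> = r * h x v"
        using sublinear_scaleR[OF p, of r "x - v"] r by (simp add: h_def f_scale v algebra_simps)
      finally show "p' (r *\<^sub>R x) \<le> r * h x v" .
    qed
  next
    have "0 \<le> p' 0"
      unfolding p'_def using lower[of _ 0] sublinear_zero[OF p] ne by (intro cINF_greatest) auto
    moreover have "p' 0 \<le> 0"
      using p'_le[OF subspace_0[OF V], of 0] sublinear_zero[OF p] f_scale[OF subspace_0[OF V], of 0]
      by (simp add: h_def)
    ultimately show "p' 0 = 0" by simp
  qed
  then obtain g where g: "linear g" "\<And>x. g x \<le> p' x"
    using linear_below_sublinear by blast
  have g_le: "g v \<le> f v" if "v \<in> V" for v
    using g(2)[of v] p'_le[OF that, of v] sublinear_zero[OF p] by (simp add: h_def)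
  have "g v = f v" if "v \<in> V" for v
    using g_le[OF that] g_le[OF subspace_neg[OF V that]] linear_neg[OF g(1)] f_minus[OF that]
    by fastforce
  moreover have "g x \<le> p x" for x
    using g(2)[of x] p'_le[OF subspace_0[OF V], of x] f_scale[OF subspace_0[OF V], of 0]
    by (simp add: h_def)
  ultimately show ?thesis using g(1) by blast
qed

section \<open>Operator matrices\<close>

abbreviation vec_norm :: "nat \<Rightarrow> (nat \<Rightarrow> 'h::real_normed_vector) \<Rightarrow> real"
  where "vec_norm n x \<equiv> L2_set (\<lambda>i. norm (x i)) {..<n}"

text \<open>The matrix enters as a function on index pairs, so that the form is additive and homogeneous in it
  without conditions on dimensions.\<close>

definition mat_form ::
    "nat \<Rightarrow> (nat \<times> nat \<Rightarrow> 'h::chilbert_space \<Rightarrow>\<^sub>L 'h) \<Rightarrow> (nat \<Rightarrow> 'h) \<Rightarrow> (nat \<Rightarrow> 'h) \<Rightarrow> complex"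
  where "mat_form n M x y = (\<Sum>i<n. cinner (\<Sum>j<n. M (i, j) (x j)) (y i))"

lemma mat_form_cong:
  "(\<And>i j. i < n \<Longrightarrow> j < n \<Longrightarrow> M (i, j) = M' (i, j)) \<Longrightarrow> mat_form n M x y = mat_form n M' x y"
  by (simp add: mat_form_def)

lemma mat_form_mat [simp]: "mat_form n (($$) (mat n n M)) x y = mat_form n M x y"
  by (rule mat_form_cong) simp

lemma mat_form_add:
  "mat_form n (\<lambda>ij. M ij + M' ij) x y = mat_form n M x y + mat_form n M' x y"
  by (simp add: mat_form_def blinfun.add_left sum.distrib cinner_add_left)

lemma mat_form_scaleR: "mat_form n (\<lambda>ij. r *\<^sub>R M ij) x y = r * mat_form n M x y"
  by (simp add: mat_form_def blinfun.scaleR_left cinner_scaleR_left sum_distrib_left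
      flip: scaleR_sum_right)

lemma mat_form_op_scale: "mat_form n (\<lambda>ij. op_scale c (M ij)) x y = c * mat_form n M x y"
  by (simp add: mat_form_def cinner_scaleC_left sum_distrib_left flip: scaleC_sum_right)

lemma mat_form_scaled_vectors:
  "mat_form n M (\<lambda>i. r *\<^sub>R x i) (\<lambda>i. r *\<^sub>R y i) = r\<^sup>2 * mat_form n M x y"
  by (simp add: mat_form_def blinfun.scaleR_right cinner_scaleR_left cinner_scaleR_right
      sum_distrib_left power2_eq_square mult.assoc flip: scaleR_sum_right)

lemma mat_form_adjoint:
  assumes "\<And>i j. i < n \<Longrightarrow> j < n \<Longrightarrow> M (i, j) \<in> bounded_ops"
  shows "mat_form n (\<lambda>(i, j). op_adj (M (j, i))) x y = cnj (mat_form n M y x)"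
proof -
  have "mat_form n (\<lambda>(i, j). op_adj (M (j, i))) x y
      = (\<Sum>i<n. \<Sum>j<n. cinner (x j) (M (j, i) (y i)))"
    using assms by (simp add: mat_form_def cinner_sum_left op_adj_left)
  also have "\<dots> = (\<Sum>j<n. \<Sum>i<n. cnj (cinner (M (j, i) (y i)) (x j)))"
    by (subst sum.swap) (simp flip: cinner_commute)
  also have "\<dots> = cnj (mat_form n M y x)"
    by (simp add: mat_form_def cinner_sum_left)
  finally show ?thesis .
qed

lemma op_mat_pos_iff:
  "X \<in> carrier_mat n n \<Longrightarrow> op_mat_pos X \<longleftrightarrow> (\<forall>x. mat_form n (($$) X) x x \<in> \<real>\<^sub>\<ge>\<^sub>0)"
  by (auto simp: op_mat_pos_def mat_form_def)

lemma mat_form_self: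
  "mat_form n M x (\<lambda>i. \<Sum>j<n. M (i, j) (x j)) =
    complex_of_real ((vec_norm n (\<lambda>i. \<Sum>j<n. M (i, j) (x j)))\<^sup>2)"
  by (simp add: mat_form_def cinner_norm L2_set_def sum_nonneg del: of_real_power)

lemma vec_norm_le_1_entry: "vec_norm n x \<le> 1 \<Longrightarrow> j < n \<Longrightarrow> norm (x j) \<le> 1"
  using member_le_L2_set[of "{..<n}" j "\<lambda>i. norm (x i)"] by auto

lemma vec_norm_scaleR: "vec_norm n (\<lambda>i. r *\<^sub>R x i) = \<bar>r\<bar> * vec_norm n x"
  by (simp add: L2_set_right_distrib)

lemma vec_norm_eq_0: "vec_norm n x = 0 \<Longrightarrow> i < n \<Longrightarrow> x i = 0"
  using L2_set_eq_0_iff[of "{..<n}" "\<lambda>i. norm (x i)"] by auto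

lemma op_mat_norm_set_bound:
  fixes M :: "nat \<times> nat \<Rightarrow> 'h::chilbert_space \<Rightarrow>\<^sub>L 'h"
  assumes "vec_norm n x \<le> 1"
  shows "L2_set (\<lambda>i. norm (\<Sum>j<n. M (i, j) (x j))) {..<n} \<le> (\<Sum>i<n. \<Sum>j<n. norm (M (i, j)))"
proof -
  have "L2_set (\<lambda>i. norm (\<Sum>j<n. M (i, j) (x j))) {..<n} \<le> (\<Sum>i<n. norm (\<Sum>j<n. M (i, j) (x j)))"
    by (rule L2_set_le_sum) simp
  also have "\<dots> \<le> (\<Sum>i<n. \<Sum>j<n. norm (M (i, j)))"
  proof (intro sum_mono order_trans[OF norm_sum])
    fix i j assume "j \<in> {..<n}"
    then have "norm (M (i, j)) * norm (x j) \<le> norm (M (i, j)) * 1"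
      using assms by (intro mult_left_mono vec_norm_le_1_entry) auto
    then show "norm (M (i, j) (x j)) \<le> norm (M (i, j))"
      using norm_blinfun[of "M (i, j)" "x j"] by simp
  qed
  finally show ?thesis .
qed

lemma op_mat_norm_le:
  fixes X :: "('h::chilbert_space \<Rightarrow>\<^sub>L 'h) mat"
  assumes X: "X \<in> carrier_mat n n"
    and le: "\<And>x. vec_norm n x \<le> 1 \<Longrightarrow> vec_norm n (\<lambda>i. \<Sum>j<n. (X $$ (i, j)) (x j)) \<le> B"
  shows "op_mat_norm X \<le> B"
  unfolding op_mat_norm_def using X
proof (intro cSUP_least)
  show "{x :: nat \<Rightarrow> 'h. vec_norm (dim_col X) x \<le> 1} \<noteq> {}"
    by (auto intro!: exI[of _ "\<lambda>_. 0"] simp: L2_set_def)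
qed (use le in auto)

lemma op_mat_norm_upper:
  fixes X :: "('h::chilbert_space \<Rightarrow>\<^sub>L 'h) mat"
  assumes X: "X \<in> carrier_mat n n" and x: "vec_norm n x \<le> 1"
  shows "vec_norm n (\<lambda>i. \<Sum>j<n. (X $$ (i, j)) (x j)) \<le> op_mat_norm X"
  unfolding op_mat_norm_def
proof (rule cSUP_upper2[where x = x])
  show "bdd_above ((\<lambda>x. vec_norm (dim_row X) (\<lambda>i. \<Sum>j<dim_col X. (X $$ (i, j)) (x j)))
      ` {x :: nat \<Rightarrow> 'h. vec_norm (dim_col X) x \<le> 1})"
    using X op_mat_norm_set_bound[where n = n and M = "($$) X"]
    by (intro bdd_aboveI2[where M = "\<Sum>i<n. \<Sum>j<n. norm (X $$ (i, j))"]) auto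
qed (use X x in auto)

lemma op_mat_norm_apply:
  fixes X :: "('h::chilbert_space \<Rightarrow>\<^sub>L 'h) mat"
  assumes X: "X \<in> carrier_mat n n"
  shows "vec_norm n (\<lambda>i. \<Sum>j<n. (X $$ (i, j)) (x j)) \<le> op_mat_norm X * vec_norm n x"
proof -
  note unit = op_mat_norm_upper[OF X]
  show ?thesis
  proof (cases "vec_norm n x = 0")
    case True
    then have "x j = 0" if "j < n" for j
      using vec_norm_eq_0 that by blast
    then show ?thesis using True by (simp add: L2_set_def)
  next
    case False
    define r where "r = vec_norm n x"
    have r: "r > 0"
      using False L2_set_nonneg[of "\<lambda>i. norm (x i)" "{..<n}"] unfolding r_def by linarith
    have "vec_norm n (\<lambda>i. (1 / r) *\<^sub>R x i) \<le> 1"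
      using r by (simp add: vec_norm_scaleR r_def del: norm_scaleR)
    from unit[OF this] have "vec_norm n (\<lambda>i. (1 / r) *\<^sub>R (\<Sum>j<n. (X $$ (i, j)) (x j))) \<le> op_mat_norm X"
      by (simp add: blinfun.scaleR_right scaleR_sum_right del: norm_scaleR)
    then show ?thesis
      using r unfolding vec_norm_scaleR by (simp add: r_def field_simps)
  qed
qed

lemma op_mat_norm_nonneg: "X \<in> carrier_mat n n \<Longrightarrow> 0 \<le> op_mat_norm X"
  using op_mat_norm_upper[where x = "\<lambda>_. 0" and X = X] by (simp add: L2_set_def)

lemma op_mat_norm_le_sum:
  "X \<in> carrier_mat n n \<Longrightarrow> op_mat_norm X \<le> (\<Sum>i<n. \<Sum>j<n. norm (X $$ (i, j)))"
  using op_mat_norm_le op_mat_norm_set_bound[where n = n and M = "($$) X"] by blast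

lemma mat_form_le:
  assumes X: "X \<in> carrier_mat n n"
  shows "cmod (mat_form n (($$) X) x y) \<le> op_mat_norm X * vec_norm n x * vec_norm n y"
proof -
  let ?z = "\<lambda>i. \<Sum>j<n. (X $$ (i, j)) (x j)"
  have "cmod (mat_form n (($$) X) x y) \<le> (\<Sum>i<n. norm (?z i) * norm (y i))"
    unfolding mat_form_def by (intro order_trans[OF norm_sum] sum_mono cinner_Cauchy_Schwarz)
  also have "\<dots> \<le> vec_norm n ?z * vec_norm n y"
    using L2_set_mult_ineq[of "\<lambda>i. norm (?z i)" "\<lambda>i. norm (y i)" "{..<n}"] by simp
  also have "\<dots> \<le> (op_mat_norm X * vec_norm n x) * vec_norm n y"
    by (intro mult_right_mono op_mat_norm_apply X L2_set_nonneg)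
  finally show ?thesis .
qed

text \<open>The form at the pair \<open>x\<close>, \<open>X x\<close> is the square of the norm of \<open>X x\<close>.\<close>

lemma op_mat_norm_le_form:
  fixes X :: "('h::chilbert_space \<Rightarrow>\<^sub>L 'h) mat"
  assumes X: "X \<in> carrier_mat n n" and "0 \<le> B"
    and le: "\<And>x y. cmod (mat_form n (($$) X) x y) \<le> B * vec_norm n x * vec_norm n y"
  shows "op_mat_norm X \<le> B"
proof (rule op_mat_norm_le[OF X])
  fix x :: "nat \<Rightarrow> 'h" assume x: "vec_norm n x \<le> 1"
  let ?z = "\<lambda>i. \<Sum>j<n. (X $$ (i, j)) (x j)"
  have "(vec_norm n ?z)\<^sup>2 = cmod (mat_form n (($$) X) x ?z)"
    using mat_form_self[of n "($$) X" x] by (simp del: of_real_power)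
  also have "\<dots> \<le> (B * vec_norm n x) * vec_norm n ?z"
    using le by simp
  also have "\<dots> \<le> (B * 1) * vec_norm n ?z"
    using x \<open>0 \<le> B\<close> by (intro mult_right_mono mult_left_mono L2_set_nonneg)
  finally show "vec_norm n ?z \<le> B"
    using L2_set_nonneg[of "\<lambda>i. norm (?z i)" "{..<n}"]
    by (cases "vec_norm n ?z = 0") (auto simp: power2_eq_square \<open>0 \<le> B\<close>)
qed

subsection \<open>The numerical bound\<close>

text \<open>The supremum of the real part of the numerical range.  Being one-sided it vanishes at negative and at
  antiselfadjoint matrices, so a linear functional dominated by a multiple of it is automatically
  positive and selfadjoint, as well as bounded.\<close>

definition numerical_sup :: "nat \<Rightarrow> (nat \<times> nat \<Rightarrow> 'h::chilbert_space \<Rightarrow>\<^sub>L 'h) \<Rightarrow> real"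
  where "numerical_sup n M = (SUP x \<in> {x. vec_norm n x \<le> 1}. Re (mat_form n M x x))"

lemma numerical_sup_upper_unit:
  fixes M :: "nat \<times> nat \<Rightarrow> 'h::chilbert_space \<Rightarrow>\<^sub>L 'h"
  assumes "vec_norm n x \<le> 1"
  shows "Re (mat_form n M x x) \<le> numerical_sup n M"
  unfolding numerical_sup_def
proof (intro cSUP_upper bdd_aboveI2)
  fix y :: "nat \<Rightarrow> 'h" assume "y \<in> {y. vec_norm n y \<le> 1}"
  then have y: "vec_norm n y * vec_norm n y \<le> 1"
    by (intro mult_le_one L2_set_nonneg) auto
  have "Re (mat_form n M y y) \<le> op_mat_norm (mat n n M) * (vec_norm n y * vec_norm n y)"
    using mat_form_le[of "mat n n M" n y y] complex_Re_le_cmod[of "mat_form n M y y"]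
    by (simp add: mult.assoc)
  also have "\<dots> \<le> op_mat_norm (mat n n M)"
    using y op_mat_norm_nonneg[of "mat n n M" n] by (intro mult_right_le_one_le) auto
  finally show "Re (mat_form n M y y) \<le> op_mat_norm (mat n n M)" .
qed (use assms in auto)

lemma numerical_sup_upper: "Re (mat_form n M x x) \<le> numerical_sup n M * (vec_norm n x)\<^sup>2"
proof (cases "vec_norm n x = 0")
  case True
  then have "x j = 0" if "j < n" for j
    using vec_norm_eq_0 that by blast
  then show ?thesis using True by (simp add: mat_form_def)
next
  case False
  define r where "r = vec_norm n x"
  have r: "r > 0"
    using False L2_set_nonneg[of "\<lambda>i. norm (x i)" "{..<n}"] unfolding r_def by linarith
  have "vec_norm n (\<lambda>i. (1 / r) *\<^sub>R x i) \<le> 1"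
    using r by (simp add: vec_norm_scaleR r_def del: norm_scaleR)
  from numerical_sup_upper_unit[OF this, of M]
  have "(1 / r)\<^sup>2 * Re (mat_form n M x x) \<le> numerical_sup n M"
    by (simp add: mat_form_scaled_vectors del: of_real_power of_real_divide flip: of_real_power)
  then show ?thesis
    using r by (simp add: r_def field_simps)
qed

lemma numerical_sup_le:
  assumes "\<And>x. vec_norm n x \<le> 1 \<Longrightarrow> Re (mat_form n M x x) \<le> B"
  shows "numerical_sup n M \<le> B"
  unfolding numerical_sup_def
proof (rule cSUP_least)
  show "{x :: nat \<Rightarrow> 'a. vec_norm n x \<le> 1} \<noteq> {}"
    by (auto intro!: exI[of _ "\<lambda>_. 0"] simp: L2_set_def)
qed (use assms in auto)

lemma numerical_sup_nonneg: "0 \<le> numerical_sup n M"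
  using numerical_sup_upper_unit[where n = n and x = "\<lambda>_. 0" and M = M] by (simp add: mat_form_def L2_set_def)

lemma numerical_sup_nonpos:
  "(\<And>x. Re (mat_form n M x x) \<le> 0) \<Longrightarrow> numerical_sup n M = 0"
  using numerical_sup_le[of n M 0] numerical_sup_nonneg[of n M] by fastforce

lemma lookup_scaleR: "Poly_Mapping.lookup (r *\<^sub>R m) k = r *\<^sub>R Poly_Mapping.lookup m k"
proof -
  have "finite {k. r *\<^sub>R Poly_Mapping.lookup m k \<noteq> 0}"
    by (rule finite_subset[OF _ finite_lookup[of m]]) auto
  then show ?thesis
    by (simp add: scaleR_poly_mapping_def lookup_Abs_poly_mapping)
qed

lemma sublinear_numerical_sup:
  fixes c :: real
  assumes "0 \<le> c"
  shows "sublinear (\<lambda>m :: nat \<times> nat \<Rightarrow>\<^sub>0 ('h::chilbert_space \<Rightarrow>\<^sub>L 'h).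
    c * numerical_sup n (Poly_Mapping.lookup m))"
proof (rule sublinearI)
  fix m m' :: "nat \<times> nat \<Rightarrow>\<^sub>0 ('h \<Rightarrow>\<^sub>L 'h)"
  have "numerical_sup n (Poly_Mapping.lookup (m + m')) \<le>
      numerical_sup n (Poly_Mapping.lookup m) + numerical_sup n (Poly_Mapping.lookup m')"
    by (rule numerical_sup_le)
       (simp add: lookup_add[abs_def] mat_form_add add_mono numerical_sup_upper_unit)
  then show "c * numerical_sup n (Poly_Mapping.lookup (m + m')) \<le>
      c * numerical_sup n (Poly_Mapping.lookup m) + c * numerical_sup n (Poly_Mapping.lookup m')"
    using assms by (metis distrib_left mult_left_mono)
next
  fix r :: real and m :: "nat \<times> nat \<Rightarrow>\<^sub>0 ('h \<Rightarrow>\<^sub>L 'h)"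
  assume r: "0 < r"
  have eq: "Poly_Mapping.lookup (r *\<^sub>R m) = (\<lambda>ij. r *\<^sub>R Poly_Mapping.lookup m ij)"
    by (simp add: fun_eq_iff lookup_scaleR)
  have "numerical_sup n (Poly_Mapping.lookup (r *\<^sub>R m)) \<le> r * numerical_sup n (Poly_Mapping.lookup m)"
    unfolding eq by (rule numerical_sup_le) (use r in \<open>simp add: mat_form_scaleR numerical_sup_upper_unit\<close>)
  then show "c * numerical_sup n (Poly_Mapping.lookup (r *\<^sub>R m)) \<le> r * (c * numerical_sup n (Poly_Mapping.lookup m))"
    using assms by (metis mult.left_commute mult_left_mono)
next
  show "c * numerical_sup n (Poly_Mapping.lookup (0 :: nat \<times> nat \<Rightarrow>\<^sub>0 ('h \<Rightarrow>\<^sub>L 'h))) = 0"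
    by (simp add: numerical_sup_nonpos mat_form_def)
qed

section \<open>Completely positive contractive functionals\<close>

definition op_mats :: "('h::chilbert_space \<Rightarrow>\<^sub>L 'h) set \<Rightarrow> nat \<Rightarrow> ('h \<Rightarrow>\<^sub>L 'h) mat set"
  where "op_mats S n = {X \<in> carrier_mat n n. \<forall>i<n. \<forall>j<n. X $$ (i, j) \<in> S}"

definition mat_adj :: "('h::chilbert_space \<Rightarrow>\<^sub>L 'h) mat \<Rightarrow> ('h \<Rightarrow>\<^sub>L 'h) mat"
  where "mat_adj X = mat (dim_col X) (dim_row X) (\<lambda>(i, j). op_adj (X $$ (j, i)))"

lemma mats_operator_space [simp]: "mats (operator_space S) n = op_mats S n"
  by (simp add: mats_def operator_space_def op_mats_def)

lemma operator_space_sel [simp]: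
  "elems (operator_space S) = S" "vadd (operator_space S) = (+)"
  "vscale (operator_space S) = op_scale" "vstar (operator_space S) = op_adj"
  "mpos (operator_space S) = op_mat_pos" "mnorm (operator_space S) = op_mat_norm"
  by (simp_all add: operator_space_def)

lemma mstar_operator_space [simp]: "mstar (operator_space S) X = mat_adj X"
  by (simp add: mstar_def mat_adj_def)

lemma matrix_space_sel [simp]:
  "elems (matrix_space n V) = mats V n"
  "vadd (matrix_space n V) = (\<lambda>X Y. mat n n (\<lambda>ij. vadd V (X $$ ij) (Y $$ ij)))"
  "vscale (matrix_space n V) = (\<lambda>c. map_mat (vscale V c))"
  "vstar (matrix_space n V) = mstar V"
  "mpos (matrix_space n V) = (\<lambda>X. mpos V (flatten_mat n X))"
  "mnorm (matrix_space n V) = (\<lambda>X. mnorm V (flatten_mat n X))"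
  by (simp_all add: matrix_space_def)

lemma scalars_sel [simp]:
  "elems scalars = UNIV" "vadd scalars = (+)" "vscale scalars = (*)" "vstar scalars = cnj"
  "mpos scalars = (\<lambda>a. op_mat_pos (map_mat scalar_op a :: (complex \<Rightarrow>\<^sub>L complex) mat))"
  "mnorm scalars = (\<lambda>a. op_mat_norm (map_mat scalar_op a :: (complex \<Rightarrow>\<^sub>L complex) mat))"
  by (simp_all add: scalars_def)

lemma mat_form_scalar:
  assumes "a \<in> carrier_mat n n"
  shows "mat_form n (($$) (map_mat scalar_op a :: (complex \<Rightarrow>\<^sub>L complex) mat)) z w
    = (\<Sum>i<n. \<Sum>j<n. a $$ (i, j) * z j * cnj (w i))"
  using assms by (simp add: mat_form_def cinner_complex_def scaleC_complex_def sum_distrib_right)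

lemma mats_matrix_space:
  "mats (matrix_space n V) k = {Z \<in> carrier_mat k k. \<forall>i<k. \<forall>j<k. Z $$ (i, j) \<in> mats V n}"
  by (simp add: mats_def)

lemma op_mats_carrier: "X \<in> op_mats S n \<Longrightarrow> X \<in> carrier_mat n n"
  by (simp add: op_mats_def)

lemma op_mats_entry: "X \<in> op_mats S n \<Longrightarrow> i < n \<Longrightarrow> j < n \<Longrightarrow> X $$ (i, j) \<in> S"
  by (simp add: op_mats_def)

lemma op_mats_mono: "S \<subseteq> T \<Longrightarrow> X \<in> op_mats S n \<Longrightarrow> X \<in> op_mats T n"
  by (auto simp: op_mats_def)

lemma mat_in_op_mats: "mat n n f \<in> op_mats S n \<longleftrightarrow> (\<forall>i<n. \<forall>j<n. f (i, j) \<in> S)"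
  by (simp add: op_mats_def)

lemma sa_space_bounded: "selfadjoint_operator_space S \<Longrightarrow> S \<subseteq> bounded_ops"
  and sa_space_zero: "selfadjoint_operator_space S \<Longrightarrow> 0 \<in> S"
  and sa_space_add: "selfadjoint_operator_space S \<Longrightarrow> s \<in> S \<Longrightarrow> t \<in> S \<Longrightarrow> s + t \<in> S"
  and sa_space_scale: "selfadjoint_operator_space S \<Longrightarrow> s \<in> S \<Longrightarrow> op_scale c s \<in> S"
  and sa_space_adj: "selfadjoint_operator_space S \<Longrightarrow> s \<in> S \<Longrightarrow> op_adj s \<in> S"
  by (auto simp: selfadjoint_operator_space_def)

lemma sa_space_sum:
  "selfadjoint_operator_space S \<Longrightarrow> (\<And>i. i \<in> I \<Longrightarrow> f i \<in> S) \<Longrightarrow> (\<Sum>i\<in>I. f i) \<in> S"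
  by (induction I rule: infinite_finite_induct) (auto simp: sa_space_zero sa_space_add)

text \<open>Linearity over sums of any finite length, for which matrices of a given size offer no addition of
  their own.\<close>

lemma functional_combination:
  assumes S: "selfadjoint_operator_space S"
    and lin: "linear_map (matrix_space n (operator_space S)) scalars \<phi>"
    and I: "finite I" and X: "\<And>i. i \<in> I \<Longrightarrow> X i \<in> op_mats S n"
  shows "\<phi> (mat n n (\<lambda>pq. \<Sum>i\<in>I. op_scale (c i) (X i $$ pq))) = (\<Sum>i\<in>I. c i * \<phi> (X i))"
  using I X
proof (induction I rule: finite_induct)
  case empty
  have "0\<^sub>m n n \<in> op_mats S n"
    using S by (simp add: op_mats_def sa_space_zero)
  then have "\<phi> (map_mat (op_scale 0) (0\<^sub>m n n)) = 0 * \<phi> (0\<^sub>m n n)"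
    using lin by (simp add: linear_map_def)
  moreover have "map_mat (op_scale 0) (0\<^sub>m n n) = mat n n (\<lambda>_. 0 :: 'a \<Rightarrow>\<^sub>L 'a)"
    by (rule eq_matI) auto
  ultimately show ?case by simp
next
  case (insert i I)
  let ?Y = "mat n n (\<lambda>pq. \<Sum>i\<in>I. op_scale (c i) (X i $$ pq))"
  have Xi: "X i \<in> op_mats S n" using insert by simp
  have sX: "map_mat (op_scale (c i)) (X i) \<in> op_mats S n"
    using Xi S by (auto simp: op_mats_def sa_space_scale)
  have Y: "?Y \<in> op_mats S n"
    using insert S by (auto simp: mat_in_op_mats intro!: sa_space_sum sa_space_scale intro: op_mats_entry)
  have "mat n n (\<lambda>pq. \<Sum>i\<in>insert i I. op_scale (c i) (X i $$ pq))
      = mat n n (\<lambda>pq. map_mat (op_scale (c i)) (X i) $$ pq + ?Y $$ pq)"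
    using insert(1,2) op_mats_carrier[OF Xi] by (intro eq_matI) auto
  also have "\<phi> \<dots> = \<phi> (map_mat (op_scale (c i)) (X i)) + \<phi> ?Y"
    using lin sX Y by (simp add: linear_map_def)
  also have "\<phi> (map_mat (op_scale (c i)) (X i)) = c i * \<phi> (X i)"
    using lin Xi by (simp add: linear_map_def)
  also have "\<phi> ?Y = (\<Sum>i\<in>I. c i * \<phi> (X i))"
    using insert by simp
  finally show ?case using insert(1,2) by simp
qed

lemma sum_lessThan_mult:
  fixes f :: "nat \<Rightarrow> 'b::comm_monoid_add"
  shows "(\<Sum>m<k * n. f m) = (\<Sum>i<k. \<Sum>p<n. f (i * n + p))"
proof -
  have "sum f {i * n..<i * n + n} = (\<Sum>p<n. f (i * n + p))" for i
    using sum.shift_bounds_nat_ivl[of f 0 "i * n" n]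
    by (simp add: atLeast0LessThan add.commute)
  then show ?thesis
    by (simp flip: sum.nat_group)
qed

lemma flatten_mat_carrier: "Z \<in> carrier_mat k k \<Longrightarrow> flatten_mat n Z \<in> carrier_mat (k * n) (k * n)"
  by (simp add: flatten_mat_def)

lemma index_flatten_mat:
  assumes "Z \<in> carrier_mat k k" "i < k" "j < k" "p < n" "q < n"
  shows "flatten_mat n Z $$ (i * n + p, j * n + q) = Z $$ (i, j) $$ (p, q)"
proof -
  have "i * n + p < k * n" if "i < k" "p < n" for i p
  proof -
    have "i * n + p < Suc i * n" using that by simp
    also have "\<dots> \<le> k * n" using that by (intro mult_le_mono1) simp
    finally show ?thesis .
  qed
  then show ?thesis
    using assms by (simp add: flatten_mat_def)
qed

lemma flatten_mat_single:
  assumes "X \<in> carrier_mat n n"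
  shows "flatten_mat n (mat 1 1 (\<lambda>_. X)) = X"
  by (rule eq_matI) (use assms in \<open>auto simp: flatten_mat_def\<close>)

text \<open>On elementary tensors \<open>z \<otimes> x\<close> and \<open>w \<otimes> y\<close> the form of a matrix of matrices reduces to the form
  of a linear combination of its blocks.\<close>

lemma mat_form_flatten:
  fixes Z :: "('h::chilbert_space \<Rightarrow>\<^sub>L 'h) mat mat"
  assumes Z: "Z \<in> mats (matrix_space n (operator_space bounded_ops)) k"
  shows "mat_form (k * n) (($$) (flatten_mat n Z))
      (\<lambda>m. z (m div n) *\<^sub>C x (m mod n)) (\<lambda>m. w (m div n) *\<^sub>C y (m mod n)) =
    mat_form n (\<lambda>pq. \<Sum>ij\<in>{..<k} \<times> {..<k}. op_scale (z (snd ij) * cnj (w (fst ij))) (Z $$ ij $$ pq)) x y"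
    (is "?L = ?R")
proof -
  have dims: "Z \<in> carrier_mat k k"
    using Z by (simp add: mats_matrix_space)
  have lin: "Z $$ (i, j) $$ (p, q) \<in> bounded_ops" if "i < k" "j < k" "p < n" "q < n" for i j p q
    using Z that by (auto simp: mats_matrix_space intro: op_mats_entry)
  have "?L = (\<Sum>i<k. \<Sum>p<n. \<Sum>j<k. \<Sum>q<n.
      cinner ((Z $$ (i, j) $$ (p, q)) (z j *\<^sub>C x q)) (w i *\<^sub>C y p))"
    unfolding mat_form_def sum_lessThan_mult cinner_sum_left
    by (intro sum.cong refl) (simp add: index_flatten_mat[OF dims])
  also have "\<dots> = (\<Sum>i<k. \<Sum>p<n. \<Sum>j<k. \<Sum>q<n.
      z j * cnj (w i) * cinner ((Z $$ (i, j) $$ (p, q)) (x q)) (y p))"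
    by (intro sum.cong refl)
       (simp add: bounded_ops_apply[OF lin] cinner_scaleC_left cinner_scaleC_right)
  also have "\<dots> = (\<Sum>p<n. \<Sum>q<n. \<Sum>i<k. \<Sum>j<k.
      z j * cnj (w i) * cinner ((Z $$ (i, j) $$ (p, q)) (x q)) (y p))"
  proof (subst sum.swap, rule sum.cong[OF refl])
    fix p
    let ?t = "\<lambda>i j q. z j * cnj (w i) * cinner ((Z $$ (i, j) $$ (p, q)) (x q)) (y p)"
    have "(\<Sum>i<k. \<Sum>j<k. \<Sum>q<n. ?t i j q) = (\<Sum>i<k. \<Sum>q<n. \<Sum>j<k. ?t i j q)"
      by (intro sum.cong refl sum.swap)
    also have "\<dots> = (\<Sum>q<n. \<Sum>i<k. \<Sum>j<k. ?t i j q)"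
      by (rule sum.swap)
    finally show "(\<Sum>i<k. \<Sum>j<k. \<Sum>q<n. ?t i j q) = (\<Sum>q<n. \<Sum>i<k. \<Sum>j<k. ?t i j q)" .
  qed
  also have "\<dots> = ?R"
    unfolding mat_form_def cinner_sum_left
    by (simp add: blinfun.sum_left cinner_sum_left cinner_scaleC_left sum.cartesian_product
        case_prod_beta)
  finally show ?thesis .
qed

lemma vec_norm_tensor:
  fixes z :: "nat \<Rightarrow> complex" and x :: "nat \<Rightarrow> 'h::chilbert_space"
  shows "vec_norm (k * n) (\<lambda>m. z (m div n) *\<^sub>C x (m mod n)) = vec_norm k z * vec_norm n x"
proof -
  have "(\<Sum>m<k * n. (norm (z (m div n) *\<^sub>C x (m mod n)))\<^sup>2)
      = (\<Sum>i<k. \<Sum>p<n. (norm (z i))\<^sup>2 * (norm (x p))\<^sup>2)"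
    unfolding sum_lessThan_mult
    by (intro sum.cong refl) (simp add: norm_scaleC power_mult_distrib)
  also have "\<dots> = (\<Sum>i<k. (norm (z i))\<^sup>2) * (\<Sum>p<n. (norm (x p))\<^sup>2)"
    by (simp add: sum_product)
  finally show ?thesis
    by (simp add: L2_set_def real_sqrt_mult)
qed

text \<open>The first amplification, in which \<open>M\<^sub>1(M\<^sub>n(S))\<close> is identified with \<open>M\<^sub>n(S)\<close>, already contains these
  properties.\<close>

lemma CCP_functionalD:
  assumes \<phi>: "\<phi> \<in> CCP (matrix_space n (operator_space S)) scalars" and X: "X \<in> op_mats S n"
  shows "\<phi> (mat_adj X) = cnj (\<phi> X)" "op_mat_pos X \<Longrightarrow> \<phi> X \<in> \<real>\<^sub>\<ge>\<^sub>0" "cmod (\<phi> X) \<le> op_mat_norm X"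
    "linear_map (matrix_space n (operator_space S)) scalars \<phi>"
proof -
  let ?V = "matrix_space n (operator_space S)"
  let ?X = "mat 1 1 (\<lambda>_. X)"
  have X1: "?X \<in> mats ?V 1"
    using X by (simp add: mats_matrix_space)
  have flat: "flatten_mat n ?X = X"
    using op_mats_carrier[OF X] by (rule flatten_mat_single)
  have map1: "map_mat \<phi> ?X = mat 1 1 (\<lambda>_. \<phi> X)"
    by (rule eq_matI) auto
  have ap: "amplification_positive ?V scalars \<phi> 1"
    using \<phi> by (auto simp: CCP_def completely_positive_def)
  then have "map_mat \<phi> (mstar ?V ?X) = mstar scalars (map_mat \<phi> ?X)"
    using X1 by (simp only: amplification_positive_def)
  then have "map_mat \<phi> (mstar ?V ?X) $$ (0, 0) = mstar scalars (map_mat \<phi> ?X) $$ (0, 0)"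
    by simp
  then show "\<phi> (mat_adj X) = cnj (\<phi> X)"
    by (simp add: mstar_def mat_adj_def)
  show "\<phi> X \<in> \<real>\<^sub>\<ge>\<^sub>0" if "op_mat_pos X"
  proof -
    have "mpos scalars (map_mat \<phi> ?X)"
      using ap X1 that flat by (simp add: amplification_positive_def del: scalars_sel)
    then have "op_mat_pos (map_mat scalar_op (mat 1 1 (\<lambda>_. \<phi> X)) :: (complex \<Rightarrow>\<^sub>L complex) mat)"
      unfolding map1 by simp
    then have "mat_form 1 (($$) (map_mat scalar_op (mat 1 1 (\<lambda>_. \<phi> X)) :: (complex \<Rightarrow>\<^sub>L complex) mat))
        (\<lambda>_. 1) (\<lambda>_. 1) \<in> \<real>\<^sub>\<ge>\<^sub>0"
      by (subst (asm) op_mat_pos_iff[of _ 1]) auto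
    then show ?thesis
      by (subst (asm) mat_form_scalar) auto
  qed
  have "mnorm scalars (map_mat \<phi> ?X) \<le> mnorm ?V ?X"
    using \<phi> X1 by (auto simp: CCP_def completely_contractive_def simp del: scalars_sel)
  then have le: "op_mat_norm (map_mat scalar_op (mat 1 1 (\<lambda>_. \<phi> X)) :: (complex \<Rightarrow>\<^sub>L complex) mat)
      \<le> op_mat_norm X"
    using flat unfolding map1 by simp
  have "cmod (mat_form 1 (($$) (map_mat scalar_op (mat 1 1 (\<lambda>_. \<phi> X)) :: (complex \<Rightarrow>\<^sub>L complex) mat))
        (\<lambda>_. 1) (\<lambda>_. 1))
      \<le> op_mat_norm (map_mat scalar_op (mat 1 1 (\<lambda>_. \<phi> X)) :: (complex \<Rightarrow>\<^sub>L complex) mat)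
        * vec_norm 1 (\<lambda>_. 1 :: complex) * vec_norm 1 (\<lambda>_. 1 :: complex)"
    by (rule mat_form_le) simp
  then have "cmod (\<phi> X) \<le> op_mat_norm (map_mat scalar_op (mat 1 1 (\<lambda>_. \<phi> X)) :: (complex \<Rightarrow>\<^sub>L complex) mat)"
    by (subst (asm) mat_form_scalar) (auto simp: L2_set_def)
  with le show "cmod (\<phi> X) \<le> op_mat_norm X" by simp
  show "linear_map ?V scalars \<phi>"
    using \<phi> by (simp add: CCP_def completely_positive_def)
qed

text \<open>Positive functionals are completely positive and contractive functionals completely
  contractive: a form \<open>\<Sum>i j. \<phi> (Z i j) * z j * cnj (w i)\<close> is the value of \<open>\<phi>\<close> at a linear combination
  of blocks, which inherits positivity and the norm bound from \<open>Z\<close>.\<close>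

lemma CCP_functionalI:
  fixes S :: "('h::chilbert_space \<Rightarrow>\<^sub>L 'h) set"
  assumes S: "selfadjoint_operator_space S"
    and lin: "linear_map (matrix_space n (operator_space S)) scalars \<phi>"
    and star: "\<And>X. X \<in> op_mats S n \<Longrightarrow> \<phi> (mat_adj X) = cnj (\<phi> X)"
    and pos: "\<And>X. X \<in> op_mats S n \<Longrightarrow> op_mat_pos X \<Longrightarrow> \<phi> X \<in> \<real>\<^sub>\<ge>\<^sub>0"
    and contr: "\<And>X. X \<in> op_mats S n \<Longrightarrow> cmod (\<phi> X) \<le> op_mat_norm X"
  shows "\<phi> \<in> CCP (matrix_space n (operator_space S)) scalars"
proof -
  let ?V = "matrix_space n (operator_space S)"
  define comb where "comb k Z z w =
    mat n n (\<lambda>pq. \<Sum>ij\<in>{..<k} \<times> {..<k}. op_scale (z (snd ij) * cnj (w (fst ij))) (Z $$ ij $$ pq))"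
    for k :: nat and Z :: "('h \<Rightarrow>\<^sub>L 'h) mat mat" and z w :: "nat \<Rightarrow> complex"
  have comb_in: "comb k Z z w \<in> op_mats S n" if Z: "Z \<in> mats ?V k" for k Z z w
    using Z unfolding comb_def mat_in_op_mats
    by (auto simp: mats_matrix_space intro!: sa_space_sum[OF S] sa_space_scale[OF S] op_mats_entry)
  have form: "mat_form k (($$) (map_mat scalar_op (map_mat \<phi> Z) :: (complex \<Rightarrow>\<^sub>L complex) mat)) z w
      = \<phi> (comb k Z z w)" if Z: "Z \<in> mats ?V k" for k Z z w
  proof -
    have "\<phi> (comb k Z z w) = (\<Sum>ij\<in>{..<k} \<times> {..<k}. z (snd ij) * cnj (w (fst ij)) * \<phi> (Z $$ ij))"
      unfolding comb_def using Z
      by (intro functional_combination[OF S lin]) (auto simp: mats_matrix_space)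
    also have "\<dots> = (\<Sum>i<k. \<Sum>j<k. map_mat \<phi> Z $$ (i, j) * z j * cnj (w i))"
      using Z by (auto simp: mats_matrix_space sum.cartesian_product intro!: sum.cong)
    finally show ?thesis
      using Z by (subst mat_form_scalar) (auto simp: mats_matrix_space)
  qed
  have Zb: "Z \<in> mats (matrix_space n (operator_space bounded_ops)) k" if "Z \<in> mats ?V k" for k Z
    using that op_mats_mono[OF sa_space_bounded[OF S]] by (auto simp: mats_matrix_space)
  have "amplification_positive ?V scalars \<phi> k" for k
    unfolding amplification_positive_def
  proof (intro conjI ballI impI)
    fix Z assume Z: "Z \<in> mats ?V k"
    then show "map_mat \<phi> (mstar ?V Z) = mstar scalars (map_mat \<phi> Z)"
      by (intro eq_matI) (auto simp: mstar_def[of ?V] mstar_def[of scalars] mats_matrix_space star)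
    assume "mpos ?V Z"
    then have P: "op_mat_pos (flatten_mat n Z)" by simp
    have dims: "Z \<in> carrier_mat k k" using Z by (simp add: mats_matrix_space)
    have "op_mat_pos (comb k Z z z)" for z
    proof (subst op_mat_pos_iff[of _ n], goal_cases)
      case 2
      show ?case
      proof
        fix x
        show "mat_form n (($$) (comb k Z z z)) x x \<in> \<real>\<^sub>\<ge>\<^sub>0"
          using P mat_form_flatten[OF Zb[OF Z], of z x z x, symmetric]
          by (simp add: comb_def op_mat_pos_iff[OF flatten_mat_carrier[OF dims]])
      qed
    qed (simp add: comb_def)
    then have "mat_form k (($$) (map_mat scalar_op (map_mat \<phi> Z) :: (complex \<Rightarrow>\<^sub>L complex) mat)) z z \<in> \<real>\<^sub>\<ge>\<^sub>0"
      for z unfolding form[OF Z] by (intro pos comb_in Z)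
    then show "mpos scalars (map_mat \<phi> Z)"
      using dims by (simp add: op_mat_pos_iff[of _ k])
  qed
  moreover have "mnorm scalars (map_mat \<phi> Z) \<le> mnorm ?V Z" if Z: "Z \<in> mats ?V k" for k Z
  proof -
    have dims: "Z \<in> carrier_mat k k" using Z by (simp add: mats_matrix_space)
    note flat = flatten_mat_carrier[OF dims, of n]
    have "op_mat_norm (map_mat scalar_op (map_mat \<phi> Z) :: (complex \<Rightarrow>\<^sub>L complex) mat)
        \<le> op_mat_norm (flatten_mat n Z)"
    proof (rule op_mat_norm_le_form)
      show "(map_mat scalar_op (map_mat \<phi> Z) :: (complex \<Rightarrow>\<^sub>L complex) mat) \<in> carrier_mat k k"
        using dims by simp
      show "0 \<le> op_mat_norm (flatten_mat n Z)"
        using flat by (rule op_mat_norm_nonneg)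
      fix z w :: "nat \<Rightarrow> complex"
      have "cmod (\<phi> (comb k Z z w)) \<le> op_mat_norm (comb k Z z w)"
        by (intro contr comb_in Z)
      also have "\<dots> \<le> op_mat_norm (flatten_mat n Z) * vec_norm k z * vec_norm k w"
      proof (rule op_mat_norm_le_form)
        show "comb k Z z w \<in> carrier_mat n n"
          by (simp add: comb_def)
        show "0 \<le> op_mat_norm (flatten_mat n Z) * vec_norm k z * vec_norm k w"
          by (intro mult_nonneg_nonneg L2_set_nonneg op_mat_norm_nonneg[OF flat])
        fix x y
        have "mat_form n (($$) (comb k Z z w)) x y = mat_form (k * n) (($$) (flatten_mat n Z))
            (\<lambda>m. z (m div n) *\<^sub>C x (m mod n)) (\<lambda>m. w (m div n) *\<^sub>C y (m mod n))"
          unfolding mat_form_flatten[OF Zb[OF Z]] comb_def by simp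
        also have "cmod \<dots> \<le> op_mat_norm (flatten_mat n Z) *
            (vec_norm k z * vec_norm n x) * (vec_norm k w * vec_norm n y)"
          using mat_form_le[OF flat] unfolding vec_norm_tensor[symmetric] .
        finally show "cmod (mat_form n (($$) (comb k Z z w)) x y) \<le>
            op_mat_norm (flatten_mat n Z) * vec_norm k z * vec_norm k w * vec_norm n x * vec_norm n y"
          by (simp add: mult_ac)
      qed
      finally show "cmod (mat_form k (($$) (map_mat scalar_op (map_mat \<phi> Z) :: (complex \<Rightarrow>\<^sub>L complex) mat)) z w)
          \<le> op_mat_norm (flatten_mat n Z) * vec_norm k z * vec_norm k w"
        by (simp add: form[OF Z])
    qed
    then show ?thesis by simp
  qed
  ultimately show ?thesis
    using lin by (auto simp: CCP_def completely_positive_def completely_contractive_def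
        simp del: scalars_sel matrix_space_sel)
qed

lemma CCP_restrict:
  assumes "S \<subseteq> T" and \<phi>: "\<phi> \<in> CCP (matrix_space n (operator_space T)) scalars"
  shows "\<phi> \<in> CCP (matrix_space n (operator_space S)) scalars"
proof -
  have sub: "X \<in> op_mats T n" if "X \<in> op_mats S n" for X
    using op_mats_mono[OF assms(1) that] .
  have subZ: "Z \<in> mats (matrix_space n (operator_space T)) k"
    if "Z \<in> mats (matrix_space n (operator_space S)) k" for Z k
    using that sub by (auto simp: mats_matrix_space)
  have mstar: "mstar (matrix_space n (operator_space S)) Z = mstar (matrix_space n (operator_space T)) Z" for Z
    by (simp add: mstar_def)
  have "linear_map (matrix_space n (operator_space S)) scalars \<phi>"
    using \<phi> sub by (simp add: CCP_def completely_positive_def linear_map_def)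
  then show ?thesis
    using \<phi> subZ
    unfolding CCP_def completely_positive_def completely_contractive_def amplification_positive_def
      mstar by auto
qed

section \<open>Extending functionals\<close>

lemma vnorm_scalars: "vnorm scalars z = cmod z"
proof (rule antisym)
  let ?Z = "map_mat scalar_op (mat 1 1 (\<lambda>_. z)) :: (complex \<Rightarrow>\<^sub>L complex) mat"
  have Z: "?Z \<in> carrier_mat 1 1" by simp
  have form: "mat_form 1 (($$) ?Z) x y = z * x 0 * cnj (y 0)" for x y
    by (subst mat_form_scalar) auto
  have "op_mat_norm ?Z \<le> cmod z"
    by (rule op_mat_norm_le_form[OF Z]) (simp_all only: form, simp_all add: norm_mult L2_set_def)
  then show "vnorm scalars z \<le> cmod z" by (simp add: vnorm_def)
  have "cmod z \<le> op_mat_norm ?Z"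
    using mat_form_le[OF Z, of "\<lambda>_. 1" "\<lambda>_. 1"] unfolding form by (simp add: L2_set_def)
  then show "cmod z \<le> vnorm scalars z" by (simp add: vnorm_def)
qed

lemma vnorm_op_mats: "X \<in> op_mats S n \<Longrightarrow> vnorm (matrix_space n (operator_space S)) X = op_mat_norm X"
  by (simp add: vnorm_def flatten_mat_single[OF op_mats_carrier] del: One_nat_def)

lemma map_norm_functional:
  "map_norm (matrix_space n (operator_space S)) scalars \<phi> =
    (SUP X \<in> {X \<in> op_mats S n. op_mat_norm X \<le> 1}. cmod (\<phi> X))"
  unfolding map_norm_def vnorm_scalars
  by (rule arg_cong[where f = "\<lambda>D. Sup ((\<lambda>X. cmod (\<phi> X)) ` D)"]) (auto simp: vnorm_op_mats)

lemma map_norm_upper: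
  assumes \<phi>: "\<phi> \<in> CCP (matrix_space n (operator_space S)) scalars"
    and "X \<in> op_mats S n" "op_mat_norm X \<le> 1"
  shows "cmod (\<phi> X) \<le> map_norm (matrix_space n (operator_space S)) scalars \<phi>"
  unfolding map_norm_functional using assms(2,3) CCP_functionalD(3)[OF \<phi>]
  by (intro cSUP_upper bdd_aboveI2[where M = 1]) (auto intro: order_trans)

lemma zero_op_mats: "selfadjoint_operator_space S \<Longrightarrow> 0\<^sub>m n n \<in> op_mats S n"
  by (simp add: op_mats_def sa_space_zero)

lemma op_mat_norm_zero [simp]: "op_mat_norm (0\<^sub>m n n) = 0"
  by (rule antisym, rule order_trans[OF op_mat_norm_le_sum[of _ n]])
     (auto intro: op_mat_norm_nonneg[of _ n])

lemma map_norm_le: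
  assumes "selfadjoint_operator_space S"
    and "\<And>X. X \<in> op_mats S n \<Longrightarrow> op_mat_norm X \<le> 1 \<Longrightarrow> cmod (\<phi> X) \<le> B"
  shows "map_norm (matrix_space n (operator_space S)) scalars \<phi> \<le> B"
  unfolding map_norm_functional
proof (rule cSUP_least)
  have "0\<^sub>m n n \<in> {X \<in> op_mats S n. op_mat_norm X \<le> 1}"
    using zero_op_mats[OF assms(1)] by simp
  then show "{X \<in> op_mats S n. op_mat_norm X \<le> 1} \<noteq> {}" by blast
qed (use assms(2) in auto)

lemma map_norm_bounds:
  assumes S: "selfadjoint_operator_space S" and \<phi>: "\<phi> \<in> CCP (matrix_space n (operator_space S)) scalars"
  shows "0 \<le> map_norm (matrix_space n (operator_space S)) scalars \<phi>"
    and "map_norm (matrix_space n (operator_space S)) scalars \<phi> \<le> 1"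
proof -
  show "0 \<le> map_norm (matrix_space n (operator_space S)) scalars \<phi>"
    using map_norm_upper[OF \<phi> zero_op_mats[OF S]] by (auto intro: order_trans[OF norm_ge_zero])
  show "map_norm (matrix_space n (operator_space S)) scalars \<phi> \<le> 1"
    using CCP_functionalD(3)[OF \<phi>] by (intro map_norm_le[OF S]) (auto intro: order_trans)
qed

lemma numerical_sup_cong:
  assumes "\<And>i j. i < n \<Longrightarrow> j < n \<Longrightarrow> M (i, j) = M' (i, j)"
  shows "numerical_sup n M = numerical_sup n M'"
  unfolding numerical_sup_def using mat_form_cong[of n M M', OF assms] by simp

text \<open>Matrices of a given size do not form a type, but the finitely supported families of operators are a
  real vector space, to which the Hahn--Banach theorem applies.\<close>

definition entries :: "nat \<Rightarrow> ('h::chilbert_space \<Rightarrow>\<^sub>L 'h) mat \<Rightarrow> (nat \<times> nat \<Rightarrow>\<^sub>0 ('h \<Rightarrow>\<^sub>L 'h))"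
  where "entries n X = Abs_poly_mapping (\<lambda>ij. if ij \<in> {..<n} \<times> {..<n} then X $$ ij else 0)"

lemma lookup_entries:
  "Poly_Mapping.lookup (entries n X) ij = (if ij \<in> {..<n} \<times> {..<n} then X $$ ij else 0)"
proof -
  have "finite {ij. (if ij \<in> {..<n} \<times> {..<n} then X $$ ij else 0) \<noteq> 0}"
    by (rule finite_subset[of _ "{..<n} \<times> {..<n}"]) auto
  then show ?thesis
    unfolding entries_def by (simp add: lookup_Abs_poly_mapping)
qed

text \<open>The real part of \<open>\<phi>\<close> extends to a real-linear functional \<open>h\<close> with the same domination, and
  \<open>\<psi> X = h X - \<i> * h (\<i> X)\<close> is the complex-linear functional with real part \<open>h\<close>.  The domination gives
  all that is required: \<open>h\<close> is nonnegative at positive matrices and zero at antiselfadjoint ones.\<close>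

theorem dominated_functional_extension:
  fixes S :: "('h::chilbert_space \<Rightarrow>\<^sub>L 'h) set"
  assumes S: "selfadjoint_operator_space S"
    and \<phi>: "\<phi> \<in> CCP (matrix_space n (operator_space S)) scalars"
    and c: "0 \<le> c" "c \<le> 1"
    and dom: "\<And>X. X \<in> op_mats S n \<Longrightarrow> Re (\<phi> X) \<le> c * numerical_sup n (($$) X)"
  shows "\<exists>\<psi> \<in> CCP (matrix_space n (operator_space bounded_ops)) scalars.
    (\<forall>X \<in> op_mats S n. \<psi> X = \<phi> X) \<and> (\<forall>X \<in> op_mats bounded_ops n. cmod (\<psi> X) \<le> c * op_mat_norm X)"
proof -
  let ?B = "bounded_ops :: ('h \<Rightarrow>\<^sub>L 'h) set"
  have \<phi>_add: "\<phi> (mat n n (\<lambda>ij. X $$ ij + Y $$ ij)) = \<phi> X + \<phi> Y"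
    if "X \<in> op_mats S n" "Y \<in> op_mats S n" for X Y
    using \<phi> that by (simp add: CCP_def completely_positive_def linear_map_def)
  have \<phi>_scale: "\<phi> (map_mat (op_scale z) X) = z * \<phi> X" if "X \<in> op_mats S n" for X z
    using \<phi> that by (simp add: CCP_def completely_positive_def linear_map_def)
  define V where "V = {m. \<forall>i<n. \<forall>j<n. Poly_Mapping.lookup m (i, j) \<in> S}"
  define M where "M m = mat n n (Poly_Mapping.lookup m)" for m :: "nat \<times> nat \<Rightarrow>\<^sub>0 ('h \<Rightarrow>\<^sub>L 'h)"
  have M_in: "M m \<in> op_mats S n" if "m \<in> V" for m
    using that by (simp add: V_def M_def mat_in_op_mats)
  have "\<exists>g. linear g \<and> (\<forall>m\<in>V. g m = Re (\<phi> (M m))) \<and>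
      (\<forall>m. g m \<le> c * numerical_sup n (Poly_Mapping.lookup m))"
  proof (rule hahn_banach)
    show "sublinear (\<lambda>m. c * numerical_sup n (Poly_Mapping.lookup m))"
      using c(1) by (rule sublinear_numerical_sup)
    show "subspace V"
      using S unfolding subspace_def V_def
      by (auto simp: sa_space_zero lookup_add sa_space_add lookup_scaleR
          sa_space_scale simp flip: op_scale_of_real)
    show "Re (\<phi> (M (x + y))) = Re (\<phi> (M x)) + Re (\<phi> (M y))" if "x \<in> V" "y \<in> V" for x y
    proof -
      have "M (x + y) = mat n n (\<lambda>ij. M x $$ ij + M y $$ ij)"
        by (rule eq_matI) (auto simp: M_def lookup_add)
      then show ?thesis
        using \<phi>_add M_in that by simp
    qed
    show "Re (\<phi> (M (r *\<^sub>R x))) = r * Re (\<phi> (M x))" if "x \<in> V" for r x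
    proof -
      have "M (r *\<^sub>R x) = map_mat (op_scale (complex_of_real r)) (M x)"
        by (rule eq_matI) (auto simp: M_def lookup_scaleR op_scale_of_real)
      then show ?thesis
        using \<phi>_scale M_in that by simp
    qed
    show "Re (\<phi> (M x)) \<le> c * numerical_sup n (Poly_Mapping.lookup x)" if "x \<in> V" for x
    proof -
      have "numerical_sup n (($$) (M x)) = numerical_sup n (Poly_Mapping.lookup x)"
        by (rule numerical_sup_cong) (simp add: M_def)
      then show ?thesis
        using dom[OF M_in[OF that]] by simp
    qed
  qed
  then obtain g where g: "linear g" and gV: "\<And>m. m \<in> V \<Longrightarrow> g m = Re (\<phi> (M m))"
    and g_le: "\<And>m. g m \<le> c * numerical_sup n (Poly_Mapping.lookup m)"
    by blast
  define h where "h X = g (entries n X)" for X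
  have h_le: "h X \<le> c * numerical_sup n (($$) X)" for X
    unfolding h_def
    using g_le[of "entries n X"] numerical_sup_cong[of n "Poly_Mapping.lookup (entries n X)" "($$) X"]
    by (simp add: lookup_entries)
  have h_add: "h (mat n n (\<lambda>ij. X $$ ij + Y $$ ij)) = h X + h Y" for X Y
  proof -
    have "entries n (mat n n (\<lambda>ij. X $$ ij + Y $$ ij)) = entries n X + entries n Y"
      by (rule poly_mapping_eqI) (auto simp: lookup_entries lookup_add)
    then show ?thesis
      by (simp add: h_def linear_add[OF g])
  qed
  have h_scale: "h (map_mat (op_scale (complex_of_real r)) X) = r * h X" if "X \<in> carrier_mat n n" for r X
  proof -
    have "entries n (map_mat (op_scale (complex_of_real r)) X) = r *\<^sub>R entries n X"
      using that by (intro poly_mapping_eqI) (auto simp: lookup_entries lookup_scaleR op_scale_of_real)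
    then show ?thesis
      by (simp add: h_def linear_scale[OF g])
  qed
  have h_nonneg: "0 \<le> h X" if X: "X \<in> carrier_mat n n" and pos: "\<And>x. 0 \<le> Re (mat_form n (($$) X) x x)" for X
  proof -
    let ?N = "map_mat (op_scale (complex_of_real (- 1))) X"
    have "mat_form n (($$) ?N) x x = - mat_form n (($$) X) x x" for x
    proof -
      have "mat_form n (($$) ?N) x x = mat_form n (\<lambda>ij. op_scale (- 1) (X $$ ij)) x x"
        using X by (intro mat_form_cong) auto
      then show ?thesis by (simp add: mat_form_op_scale)
    qed
    then have "numerical_sup n (($$) ?N) = 0"
      using pos by (intro numerical_sup_nonpos) simp
    then show ?thesis
      using h_le[of ?N] h_scale[OF X, of "- 1"] by simp
  qed
  have h_zero: "h X = 0" if X: "X \<in> carrier_mat n n" and "\<And>x. Re (mat_form n (($$) X) x x) = 0" for X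
  proof -
    have "numerical_sup n (($$) X) = 0"
      using that by (intro numerical_sup_nonpos) simp
    then show ?thesis
      using h_le[of X] h_nonneg[of X] that by simp
  qed
  define \<psi> where "\<psi> X = complex_of_real (h X) - \<i> * complex_of_real (h (map_mat (op_scale \<i>) X))" for X
  have form_scale: "mat_form n (($$) (map_mat (op_scale z) X)) x y = z * mat_form n (($$) X) x y"
    if "X \<in> carrier_mat n n" for z X x y
  proof -
    have "mat_form n (($$) (map_mat (op_scale z) X)) x y = mat_form n (\<lambda>ij. op_scale z (X $$ ij)) x y"
      using that by (intro mat_form_cong) auto
    then show ?thesis by (simp add: mat_form_op_scale)
  qed
  have h_scaleC: "h (map_mat (op_scale z) X) = Re z * h X + Im z * h (map_mat (op_scale \<i>) X)"
    if X: "X \<in> carrier_mat n n" for z X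
  proof -
    let ?Y = "map_mat (op_scale (complex_of_real (Re z))) X"
    let ?Z = "map_mat (op_scale (complex_of_real (Im z))) (map_mat (op_scale \<i>) X)"
    have "map_mat (op_scale z) X = mat n n (\<lambda>ij. ?Y $$ ij + ?Z $$ ij)"
    proof (rule eq_matI, goal_cases)
      case (1 i j)
      have "z = complex_of_real (Re z) + complex_of_real (Im z) * \<i>"
        using complex_eq[of z] by (simp add: mult.commute)
      then have "op_scale z (X $$ (i, j)) =
          op_scale (complex_of_real (Re z) + complex_of_real (Im z) * \<i>) (X $$ (i, j))"
        by simp
      then show ?case
        using 1 X by (simp add: op_scale_add_left op_scale_op_scale)
    qed (use X in auto)
    then show ?thesis
      using X by (simp add: h_add h_scale)
  qed
  have \<psi>_scale: "\<psi> (map_mat (op_scale z) X) = z * \<psi> X" if X: "X \<in> carrier_mat n n" for z X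
  proof -
    have "map_mat (op_scale \<i>) (map_mat (op_scale z) X) = map_mat (op_scale (\<i> * z)) X"
      by (rule eq_matI) (auto simp: op_scale_op_scale)
    then have "h (map_mat (op_scale \<i>) (map_mat (op_scale z) X))
        = - Im z * h X + Re z * h (map_mat (op_scale \<i>) X)"
      using h_scaleC[OF X, of "\<i> * z"] by simp
    then show ?thesis
      unfolding \<psi>_def h_scaleC[OF X, of z] by (simp add: complex_eq_iff)
  qed
  have \<psi>_add: "\<psi> (mat n n (\<lambda>ij. X $$ ij + Y $$ ij)) = \<psi> X + \<psi> Y"
    if "X \<in> carrier_mat n n" "Y \<in> carrier_mat n n" for X Y
  proof -
    have "map_mat (op_scale \<i>) (mat n n (\<lambda>ij. X $$ ij + Y $$ ij)) =
        mat n n (\<lambda>ij. map_mat (op_scale \<i>) X $$ ij + map_mat (op_scale \<i>) Y $$ ij)"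
      using that by (intro eq_matI) (auto intro!: blinfun_eqI simp: blinfun.add_left scaleC_add_right)
    then show ?thesis
      by (simp add: \<psi>_def h_add algebra_simps)
  qed
  have norm: "cmod (\<psi> X) \<le> c * op_mat_norm X" if X: "X \<in> carrier_mat n n" for X
  proof -
    \<comment> \<open>Rotating \<open>X\<close> by the conjugate of its value makes the value real, where \<open>h\<close> computes it.\<close>
    let ?w = "cnj (\<psi> X)"
    have "numerical_sup n (($$) (map_mat (op_scale ?w) X)) \<le> cmod (\<psi> X) * op_mat_norm X"
    proof (rule numerical_sup_le)
      fix x :: "nat \<Rightarrow> 'h" assume "vec_norm n x \<le> 1"
      then have x: "vec_norm n x * vec_norm n x \<le> 1"
        by (intro mult_le_one L2_set_nonneg) auto
      have "Re (mat_form n (($$) (map_mat (op_scale ?w) X)) x x) \<le> cmod (?w * mat_form n (($$) X) x x)"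
        unfolding form_scale[OF X] by (rule complex_Re_le_cmod)
      also have "\<dots> = cmod (\<psi> X) * cmod (mat_form n (($$) X) x x)"
        by (simp add: norm_mult)
      also have "\<dots> \<le> cmod (\<psi> X) * (op_mat_norm X * (vec_norm n x * vec_norm n x))"
        using mat_form_le[OF X, of x x] by (intro mult_left_mono) (simp_all add: mult.assoc)
      also have "\<dots> \<le> cmod (\<psi> X) * op_mat_norm X"
        using x op_mat_norm_nonneg[OF X] by (intro mult_left_mono mult_right_le_one_le) auto
      finally show "Re (mat_form n (($$) (map_mat (op_scale ?w) X)) x x) \<le> cmod (\<psi> X) * op_mat_norm X" .
    qed
    then have "h (map_mat (op_scale ?w) X) \<le> c * (cmod (\<psi> X) * op_mat_norm X)"
      using h_le c(1) by (meson mult_left_mono order_trans)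
    moreover have "h (map_mat (op_scale ?w) X) = Re (\<psi> (map_mat (op_scale ?w) X))"
      by (simp add: \<psi>_def)
    moreover have "\<psi> (map_mat (op_scale ?w) X) = complex_of_real ((cmod (\<psi> X))\<^sup>2)"
      unfolding \<psi>_scale[OF X] complex_norm_square by (rule mult.commute)
    ultimately have "cmod (\<psi> X) * cmod (\<psi> X) \<le> cmod (\<psi> X) * (c * op_mat_norm X)"
      by (simp add: power2_eq_square mult_ac)
    then show ?thesis
      using c(1) op_mat_norm_nonneg[OF X] by (cases "cmod (\<psi> X) = 0") auto
  qed
  have "\<psi> \<in> CCP (matrix_space n (operator_space ?B)) scalars"
  proof (rule CCP_functionalI)
    show "selfadjoint_operator_space ?B"
      by (rule cstar_algebra_bounded_ops[unfolded cstar_algebra_def, THEN conjunct1])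
    show "linear_map (matrix_space n (operator_space ?B)) scalars \<psi>"
      by (simp add: linear_map_def \<psi>_add \<psi>_scale op_mats_carrier)
    fix X assume XB: "X \<in> op_mats ?B n"
    then have X: "X \<in> carrier_mat n n" by (rule op_mats_carrier)
    show "cmod (\<psi> X) \<le> op_mat_norm X"
      using norm[OF X] mult_left_le_one_le[OF op_mat_norm_nonneg[OF X] c] by linarith
    have X': "mat_adj X \<in> carrier_mat n n"
      using X by (simp add: mat_adj_def)
    have form_adj: "mat_form n (($$) (mat_adj X)) x x = cnj (mat_form n (($$) X) x x)" for x
    proof -
      have "mat_form n (($$) (mat_adj X)) x x = mat_form n (\<lambda>(i, j). op_adj (X $$ (j, i))) x x"
        using X by (intro mat_form_cong) (simp add: mat_adj_def)
      also have "\<dots> = cnj (mat_form n (($$) X) x x)"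
        using XB by (intro mat_form_adjoint) (simp add: op_mats_entry)
      finally show ?thesis .
    qed
    show "\<psi> (mat_adj X) = cnj (\<psi> X)"
    proof -
      \<comment> \<open>\<open>X\<^sup>* - X\<close> and \<open>\<i> X\<^sup>* + \<i> X\<close> are antiselfadjoint, so \<open>h\<close> vanishes at them.\<close>
      let ?iX = "map_mat (op_scale \<i>) X" and ?iX' = "map_mat (op_scale \<i>) (mat_adj X)"
      let ?nX = "map_mat (op_scale (complex_of_real (- 1))) X"
      have "h (mat n n (\<lambda>ij. mat_adj X $$ ij + ?nX $$ ij)) = 0"
      proof (rule h_zero)
        fix x
        have "mat_form n (($$) ?nX) x x = - mat_form n (($$) X) x x"
          using form_scale[OF X] by simp
        then show "Re (mat_form n (($$) (mat n n (\<lambda>ij. mat_adj X $$ ij + ?nX $$ ij))) x x) = 0"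
          by (simp add: mat_form_add form_adj)
      qed simp
      then have re: "h (mat_adj X) = h X"
        unfolding h_add h_scale[OF X] by simp
      have "h (mat n n (\<lambda>ij. ?iX' $$ ij + ?iX $$ ij)) = 0"
        by (rule h_zero) (simp_all add: mat_form_add form_scale[OF X] form_scale[OF X'] form_adj)
      then have im: "h ?iX' = - h ?iX"
        unfolding h_add by simp
      show ?thesis
        by (simp add: \<psi>_def re im)
    qed
    show "\<psi> X \<in> \<real>\<^sub>\<ge>\<^sub>0" if "op_mat_pos X"
    proof -
      have pos: "mat_form n (($$) X) x x \<in> \<real>\<^sub>\<ge>\<^sub>0" for x
        using that op_mat_pos_iff[OF X] by blast
      then have "h (map_mat (op_scale \<i>) X) = 0"
        using X by (intro h_zero) (auto simp: form_scale complex_nonneg_Reals_iff)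
      moreover have "0 \<le> h X"
        using pos by (intro h_nonneg X) (simp add: complex_nonneg_Reals_iff)
      ultimately show ?thesis
        by (simp add: \<psi>_def)
    qed
  qed
  moreover have "\<psi> X = \<phi> X" if X: "X \<in> op_mats S n" for X
  proof -
    have h_eq: "h Y = Re (\<phi> Y)" if Y: "Y \<in> op_mats S n" for Y
    proof -
      have "entries n Y \<in> V"
        using Y by (simp add: V_def lookup_entries op_mats_entry)
      moreover have "M (entries n Y) = Y"
        using op_mats_carrier[OF Y] by (intro eq_matI) (auto simp: M_def lookup_entries)
      ultimately show ?thesis
        by (simp add: h_def gV)
    qed
    have "map_mat (op_scale \<i>) X \<in> op_mats S n"
      using X S by (auto simp: op_mats_def sa_space_scale)
    then show ?thesis
      by (simp add: \<psi>_def h_eq X \<phi>_scale complex_eq_iff)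
  qed
  ultimately show ?thesis
    using norm op_mats_carrier by blast
qed

section \<open>Domination by compression with the approximate unit\<close>

lemma op_positive_selfadjoint:
  assumes "op_positive u"
  shows "op_adj u = u"
proof (rule op_adj_eqI)
  fix x y
  have u: "u \<in> bounded_ops" and pos: "\<And>z. cinner (u z) z \<in> \<real>\<^sub>\<ge>\<^sub>0"
    using assms by (auto simp: op_positive_def)
  have "cinner (u y) x = cnj (cinner (u x) y)"
  proof (rule psd_hermitian_coefficients(1))
    fix t
    have "cinner (u y) y + t * cinner (u x) y + cnj t * cinner (u y) x + t * cnj t * cinner (u x) x
        = cinner (u (t *\<^sub>C x + y)) (t *\<^sub>C x + y)"
      by (simp add: blinfun.add_right bounded_ops_apply[OF u] cinner_add_left cinner_add_right
          cinner_scaleC_left cinner_scaleC_right algebra_simps)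
    then show "cinner (u y) y + t * cinner (u x) y + cnj t * cinner (u y) x
        + t * cnj t * cinner (u x) x \<in> \<real>\<^sub>\<ge>\<^sub>0"
      using pos by simp
  qed
  then show "cinner (u x) y = cinner x (u y)"
    by (metis cinner_commute complex_cnj_cnj)
qed

lemma norm_blinfun_contraction: "norm u \<le> 1 \<Longrightarrow> norm (blinfun_apply u x) \<le> norm x"
  using norm_blinfun[of u x] mult_right_mono[of "norm u" 1 "norm x"] by simp

lemma norm_compose_contraction: "norm u \<le> 1 \<Longrightarrow> norm (u o\<^sub>L T) \<le> norm T"
  using norm_blinfun_compose[of u T] mult_right_mono[of "norm u" 1 "norm T"] by simp

lemma mat_form_combination:
  assumes "finite I"
  shows "mat_form n (\<lambda>pq. \<Sum>i\<in>I. op_scale (c i) (M i pq)) x y = (\<Sum>i\<in>I. c i * mat_form n (M i) x y)"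
  using assms
proof (induction I rule: finite_induct)
  case empty
  show ?case by (simp add: mat_form_def)
next
  case (insert i I)
  then show ?case
    using mat_form_add[of n "\<lambda>pq. op_scale (c i) (M i pq)" "\<lambda>pq. \<Sum>i\<in>I. op_scale (c i) (M i pq)" x y]
    by (simp add: mat_form_op_scale)
qed

definition compression :: "nat \<Rightarrow> ('h::chilbert_space \<Rightarrow>\<^sub>L 'h) \<Rightarrow> ('h \<Rightarrow>\<^sub>L 'h) mat \<Rightarrow> ('h \<Rightarrow>\<^sub>L 'h) mat"
  where "compression n u X = mat n n (\<lambda>ij. u o\<^sub>L X $$ ij o\<^sub>L u)"

definition diagonal_square :: "nat \<Rightarrow> ('h::chilbert_space \<Rightarrow>\<^sub>L 'h) \<Rightarrow> ('h \<Rightarrow>\<^sub>L 'h) mat"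
  where "diagonal_square n u = mat n n (\<lambda>(i, j). if i = j then u o\<^sub>L u else 0)"

lemma mat_form_compression:
  assumes "op_positive u"
  shows "mat_form n (($$) (compression n u X)) x x = mat_form n (($$) X) (\<lambda>i. u (x i)) (\<lambda>i. u (x i))"
proof -
  have u: "u \<in> bounded_ops" using assms by (simp add: op_positive_def)
  have "cinner (u z) y = cinner z (u y)" for y z
    using op_adj_right[OF u] op_positive_selfadjoint[OF assms] by metis
  then show ?thesis
    by (simp add: compression_def mat_form_def flip: blinfun.sum_right)
qed

lemma mat_form_diagonal_square:
  assumes "op_positive u"
  shows "mat_form n (($$) (diagonal_square n u)) x x = complex_of_real ((vec_norm n (\<lambda>i. u (x i)))\<^sup>2)"
proof -
  have u: "u \<in> bounded_ops" using assms by (simp add: op_positive_def)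
  have sa: "cinner (u z) y = cinner z (u y)" for y z
    using op_adj_right[OF u] op_positive_selfadjoint[OF assms] by metis
  have "mat_form n (($$) (diagonal_square n u)) x x = (\<Sum>i<n. cinner (u (u (x i))) (x i))"
    unfolding diagonal_square_def mat_form_mat unfolding mat_form_def
    by (intro sum.cong refl) (simp add: if_distribR if_distrib[where f = blinfun_apply] cong: if_cong)
  also have "\<dots> = (\<Sum>i<n. complex_of_real ((norm (u (x i)))\<^sup>2))"
    by (simp only: sa cinner_norm)
  finally show ?thesis
    by (simp add: L2_set_def sum_nonneg)
qed

lemma op_mat_norm_diagonal_square:
  assumes "norm u \<le> 1"
  shows "op_mat_norm (diagonal_square n u) \<le> 1"
proof (rule op_mat_norm_le)
  show "diagonal_square n u \<in> carrier_mat n n"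
    by (simp add: diagonal_square_def)
  fix x :: "nat \<Rightarrow> 'a" assume x: "vec_norm n x \<le> 1"
  have "vec_norm n (\<lambda>i. \<Sum>j<n. (diagonal_square n u $$ (i, j)) (x j)) \<le> vec_norm n x"
  proof (rule L2_set_mono)
    fix i assume i: "i \<in> {..<n}"
    then have "(\<Sum>j<n. (diagonal_square n u $$ (i, j)) (x j)) = u (u (x i))"
      by (simp add: diagonal_square_def if_distrib[where f = blinfun_apply] if_distribR cong: if_cong)
    then show "norm (\<Sum>j<n. (diagonal_square n u $$ (i, j)) (x j)) \<le> norm (x i)"
      using norm_blinfun_contraction[OF assms] by (metis order_trans)
  qed simp
  then show "vec_norm n (\<lambda>i. \<Sum>j<n. (diagonal_square n u $$ (i, j)) (x j)) \<le> 1"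
    using x by linarith
qed

text \<open>With \<open>r\<close> the numerical supremum of \<open>X\<close>, compressing \<open>r - Re X \<ge> 0\<close> by \<open>u\<close> gives the positive element
  \<open>r u\<^sup>2 - u (Re X) u\<close>.  It lies in the space although the unit operator need not, and \<open>\<phi>\<close> takes a value
  of at most its norm at \<open>u\<^sup>2\<close>.\<close>

lemma functional_compression_le:
  fixes S :: "('h::chilbert_space \<Rightarrow>\<^sub>L 'h) set"
  assumes S: "selfadjoint_operator_space S"
    and \<phi>: "\<phi> \<in> CCP (matrix_space n (operator_space S)) scalars"
    and u: "op_positive u" "norm u \<le> 1"
    and D: "diagonal_square n u \<in> op_mats S n" and C: "compression n u X \<in> op_mats S n"
  shows "Re (\<phi> (compression n u X)) \<le>
    map_norm (matrix_space n (operator_space S)) scalars \<phi> * numerical_sup n (($$) X)"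
proof -
  define r where "r = numerical_sup n (($$) X)"
  \<comment> \<open>The positive element \<open>r u\<^sup>2 - (u X u + (u X u)\<^sup>*) / 2\<close>.\<close>
  define c :: "nat \<Rightarrow> complex" where "c k = (if k = 0 then of_real r else - 1 / 2)" for k
  define Z where "Z k = (if k = 0 then diagonal_square n u
    else if k = 1 then compression n u X else mat_adj (compression n u X))" for k :: nat
  define K where "K = mat n n (\<lambda>pq. \<Sum>k\<in>{0, 1, 2}. op_scale (c k) (Z k $$ pq))"
  have adj: "mat_adj (compression n u X) \<in> op_mats S n"
    using C S by (auto simp: op_mats_def mat_adj_def sa_space_adj)
  have Z: "Z k \<in> op_mats S n" for k
    using D C adj by (simp add: Z_def)
  have K: "K \<in> op_mats S n"
    unfolding K_def mat_in_op_mats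
    by (intro allI impI sa_space_sum[OF S] sa_space_scale[OF S] op_mats_entry[OF Z])
  have "mat_form n (($$) K) x x \<in> \<real>\<^sub>\<ge>\<^sub>0" for x
  proof -
    let ?q = "mat_form n (($$) X) (\<lambda>i. u (x i)) (\<lambda>i. u (x i))"
    have "mat_form n (($$) (mat_adj (compression n u X))) x x
        = mat_form n (\<lambda>(i, j). op_adj (compression n u X $$ (j, i))) x x"
      by (rule mat_form_cong) (simp add: mat_adj_def compression_def)
    also have "\<dots> = cnj (mat_form n (($$) (compression n u X)) x x)"
      using C sa_space_bounded[OF S] by (intro mat_form_adjoint) (auto dest: op_mats_entry)
    finally have adj_form: "mat_form n (($$) (mat_adj (compression n u X))) x x = cnj ?q"
      by (simp add: mat_form_compression[OF u(1)])
    have "mat_form n (($$) K) x x = (\<Sum>k\<in>{0, 1, 2}. c k * mat_form n (($$) (Z k)) x x)"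
      unfolding K_def mat_form_mat by (rule mat_form_combination) simp
    also have "\<dots> = complex_of_real (r * (vec_norm n (\<lambda>i. u (x i)))\<^sup>2) - (?q + cnj ?q) / 2"
      by (simp add: c_def Z_def mat_form_diagonal_square[OF u(1)] mat_form_compression[OF u(1)]
          adj_form del: of_real_power) (simp add: field_simps)
    also have "\<dots> = complex_of_real (r * (vec_norm n (\<lambda>i. u (x i)))\<^sup>2 - Re ?q)"
      by (simp add: complex_add_cnj del: of_real_power)
    also have "\<dots> \<in> \<real>\<^sub>\<ge>\<^sub>0"
      using numerical_sup_upper[of n "($$) X" "\<lambda>i. u (x i)"]
      by (simp add: r_def nonneg_Reals_of_real_iff del: of_real_power of_real_diff of_real_mult)
    finally show ?thesis .
  qed
  then have "op_mat_pos K"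
    using op_mat_pos_iff[OF op_mats_carrier[OF K]] by blast
  then have "\<phi> K \<in> \<real>\<^sub>\<ge>\<^sub>0"
    by (rule CCP_functionalD(2)[OF \<phi> K])
  moreover have "\<phi> K = (\<Sum>k\<in>{0, 1, 2}. c k * \<phi> (Z k))"
    unfolding K_def using CCP_functionalD(4)[OF \<phi> K] Z by (intro functional_combination[OF S]) auto
  then have "\<phi> K = r * \<phi> (diagonal_square n u)
      - (\<phi> (compression n u X) + cnj (\<phi> (compression n u X))) / 2"
    by (simp add: c_def Z_def CCP_functionalD(1)[OF \<phi> C] add_divide_distrib)
  ultimately have "Re (\<phi> (compression n u X)) \<le> r * Re (\<phi> (diagonal_square n u))"
    by (simp add: complex_nonneg_Reals_iff)
  also have "\<dots> \<le> r * map_norm (matrix_space n (operator_space S)) scalars \<phi>"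
  proof (rule mult_left_mono)
    show "Re (\<phi> (diagonal_square n u)) \<le> map_norm (matrix_space n (operator_space S)) scalars \<phi>"
      using map_norm_upper[OF \<phi> D op_mat_norm_diagonal_square[OF u(2)]] complex_Re_le_cmod
      by (rule order_trans[rotated])
    show "0 \<le> r" by (simp add: r_def numerical_sup_nonneg)
  qed
  finally show ?thesis by (simp add: r_def mult.commute)
qed

text \<open>Multiplication from the right converges because the adjoint turns it into multiplication from the
  left.\<close>

lemma compression_tendsto:
  fixes u :: "'i \<Rightarrow> ('h::chilbert_space \<Rightarrow>\<^sub>L 'h)"
  assumes u: "\<And>i. op_positive (u i)" "\<And>i. norm (u i) \<le> 1"
    and s: "s \<in> bounded_ops"
    and lim: "((\<lambda>i. u i o\<^sub>L s) \<longlongrightarrow> s) F" and lim_adj: "((\<lambda>i. u i o\<^sub>L op_adj s) \<longlongrightarrow> op_adj s) F"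
  shows "((\<lambda>i. norm ((u i o\<^sub>L s o\<^sub>L u i) - s)) \<longlongrightarrow> 0) F"
proof (rule tendsto_sandwich[OF _ _ tendsto_const])
  let ?f = "\<lambda>i. norm ((u i o\<^sub>L op_adj s) - op_adj s) + norm ((u i o\<^sub>L s) - s)"
  have "((\<lambda>i. norm ((u i o\<^sub>L op_adj s) - op_adj s)) \<longlongrightarrow> 0) F" "((\<lambda>i. norm ((u i o\<^sub>L s) - s)) \<longlongrightarrow> 0) F"
    using lim lim_adj by (auto intro: tendsto_norm_zero LIM_zero)
  then show "(?f \<longlongrightarrow> 0) F"
    using tendsto_add by fastforce
  have "norm ((u i o\<^sub>L s o\<^sub>L u i) - s) \<le> ?f i" for i
  proof -
    have ub: "u i \<in> bounded_ops" using u(1) by (simp add: op_positive_def)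
    have mult: "T o\<^sub>L R \<in> bounded_ops" if "T \<in> bounded_ops" "R \<in> bounded_ops" for T R :: "'h \<Rightarrow>\<^sub>L 'h"
      using that by (simp add: bounded_ops_def)
    have diff: "T - R \<in> bounded_ops" if "T \<in> bounded_ops" "R \<in> bounded_ops" for T R :: "'h \<Rightarrow>\<^sub>L 'h"
      using that by (auto simp: bounded_ops_def blinfun.diff_left
          linear_diff[OF bounded_linear.linear[OF bounded_linear_scaleC]])
    have adj_s: "op_adj s \<in> bounded_ops" using s by (rule op_adj_bounded_ops)
    have "(s o\<^sub>L u i) - s = op_adj ((u i o\<^sub>L op_adj s) - op_adj s)"
      by (simp add: op_adj_diff op_adj_compose mult ub adj_s op_adj_op_adj s
          op_positive_selfadjoint[OF u(1)])
    then have right: "norm ((s o\<^sub>L u i) - s) \<le> norm ((u i o\<^sub>L op_adj s) - op_adj s)"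
      using norm_op_adj_le[OF diff[OF mult[OF ub adj_s] adj_s]] by simp
    have "(u i o\<^sub>L s o\<^sub>L u i) - s = (u i o\<^sub>L ((s o\<^sub>L u i) - s)) + ((u i o\<^sub>L s) - s)"
      by (rule blinfun_eqI) (simp add: blinfun.diff_left blinfun.add_left blinfun.diff_right)
    then have "norm ((u i o\<^sub>L s o\<^sub>L u i) - s) \<le> norm (u i o\<^sub>L ((s o\<^sub>L u i) - s)) + norm ((u i o\<^sub>L s) - s)"
      by (metis norm_triangle_ineq)
    also have "norm (u i o\<^sub>L ((s o\<^sub>L u i) - s)) \<le> norm ((s o\<^sub>L u i) - s)"
      using u(2) by (rule norm_compose_contraction)
    finally show ?thesis using right by linarith
  qed
  then show "eventually (\<lambda>i. norm ((u i o\<^sub>L s o\<^sub>L u i) - s) \<le> ?f i) F"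
    by simp
qed simp_all

text \<open>The compressions \<open>u X u\<close> by the approximate unit satisfy the bound and converge to \<open>X\<close> entrywise,
  hence in the matrix norm, in which \<open>\<phi>\<close> is continuous.\<close>

lemma approximate_unit_domination:
  fixes S A :: "('h::chilbert_space \<Rightarrow>\<^sub>L 'h) set" and u :: "'i \<Rightarrow> ('h \<Rightarrow>\<^sub>L 'h)"
  assumes S: "selfadjoint_operator_space S" and AS: "A \<subseteq> S"
    and module: "\<And>a s. a \<in> A \<Longrightarrow> s \<in> S \<Longrightarrow> a o\<^sub>L s \<in> S"
    and unit: "approximate_unit A F u"
    and lim: "\<And>s. s \<in> S \<Longrightarrow> ((\<lambda>i. u i o\<^sub>L s) \<longlongrightarrow> s) F"
    and \<phi>: "\<phi> \<in> CCP (matrix_space n (operator_space S)) scalars"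
    and X: "X \<in> op_mats S n"
  shows "Re (\<phi> X) \<le> map_norm (matrix_space n (operator_space S)) scalars \<phi> * numerical_sup n (($$) X)"
proof -
  have uA: "u i \<in> A" and u_pos: "op_positive (u i)" and u_norm: "norm (u i) \<le> 1" and F: "F \<noteq> bot" for i
    using unit by (auto simp: approximate_unit_def)
  have bdd: "s \<in> bounded_ops" if "s \<in> S" for s
    using that sa_space_bounded[OF S] by blast
  have right_module: "s o\<^sub>L u i \<in> S" if s: "s \<in> S" for s i
  proof -
    have uS: "u i \<in> S" using uA AS by blast
    have "op_adj (u i o\<^sub>L op_adj s) \<in> S"
      using module[OF uA sa_space_adj[OF S s]] by (rule sa_space_adj[OF S])
    then show ?thesis
      using s by (simp add: op_adj_compose bdd uS op_adj_bounded_ops op_adj_op_adj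
          op_positive_selfadjoint[OF u_pos])
  qed
  have comp: "compression n (u i) X \<in> op_mats S n" for i
    unfolding compression_def mat_in_op_mats
    using X by (auto intro!: right_module module uA intro: op_mats_entry)
  have diag: "diagonal_square n (u i) \<in> op_mats S n" for i
    unfolding diagonal_square_def mat_in_op_mats
    using uA AS by (auto intro!: module simp: sa_space_zero[OF S])
  have "((\<lambda>i. \<phi> (compression n (u i) X) - \<phi> X) \<longlongrightarrow> 0) F"
  proof (rule Lim_null_comparison)
    let ?d = "\<lambda>i. \<Sum>p<n. \<Sum>q<n. norm ((u i o\<^sub>L X $$ (p, q) o\<^sub>L u i) - X $$ (p, q))"
    show "(?d \<longlongrightarrow> 0) F"
    proof (intro tendsto_null_sum)
      fix p q assume "p \<in> {..<n}" "q \<in> {..<n}"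
      then have s: "X $$ (p, q) \<in> S" using X by (simp add: op_mats_entry)
      show "((\<lambda>i. norm ((u i o\<^sub>L X $$ (p, q) o\<^sub>L u i) - X $$ (p, q))) \<longlongrightarrow> 0) F"
        using u_pos u_norm bdd[OF s] lim[OF s] lim[OF sa_space_adj[OF S s]] by (rule compression_tendsto)
    qed
    have "norm (\<phi> (compression n (u i) X) - \<phi> X) \<le> ?d i" for i
    proof -
      define c :: "nat \<Rightarrow> complex" where "c k = (if k = 0 then 1 else - 1)" for k
      define Z where "Z k = (if k = 0 then compression n (u i) X else X)" for k :: nat
      define K where "K = mat n n (\<lambda>pq. \<Sum>k\<in>{0, 1}. op_scale (c k) (Z k $$ pq))"
      have Z: "Z k \<in> op_mats S n" for k
        using X comp by (simp add: Z_def)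
      have K: "K \<in> op_mats S n"
        unfolding K_def mat_in_op_mats
        by (intro allI impI sa_space_sum[OF S] sa_space_scale[OF S] op_mats_entry[OF Z])
      have "\<phi> K = (\<Sum>k\<in>{0, 1}. c k * \<phi> (Z k))"
        unfolding K_def using CCP_functionalD(4)[OF \<phi> X] Z by (intro functional_combination[OF S]) auto
      then have "\<phi> (compression n (u i) X) - \<phi> X = \<phi> K"
        by (simp add: c_def Z_def)
      then have "norm (\<phi> (compression n (u i) X) - \<phi> X) \<le> op_mat_norm K"
        using CCP_functionalD(3)[OF \<phi> K] by simp
      also have "\<dots> \<le> (\<Sum>p<n. \<Sum>q<n. norm (K $$ (p, q)))"
        by (rule op_mat_norm_le_sum[OF op_mats_carrier[OF K]])
      also have "\<dots> = ?d i"
      proof (intro sum.cong refl arg_cong[where f = norm])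
        fix p q assume "p \<in> {..<n}" "q \<in> {..<n}"
        then show "K $$ (p, q) = (u i o\<^sub>L X $$ (p, q) o\<^sub>L u i) - X $$ (p, q)"
          by (simp add: op_scale_one op_scale_minus_one K_def c_def Z_def compression_def)
      qed
      finally show ?thesis .
    qed
    then show "eventually (\<lambda>i. norm (\<phi> (compression n (u i) X) - \<phi> X) \<le> ?d i) F"
      by simp
  qed
  then have "((\<lambda>i. Re (\<phi> (compression n (u i) X))) \<longlongrightarrow> Re (\<phi> X)) F"
    by (intro tendsto_Re) (rule LIM_zero_cancel)
  then show ?thesis
  proof (rule tendsto_upperbound)
    show "eventually (\<lambda>i. Re (\<phi> (compression n (u i) X)) \<le>
        map_norm (matrix_space n (operator_space S)) scalars \<phi> * numerical_sup n (($$) X)) F"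
      by (intro always_eventually allI functional_compression_le[OF S \<phi> u_pos u_norm diag comp])
  qed (rule F)
qed

text \<open>The norm of an extension is at least that of \<open>\<phi>\<close>; the dominated extension is bounded by that norm on
  all operator matrices, hence also after restriction to \<open>T\<close>.\<close>

theorem CCP_extension:
  fixes S A :: "('h::chilbert_space \<Rightarrow>\<^sub>L 'h) set" and u :: "'i \<Rightarrow> ('h \<Rightarrow>\<^sub>L 'h)"
  assumes S: "selfadjoint_operator_space S" and AS: "A \<subseteq> S"
    and module: "\<And>a s. a \<in> A \<Longrightarrow> s \<in> S \<Longrightarrow> a o\<^sub>L s \<in> S"
    and unit: "approximate_unit A F u"
    and lim: "\<And>s. s \<in> S \<Longrightarrow> ((\<lambda>i. u i o\<^sub>L s) \<longlongrightarrow> s) F"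
    and \<phi>: "\<phi> \<in> CCP (matrix_space n (operator_space S)) scalars"
    and T: "S \<subseteq> T" "T \<subseteq> bounded_ops"
  shows "\<exists>\<psi> \<in> CCP (matrix_space n (operator_space T)) scalars.
    (\<forall>X \<in> op_mats S n. \<psi> X = \<phi> X) \<and>
    map_norm (matrix_space n (operator_space T)) scalars \<psi> =
      map_norm (matrix_space n (operator_space S)) scalars \<phi>"
proof -
  let ?c = "map_norm (matrix_space n (operator_space S)) scalars \<phi>"
  obtain \<psi> where \<psi>: "\<psi> \<in> CCP (matrix_space n (operator_space bounded_ops)) scalars"
    and ext: "\<And>X. X \<in> op_mats S n \<Longrightarrow> \<psi> X = \<phi> X"
    and bound: "\<And>X. X \<in> op_mats bounded_ops n \<Longrightarrow> cmod (\<psi> X) \<le> ?c * op_mat_norm X"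
    using dominated_functional_extension[OF S \<phi> map_norm_bounds[OF S \<phi>]
        approximate_unit_domination[OF S AS module unit lim \<phi>]] by blast
  have \<psi>T: "\<psi> \<in> CCP (matrix_space n (operator_space T)) scalars"
    using T(2) \<psi> by (rule CCP_restrict)
  have "map_norm (matrix_space n (operator_space T)) scalars \<psi> \<le> ?c"
    unfolding map_norm_functional[of n T]
  proof (rule cSUP_least)
    have "0\<^sub>m n n \<in> {X \<in> op_mats T n. op_mat_norm X \<le> 1}"
      using op_mats_mono[OF T(1) zero_op_mats[OF S]] by simp
    then show "{X \<in> op_mats T n. op_mat_norm X \<le> 1} \<noteq> {}" by blast
    fix X assume X: "X \<in> {X \<in> op_mats T n. op_mat_norm X \<le> 1}"
    then have "cmod (\<psi> X) \<le> ?c * op_mat_norm X"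
      using op_mats_mono[OF T(2)] by (intro bound) blast
    also have "\<dots> \<le> ?c * 1"
      using X map_norm_bounds(1)[OF S \<phi>] by (intro mult_left_mono) auto
    finally show "cmod (\<psi> X) \<le> ?c" by simp
  qed
  moreover have "?c \<le> map_norm (matrix_space n (operator_space T)) scalars \<psi>"
    using map_norm_upper[OF \<psi>T] ext op_mats_mono[OF T(1)] by (intro map_norm_le[OF S]) (metis)
  ultimately show ?thesis
    using \<psi>T ext by (intro bexI[of _ \<psi>]) auto
qed

section \<open>Inverse square roots of positive matrices\<close>

text \<open>The order of the unitisation compresses by an inverse square root given by a description.  Unless the
  positive inverse square root exists and is unique, nothing is known about the compressed matrix, not
  even its size, and a functional need not agree with its extension there.\<close>

definition vec_inner :: "nat \<Rightarrow> (nat \<Rightarrow> complex) \<Rightarrow> (nat \<Rightarrow> complex) \<Rightarrow> complex"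
  where "vec_inner n x y = (\<Sum>i<n. x i * cnj (y i))"

definition mat_vec :: "nat \<Rightarrow> complex mat \<Rightarrow> (nat \<Rightarrow> complex) \<Rightarrow> (nat \<Rightarrow> complex)"
  where "mat_vec n a x i = (\<Sum>j<n. a $$ (i, j) * x j)"

definition psd :: "nat \<Rightarrow> complex mat \<Rightarrow> bool"
  where "psd n a \<longleftrightarrow> (\<forall>x. vec_inner n (mat_vec n a x) x \<in> \<real>\<^sub>\<ge>\<^sub>0)"

lemma psdD: "psd n a \<Longrightarrow> vec_inner n (mat_vec n a x) x \<in> \<real>\<^sub>\<ge>\<^sub>0"
  by (simp add: psd_def)

lemma vec_inner_mat_vec: "vec_inner n (mat_vec n a x) y = (\<Sum>i<n. \<Sum>j<n. a $$ (i, j) * x j * cnj (y i))"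
  by (simp add: vec_inner_def mat_vec_def sum_distrib_right)

lemma mpos_scalars_iff: "a \<in> carrier_mat n n \<Longrightarrow> mpos scalars a \<longleftrightarrow> psd n a"
  by (simp add: psd_def op_mat_pos_iff[of _ n] mat_form_scalar vec_inner_mat_vec)

lemma vec_inner_self: "vec_inner n x x = complex_of_real ((vec_norm n x)\<^sup>2)"
  by (simp add: vec_inner_def L2_set_def sum_nonneg complex_norm_square[symmetric] del: of_real_power)

lemma vec_inner_commute: "vec_inner n x y = cnj (vec_inner n y x)"
  by (simp add: vec_inner_def mult.commute)

lemma vec_inner_cong: "(\<And>i. i < n \<Longrightarrow> x i = x' i) \<Longrightarrow> (\<And>i. i < n \<Longrightarrow> y i = y' i) \<Longrightarrow> vec_inner n x y = vec_inner n x' y'"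
  by (simp add: vec_inner_def)

lemma psd_form:
  assumes "psd n a"
  shows psd_symmetric: "vec_inner n (mat_vec n a x) y = vec_inner n x (mat_vec n a y)"
    and psd_Cauchy_Schwarz: "(cmod (vec_inner n (mat_vec n a x) y))\<^sup>2
      \<le> Re (vec_inner n (mat_vec n a y) y) * Re (vec_inner n (mat_vec n a x) x)"
proof -
  let ?q = "\<lambda>x y. vec_inner n (mat_vec n a x) y"
  have "?q y y + t * ?q x y + cnj t * ?q y x + t * cnj t * ?q x x \<in> \<real>\<^sub>\<ge>\<^sub>0" for t
  proof -
    have "?q y y + t * ?q x y + cnj t * ?q y x + t * cnj t * ?q x x
        = ?q (\<lambda>i. t * x i + y i) (\<lambda>i. t * x i + y i)"
      by (simp add: vec_inner_mat_vec algebra_simps sum.distrib sum_distrib_left)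
    then show ?thesis
      using psdD[OF assms] by simp
  qed
  from psd_hermitian_coefficients[OF this]
  show "(cmod (?q x y))\<^sup>2 \<le> Re (?q y y) * Re (?q x x)" and "?q x y = vec_inner n x (mat_vec n a y)"
    by (auto simp: vec_inner_commute[of n x])
qed

lemma mat_vec_unit: "j < n \<Longrightarrow> mat_vec n a (\<lambda>l. if l = j then 1 else 0) i = a $$ (i, j)"
  by (simp add: mat_vec_def if_distrib cong: if_cong)

lemma psd_entry_commute:
  assumes a: "psd n a" and i: "i < n" and j: "j < n"
  shows "a $$ (i, j) = cnj (a $$ (j, i))"
proof -
  let ?e = "\<lambda>j l. if l = j then 1 else (0 :: complex)"
  have "vec_inner n (mat_vec n a (?e j)) (?e i) = a $$ (i, j)"
    using i j by (simp add: vec_inner_def mat_vec_unit if_distrib[where f = cnj] if_distrib[where f = "\<lambda>z. w * z" for w] cong: if_cong)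
  moreover have "vec_inner n (?e j) (mat_vec n a (?e i)) = cnj (a $$ (j, i))"
    using i j by (simp add: vec_inner_def mat_vec_unit if_distrib[where f = "\<lambda>z. z * w" for w] cong: if_cong)
  ultimately show ?thesis
    using psd_symmetric[OF a] by metis
qed

lemma times_mat_entry:
  "a \<in> carrier_mat n n \<Longrightarrow> b \<in> carrier_mat n n \<Longrightarrow> i < n \<Longrightarrow> j < n \<Longrightarrow>
    (a * b) $$ (i, j) = (\<Sum>l<n. a $$ (i, l) * b $$ (l, j))"
  for a b :: "complex mat"
  by (simp add: scalar_prod_def atLeast0LessThan)

lemma mat_vec_times:
  assumes "a \<in> carrier_mat n n" "b \<in> carrier_mat n n" "i < n"
  shows "mat_vec n (a * b) x i = mat_vec n a (mat_vec n b x) i"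
proof -
  have "mat_vec n (a * b) x i = (\<Sum>j<n. \<Sum>l<n. a $$ (i, l) * b $$ (l, j) * x j)"
    using assms by (simp add: mat_vec_def times_mat_entry sum_distrib_right del: index_mult_mat)
  also have "\<dots> = mat_vec n a (mat_vec n b x) i"
    by (subst sum.swap) (simp add: mat_vec_def sum_distrib_left mult.assoc)
  finally show ?thesis .
qed

subsection \<open>Uniqueness\<close>

text \<open>For \<open>d = b - c\<close> one has \<open>b d + d c = b\<^sup>2 - c\<^sup>2 = 0\<close>, so the traces of the positive matrices \<open>d b d\<close>
  and \<open>d c d\<close> add up to zero.  Hence \<open>b\<close> annihilates the columns of \<open>d\<close>.\<close>

lemma psd_square_cancel:
  assumes b: "b \<in> carrier_mat n n" "psd n b" and c: "c \<in> carrier_mat n n" "psd n c"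
    and eq: "b * b = c * c"
  shows "b * (b - c) = 0\<^sub>m n n"
proof -
  define d where "d = b - c"
  have d: "d \<in> carrier_mat n n" using minus_carrier_mat[OF c(1)] by (simp add: d_def)
  define tr where "tr m = (\<Sum>i<n. m $$ (i, i))" for m :: "complex mat"
  have trace: "tr (x * y) = tr (y * x)" if "x \<in> carrier_mat n n" "y \<in> carrier_mat n n" for x y
  proof -
    have "tr (x * y) = (\<Sum>i<n. \<Sum>l<n. x $$ (i, l) * y $$ (l, i))"
      using that by (simp add: tr_def times_mat_entry del: index_mult_mat)
    also have "\<dots> = (\<Sum>l<n. \<Sum>i<n. y $$ (l, i) * x $$ (i, l))"
      by (subst sum.swap) (intro sum.cong refl mult.commute)
    also have "\<dots> = tr (y * x)"
      using that by (simp add: tr_def times_mat_entry del: index_mult_mat)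
    finally show ?thesis .
  qed
  have herm: "d $$ (i, k) = cnj (d $$ (k, i))" if "i < n" "k < n" for i k
    using that b c psd_entry_commute[OF b(2) that] psd_entry_commute[OF c(2) that]
    by (simp add: d_def)
  have tr_form: "tr (d * (m * d)) = (\<Sum>i<n. vec_inner n (mat_vec n m (\<lambda>l. d $$ (l, i))) (\<lambda>l. d $$ (l, i)))"
    if m: "m \<in> carrier_mat n n" for m
    unfolding tr_def
  proof (rule sum.cong[OF refl])
    fix i assume i: "i \<in> {..<n}"
    have "(d * (m * d)) $$ (i, i) = (\<Sum>k<n. d $$ (i, k) * (m * d) $$ (k, i))"
      using d m i by (intro times_mat_entry) auto
    also have "\<dots> = (\<Sum>k<n. (m * d) $$ (k, i) * cnj (d $$ (k, i)))"
    proof (rule sum.cong[OF refl])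
      fix k assume "k \<in> {..<n}"
      then have "d $$ (i, k) = cnj (d $$ (k, i))"
        using i by (intro herm) auto
      then show "d $$ (i, k) * (m * d) $$ (k, i) = (m * d) $$ (k, i) * cnj (d $$ (k, i))"
        by (simp only: mult.commute)
    qed
    also have "\<dots> = vec_inner n (mat_vec n m (\<lambda>l. d $$ (l, i))) (\<lambda>l. d $$ (l, i))"
      using d m i by (simp add: vec_inner_def mat_vec_def times_mat_entry del: index_mult_mat)
    finally show "(d * (m * d)) $$ (i, i) = vec_inner n (mat_vec n m (\<lambda>l. d $$ (l, i))) (\<lambda>l. d $$ (l, i))" .
  qed
  have "b * d + d * c = (b * b - b * c) + (b * c - c * c)"
    using b c by (simp add: d_def mult_minus_distrib_mat minus_mult_distrib_mat)
  also have "\<dots> = 0\<^sub>m n n"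
    using b(1) c(1) by (intro eq_matI) (auto simp: eq simp del: index_mult_mat(1))
  finally have "d * (b * d + d * c) = 0\<^sub>m n n"
    using d by simp
  then have "d * (b * d) + d * (d * c) = 0\<^sub>m n n"
    using d b c by (subst (asm) mult_add_distrib_mat[of _ n n _ n]) auto
  then have "tr (d * (b * d) + d * (d * c)) = 0"
    by (simp add: tr_def)
  moreover have "tr (d * (b * d) + d * (d * c)) = tr (d * (b * d)) + tr (d * (d * c))"
    unfolding tr_def using b c d by (simp add: sum.distrib del: index_mult_mat(1))
  moreover have "tr (d * (d * c)) = tr (d * (c * d))"
    using trace[of d "d * c"] d c by (simp add: assoc_mult_mat[of d n n c n d n])
  ultimately have "(\<Sum>i<n. vec_inner n (mat_vec n b (\<lambda>l. d $$ (l, i))) (\<lambda>l. d $$ (l, i))) +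
      (\<Sum>i<n. vec_inner n (mat_vec n c (\<lambda>l. d $$ (l, i))) (\<lambda>l. d $$ (l, i))) = 0"
    using tr_form b c by simp
  then have "(\<Sum>i<n. Re (vec_inner n (mat_vec n b (\<lambda>l. d $$ (l, i))) (\<lambda>l. d $$ (l, i)))) +
      (\<Sum>i<n. Re (vec_inner n (mat_vec n c (\<lambda>l. d $$ (l, i))) (\<lambda>l. d $$ (l, i)))) = 0"
    by (metis Re_sum plus_complex.sel(1) zero_complex.sel(1))
  moreover have nonneg: "0 \<le> Re (vec_inner n (mat_vec n m x) x)" if "psd n m" for m x
    using psdD[OF that] by (simp add: complex_nonneg_Reals_iff)
  ultimately have "(\<Sum>i<n. Re (vec_inner n (mat_vec n b (\<lambda>l. d $$ (l, i))) (\<lambda>l. d $$ (l, i)))) = 0"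
    using sum_nonneg[of "{..<n}" "\<lambda>i. Re (vec_inner n (mat_vec n b (\<lambda>l. d $$ (l, i))) (\<lambda>l. d $$ (l, i)))"]
      sum_nonneg[of "{..<n}" "\<lambda>i. Re (vec_inner n (mat_vec n c (\<lambda>l. d $$ (l, i))) (\<lambda>l. d $$ (l, i)))"]
      nonneg[OF b(2)] nonneg[OF c(2)] by (smt (verit))
  then have zero: "Re (vec_inner n (mat_vec n b (\<lambda>l. d $$ (l, i))) (\<lambda>l. d $$ (l, i))) = 0" if "i < n" for i
    using that nonneg[OF b(2)] by (simp add: sum_nonneg_eq_0_iff)
  have "(b * d) $$ (k, i) = 0" if "k < n" "i < n" for k i
  proof -
    let ?y = "mat_vec n b (\<lambda>l. d $$ (l, i))"
    have "(cmod (vec_inner n ?y ?y))\<^sup>2 \<le> Re (vec_inner n (mat_vec n b ?y) ?y) * 0"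
      using psd_Cauchy_Schwarz[OF b(2), of "\<lambda>l. d $$ (l, i)" ?y] zero[OF that(2)] by simp
    then have "vec_norm n ?y = 0"
      by (simp add: vec_inner_self)
    then have "?y k = 0"
      using that by (intro vec_norm_eq_0)
    then show ?thesis
      using that b d by (simp add: mat_vec_def times_mat_entry del: index_mult_mat)
  qed
  then show ?thesis
    using b c d unfolding d_def[symmetric] by (intro eq_matI) (auto simp del: index_mult_mat(1))
qed

lemma positive_inverse_sqrt_unique:
  assumes a: "a \<in> carrier_mat n n"
    and b: "b \<in> carrier_mat n n" "psd n b" "a * (b * b) = 1\<^sub>m n"
    and c: "c \<in> carrier_mat n n" "psd n c" "(c * c) * a = 1\<^sub>m n"
  shows "b = c"
proof -
  have "c * c = (c * c) * (a * (b * b))"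
    using b c by simp
  also have "\<dots> = ((c * c) * a) * (b * b)"
    using a b(1) c(1) by (intro assoc_mult_mat[symmetric]) auto
  also have "\<dots> = b * b"
    unfolding c(3) using b(1) by simp
  finally have "b * (b - c) = 0\<^sub>m n n"
    using b c by (intro psd_square_cancel) simp_all
  then have "a * (b * (b * (b - c))) = 0\<^sub>m n n"
    using a b(1) by simp
  moreover have "a * (b * (b * (b - c))) = (a * (b * b)) * (b - c)"
    using a b(1) minus_carrier_mat[OF c(1), of b] by (simp add: assoc_mult_mat[of _ n n _ n _ n])
  ultimately have z: "b - c = 0\<^sub>m n n"
    using b c by simp
  show ?thesis
  proof (rule eq_matI)
    fix i j assume "i < dim_row c" "j < dim_col c"
    then have ij: "i < n" "j < n"
      using c by auto
    then have "b $$ (i, j) - c $$ (i, j) = (b - c) $$ (i, j)"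
      using c by simp
    also have "(b - c) $$ (i, j) = 0"
      unfolding z using ij by simp
    finally show "b $$ (i, j) = c $$ (i, j)" by simp
  qed (use b c in auto)
qed

subsection \<open>Existence\<close>

text \<open>The Taylor coefficients of \<open>(1 - x) powr (- 1 / 2)\<close>.\<close>

definition inv_sqrt_coeff :: "nat \<Rightarrow> real"
  where "inv_sqrt_coeff m = pochhammer (1 / 2) m / fact m"

lemma inv_sqrt_coeff_nonneg: "0 \<le> inv_sqrt_coeff m"
  by (simp add: inv_sqrt_coeff_def pochhammer_nonneg)

text \<open>The square of \<open>(1 - x) powr (- 1 / 2)\<close> is the geometric series; on coefficients this is the
  Vandermonde identity.\<close>

lemma inv_sqrt_coeff_convolution: "(\<Sum>k\<le>m. inv_sqrt_coeff k * inv_sqrt_coeff (m - k)) = 1"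
proof -
  have coeff: "inv_sqrt_coeff k = (- 1) ^ k * ((- 1 / 2) gchoose k)" for k
    unfolding inv_sqrt_coeff_def gbinomial_pochhammer by (simp flip: power_mult_distrib)
  have "(\<Sum>k\<le>m. inv_sqrt_coeff k * inv_sqrt_coeff (m - k)) =
      (\<Sum>k\<le>m. (- 1) ^ m * (((- 1 / 2) gchoose k) * ((- 1 / 2) gchoose (m - k))))"
    unfolding coeff by (intro sum.cong refl) (simp add: mult_ac flip: power_add)
  also have "\<dots> = (- 1) ^ m * ((- 1) gchoose m)"
    using gbinomial_Vandermonde[of "- 1 / 2 :: real" "- 1 / 2" m]
    by (simp add: atMost_atLeast0 flip: sum_distrib_left)
  also have "\<dots> = 1"
    using gbinomial_minus[of "1 :: real" m] by (simp add: binomial_gbinomial[symmetric] flip: power_mult_distrib)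
  finally show ?thesis .
qed

lemma inv_sqrt_coeff_le_1: "inv_sqrt_coeff m \<le> 1"
proof -
  have "inv_sqrt_coeff 0 * inv_sqrt_coeff (m - 0) \<le> (\<Sum>k\<le>m. inv_sqrt_coeff k * inv_sqrt_coeff (m - k))"
    by (intro member_le_sum) (auto intro: inv_sqrt_coeff_nonneg mult_nonneg_nonneg)
  then show ?thesis
    by (simp add: inv_sqrt_coeff_convolution) (simp add: inv_sqrt_coeff_def)
qed

text \<open>The norm bound follows from the bound on the form by the Cauchy--Schwarz inequality for the form of
  \<open>a\<close> itself, at \<open>x\<close> and \<open>a x\<close>.\<close>

lemma vec_norm_mat_vec_le:
  assumes a: "psd n a" and "0 \<le> r" and le: "\<And>x. Re (vec_inner n (mat_vec n a x) x) \<le> r * (vec_norm n x)\<^sup>2"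
  shows "vec_norm n (mat_vec n a x) \<le> r * vec_norm n x"
proof -
  let ?y = "mat_vec n a x"
  have nonneg: "0 \<le> Re (vec_inner n (mat_vec n a x) x)" for x
    using psdD[OF a] by (simp add: complex_nonneg_Reals_iff)
  have "((vec_norm n ?y)\<^sup>2)\<^sup>2 = (cmod (vec_inner n ?y ?y))\<^sup>2"
    by (simp add: vec_inner_self del: of_real_power)
  also have "\<dots> \<le> Re (vec_inner n (mat_vec n a ?y) ?y) * Re (vec_inner n ?y x)"
    by (rule psd_Cauchy_Schwarz[OF a])
  also have "\<dots> \<le> (r * (vec_norm n ?y)\<^sup>2) * (r * (vec_norm n x)\<^sup>2)"
    using nonneg le \<open>0 \<le> r\<close> by (intro mult_mono) auto
  finally have *: "(vec_norm n ?y)\<^sup>2 * (vec_norm n ?y)\<^sup>2 \<le> (vec_norm n ?y)\<^sup>2 * (r * vec_norm n x)\<^sup>2"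
    by (simp add: power2_eq_square mult_ac)
  then have "(vec_norm n ?y)\<^sup>2 \<le> (r * vec_norm n x)\<^sup>2"
  proof (cases "(vec_norm n ?y)\<^sup>2 = 0")
    case False
    then have "(vec_norm n ?y)\<^sup>2 > 0"
      by (simp add: less_le)
    with * show ?thesis
      by (rule mult_left_le_imp_le)
  qed (simp only: zero_le_power2)
  then show ?thesis
    by (rule power2_le_imp_le) (intro mult_nonneg_nonneg L2_set_nonneg \<open>0 \<le> r\<close>)
qed

lemma pow_mat_Suc_left:
  fixes K :: "complex mat"
  assumes K: "K \<in> carrier_mat n n"
  shows "K ^\<^sub>m Suc m = K * K ^\<^sub>m m"
proof (induction m)
  case (Suc m)
  have "K ^\<^sub>m Suc (Suc m) = (K * K ^\<^sub>m m) * K"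
    using Suc by simp
  also have "\<dots> = K * K ^\<^sub>m Suc m"
    using K by (simp add: assoc_mult_mat[of _ n n _ n _ n])
  finally show ?case .
qed (use K in auto)

lemma pow_mat_add:
  fixes K :: "complex mat"
  assumes K: "K \<in> carrier_mat n n"
  shows "K ^\<^sub>m (m + k) = K ^\<^sub>m m * K ^\<^sub>m k"
proof (induction k)
  case (Suc k)
  have "K ^\<^sub>m (m + Suc k) = (K ^\<^sub>m m * K ^\<^sub>m k) * K"
    using Suc by simp
  also have "\<dots> = K ^\<^sub>m m * (K ^\<^sub>m k * K)"
    using K by (intro assoc_mult_mat[of _ n n _ n _ n]) auto
  finally show ?case by simp
qed (use K in auto)

text \<open>The form of \<open>K\<^sup>m\<^sup>+\<^sup>2\<close> at \<open>x\<close> is the form of \<open>K\<^sup>m\<close> at \<open>K x\<close>.\<close>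

lemma psd_pow_mat:
  assumes K: "K \<in> carrier_mat n n" "psd n K"
  shows "psd n (K ^\<^sub>m m)"
proof (induction m rule: induct_nat_012)
  case 0
  have "vec_inner n (mat_vec n (K ^\<^sub>m 0) x) x = vec_inner n x x" for x
    using K by (intro vec_inner_cong) (auto simp: mat_vec_def if_distrib[where f = "\<lambda>z. z * w" for w] cong: if_cong)
  then show ?case
    by (simp add: psd_def vec_inner_self)
next
  case 1
  then show ?case using K by simp
next
  case (ge2 m)
  have "vec_inner n (mat_vec n (K ^\<^sub>m Suc (Suc m)) x) x =
      vec_inner n (mat_vec n (K ^\<^sub>m m) (mat_vec n K x)) (mat_vec n K x)" for x
  proof -
    have "K ^\<^sub>m Suc (Suc m) = K * (K ^\<^sub>m m * K)"
      unfolding pow_mat_Suc_left[OF K(1), of "Suc m"] by simp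
    then have "vec_inner n (mat_vec n (K ^\<^sub>m Suc (Suc m)) x) x =
        vec_inner n (mat_vec n K (mat_vec n (K ^\<^sub>m m * K) x)) x"
      using K(1) by (intro vec_inner_cong) (auto intro!: mat_vec_times)
    also have "\<dots> = vec_inner n (mat_vec n (K ^\<^sub>m m * K) x) (mat_vec n K x)"
      by (rule psd_symmetric[OF K(2)])
    also have "\<dots> = vec_inner n (mat_vec n (K ^\<^sub>m m) (mat_vec n K x)) (mat_vec n K x)"
      using K(1) by (intro vec_inner_cong) (auto intro!: mat_vec_times)
    finally show ?thesis .
  qed
  then show ?case
    using ge2 by (simp add: psd_def)
qed

lemma pow_mat_entry_bound:
  fixes K :: "complex mat"
  assumes K: "K \<in> carrier_mat n n" and "0 \<le> r"
    and le: "\<And>x. vec_norm n (mat_vec n K x) \<le> r * vec_norm n x"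
    and ij: "i < n" "j < n"
  shows "cmod ((K ^\<^sub>m m) $$ (i, j)) \<le> r ^ m"
proof -
  have bound: "vec_norm n (mat_vec n (K ^\<^sub>m m) x) \<le> r ^ m * vec_norm n x" for x
  proof (induction m arbitrary: x)
    case 0
    have "vec_norm n (mat_vec n (K ^\<^sub>m 0) x) = vec_norm n x"
      using K by (intro L2_set_cong) (auto simp: mat_vec_def if_distrib[where f = "\<lambda>z. z * w" for w] cong: if_cong)
    then show ?case by simp
  next
    case (Suc m)
    have "vec_norm n (mat_vec n (K ^\<^sub>m Suc m) x) = vec_norm n (mat_vec n (K ^\<^sub>m m) (mat_vec n K x))"
      using K by (intro L2_set_cong refl) (simp add: mat_vec_times)
    also have "\<dots> \<le> r ^ m * vec_norm n (mat_vec n K x)"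
      by (rule Suc)
    also have "\<dots> \<le> r ^ m * (r * vec_norm n x)"
      using le \<open>0 \<le> r\<close> by (intro mult_left_mono) auto
    finally show ?case by (simp add: mult_ac)
  qed
  let ?e = "\<lambda>l. if l = j then 1 else (0 :: complex)"
  have "cmod ((K ^\<^sub>m m) $$ (i, j)) = norm (mat_vec n (K ^\<^sub>m m) ?e i)"
    using ij by (simp add: mat_vec_unit)
  also have "\<dots> \<le> vec_norm n (mat_vec n (K ^\<^sub>m m) ?e)"
    using ij by (intro member_le_L2_set) auto
  also have "\<dots> \<le> r ^ m * vec_norm n ?e"
    by (rule bound)
  also have "vec_norm n ?e = 1"
    using ij by (simp add: L2_set_def if_distrib[where f = cmod] if_distrib[where f = "\<lambda>z. z\<^sup>2"] cong: if_cong)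
  finally show ?thesis by simp
qed

text \<open>For \<open>0 \<le> K \<le> r < 1\<close> the series \<open>\<Sum>m. c m * K ^ m\<close> with the above coefficients converges to a
  positive matrix, which squares to the Neumann series of \<open>inverse (1 - K)\<close> by the convolution
  identity.\<close>

lemma inverse_sqrt_of_one_minus:
  fixes K :: "complex mat"
  assumes K: "K \<in> carrier_mat n n" "psd n K" and r: "0 \<le> r" "r < 1"
    and le: "\<And>x. vec_norm n (mat_vec n K x) \<le> r * vec_norm n x"
  shows "\<exists>b \<in> carrier_mat n n. psd n b \<and> (b * b) * (1\<^sub>m n - K) = 1\<^sub>m n"
proof -
  define f where "f i j m = complex_of_real (inv_sqrt_coeff m) * (K ^\<^sub>m m) $$ (i, j)" for i j m
  have entry: "cmod ((K ^\<^sub>m m) $$ (i, j)) \<le> r ^ m" if "i < n" "j < n" for i j m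
    using K(1) r(1) le that by (rule pow_mat_entry_bound)
  have f_bound: "norm (f i j m) \<le> r ^ m" if "i < n" "j < n" for i j m
  proof -
    have "norm (f i j m) = inv_sqrt_coeff m * cmod ((K ^\<^sub>m m) $$ (i, j))"
      by (simp add: f_def norm_mult inv_sqrt_coeff_nonneg)
    also have "\<dots> \<le> 1 * r ^ m"
      using entry[OF that] r(1) by (intro mult_mono inv_sqrt_coeff_le_1) auto
    finally show ?thesis by simp
  qed
  have geometric: "summable (\<lambda>m. r ^ m)"
    using r by (simp add: summable_geometric)
  have f_abs: "summable (\<lambda>m. norm (f i j m))" if "i < n" "j < n" for i j
    by (rule summable_comparison_test'[OF geometric, of 0]) (use f_bound[OF that] in auto)
  define b where "b = mat n n (\<lambda>(i, j). suminf (f i j))"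
  have b: "b \<in> carrier_mat n n" by (simp add: b_def)
  have b_sums: "f i j sums b $$ (i, j)" if "i < n" "j < n" for i j
    using summable_norm_cancel[OF f_abs[OF that]] that by (simp add: b_def summable_sums)
  have "psd n b"
    unfolding psd_def
  proof
    fix x
    have "(\<lambda>m. \<Sum>i<n. \<Sum>j<n. f i j m * x j * cnj (x i)) sums vec_inner n (mat_vec n b x) x"
      unfolding vec_inner_mat_vec by (intro sums_sum sums_mult2 b_sums) auto
    moreover have "(\<Sum>i<n. \<Sum>j<n. f i j m * x j * cnj (x i)) =
        complex_of_real (inv_sqrt_coeff m) * vec_inner n (mat_vec n (K ^\<^sub>m m) x) x" for m
      by (simp add: f_def vec_inner_mat_vec sum_distrib_left mult.assoc)
    ultimately have "(\<lambda>m. complex_of_real (inv_sqrt_coeff m) * vec_inner n (mat_vec n (K ^\<^sub>m m) x) x)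
        sums vec_inner n (mat_vec n b x) x"
      by simp
    then have lim: "(\<lambda>N. \<Sum>m<N. complex_of_real (inv_sqrt_coeff m) * vec_inner n (mat_vec n (K ^\<^sub>m m) x) x)
        \<longlonglongrightarrow> vec_inner n (mat_vec n b x) x"
      by (simp add: sums_def)
    have "(\<Sum>m<N. complex_of_real (inv_sqrt_coeff m) * vec_inner n (mat_vec n (K ^\<^sub>m m) x) x) \<in> \<real>\<^sub>\<ge>\<^sub>0" for N
      using psdD[OF psd_pow_mat[OF K]] inv_sqrt_coeff_nonneg
      by (induction N) (auto intro!: nonneg_Reals_add_I nonneg_Reals_mult_I)
    then show "vec_inner n (mat_vec n b x) x \<in> \<real>\<^sub>\<ge>\<^sub>0"
      by (rule closed_sequentially[OF closed_nonneg_Reals_complex _ lim])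
  qed
  moreover have "(b * b) * (1\<^sub>m n - K) = 1\<^sub>m n"
  proof (rule eq_matI)
    fix i j assume "i < dim_row (1\<^sub>m n :: complex mat)" "j < dim_col (1\<^sub>m n :: complex mat)"
    then have ij: "i < n" "j < n" by auto
    have square: "(\<lambda>N. (K ^\<^sub>m N) $$ (i, j)) sums ((b * b) $$ (i, j))" if "j < n" for j
    proof -
      have "(\<lambda>N. \<Sum>l<n. \<Sum>k\<le>N. f i l k * f l j (N - k)) sums (\<Sum>l<n. b $$ (i, l) * b $$ (l, j))"
      proof (rule sums_sum)
        fix l assume l: "l \<in> {..<n}"
        show "(\<lambda>N. \<Sum>k\<le>N. f i l k * f l j (N - k)) sums (b $$ (i, l) * b $$ (l, j))"
          using Cauchy_product_sums[OF f_abs[of i l] f_abs[of l j]] l ij that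
          by (simp add: sums_unique[OF b_sums, symmetric])
      qed
      moreover have "(\<Sum>l<n. \<Sum>k\<le>N. f i l k * f l j (N - k)) = (K ^\<^sub>m N) $$ (i, j)" for N
      proof -
        have "(\<Sum>l<n. \<Sum>k\<le>N. f i l k * f l j (N - k)) =
            (\<Sum>k\<le>N. complex_of_real (inv_sqrt_coeff k * inv_sqrt_coeff (N - k)) *
              (\<Sum>l<n. (K ^\<^sub>m k) $$ (i, l) * (K ^\<^sub>m (N - k)) $$ (l, j)))"
          by (subst sum.swap) (simp add: f_def sum_distrib_left mult_ac)
        also have "\<dots> = (\<Sum>k\<le>N. complex_of_real (inv_sqrt_coeff k * inv_sqrt_coeff (N - k)) * (K ^\<^sub>m N) $$ (i, j))"
        proof (intro sum.cong refl)
          fix k assume "k \<in> {..N}"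
          then have "K ^\<^sub>m N = K ^\<^sub>m k * K ^\<^sub>m (N - k)"
            using pow_mat_add[OF K(1), of k "N - k"] by simp
          then show "complex_of_real (inv_sqrt_coeff k * inv_sqrt_coeff (N - k)) *
              (\<Sum>l<n. (K ^\<^sub>m k) $$ (i, l) * (K ^\<^sub>m (N - k)) $$ (l, j)) =
              complex_of_real (inv_sqrt_coeff k * inv_sqrt_coeff (N - k)) * (K ^\<^sub>m N) $$ (i, j)"
            using times_mat_entry[of "K ^\<^sub>m k" n "K ^\<^sub>m (N - k)" i j] K(1) ij that by simp
        qed
        also have "\<dots> = complex_of_real (\<Sum>k\<le>N. inv_sqrt_coeff k * inv_sqrt_coeff (N - k)) * (K ^\<^sub>m N) $$ (i, j)"
          by (simp add: sum_distrib_right)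
        finally show ?thesis
          by (simp add: inv_sqrt_coeff_convolution)
      qed
      ultimately show ?thesis
        using times_mat_entry[OF b b ij(1) that] by simp
    qed
    have "(\<lambda>N. \<Sum>l<n. (K ^\<^sub>m N) $$ (i, l) * (1\<^sub>m n - K) $$ (l, j)) sums
        (\<Sum>l<n. (b * b) $$ (i, l) * (1\<^sub>m n - K) $$ (l, j))"
      by (intro sums_sum sums_mult2 square) auto
    moreover have "(\<Sum>l<n. (b * b) $$ (i, l) * (1\<^sub>m n - K) $$ (l, j)) = ((b * b) * (1\<^sub>m n - K)) $$ (i, j)"
      by (rule times_mat_entry[symmetric]) (use b K(1) ij in \<open>auto intro!: minus_carrier_mat\<close>)
    moreover have "(\<Sum>l<n. (K ^\<^sub>m N) $$ (i, l) * (1\<^sub>m n - K) $$ (l, j)) =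
        (K ^\<^sub>m N) $$ (i, j) - (K ^\<^sub>m Suc N) $$ (i, j)" for N
    proof -
      have "(\<Sum>l<n. (K ^\<^sub>m N) $$ (i, l) * (1\<^sub>m n - K) $$ (l, j)) = (K ^\<^sub>m N * (1\<^sub>m n - K)) $$ (i, j)"
        by (rule times_mat_entry[symmetric]) (use K(1) ij in \<open>auto intro!: minus_carrier_mat\<close>)
      also have "K ^\<^sub>m N * (1\<^sub>m n - K) = K ^\<^sub>m N - K ^\<^sub>m Suc N"
        using K(1) by (simp add: mult_minus_distrib_mat[of _ n n _ n])
      finally show ?thesis
        using K(1) ij by simp
    qed
    ultimately have "(\<lambda>N. (K ^\<^sub>m N) $$ (i, j) - (K ^\<^sub>m Suc N) $$ (i, j)) sums
        ((b * b) * (1\<^sub>m n - K)) $$ (i, j)"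
      by simp
    moreover have "(\<lambda>N. (K ^\<^sub>m N) $$ (i, j) - (K ^\<^sub>m Suc N) $$ (i, j)) sums ((K ^\<^sub>m 0) $$ (i, j) - 0)"
    proof (rule telescope_sums')
      show "(\<lambda>N. (K ^\<^sub>m N) $$ (i, j)) \<longlonglongrightarrow> 0"
        by (rule Lim_null_comparison[OF _ LIMSEQ_realpow_zero[OF r]]) (simp add: entry[OF ij])
    qed
    ultimately have "((b * b) * (1\<^sub>m n - K)) $$ (i, j) = (K ^\<^sub>m 0) $$ (i, j) - 0"
      by (rule sums_unique2)
    then show "((b * b) * (1\<^sub>m n - K)) $$ (i, j) = 1\<^sub>m n $$ (i, j)"
      using K(1) by simp
  qed (use b K(1) in auto)
  ultimately show ?thesis
    using b by blast
qed

text \<open>Dividing \<open>a\<close> by an upper bound \<open>t\<close> turns it into \<open>1 - K\<close> with \<open>0 \<le> K \<le> 1 - \<epsilon> / t\<close>.\<close>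

lemma positive_inverse_sqrt_exists:
  fixes a :: "complex mat"
  assumes a: "a \<in> carrier_mat n n" "psd n a" and \<epsilon>: "0 < \<epsilon>"
    and lower: "\<And>x. \<epsilon> * (vec_norm n x)\<^sup>2 \<le> Re (vec_inner n (mat_vec n a x) x)"
  shows "\<exists>b \<in> carrier_mat n n. psd n b \<and> (b * b) * a = 1\<^sub>m n"
proof -
  let ?A = "map_mat scalar_op a :: (complex \<Rightarrow>\<^sub>L complex) mat"
  define t where "t = \<epsilon> + op_mat_norm ?A"
  have A: "?A \<in> carrier_mat n n" using a(1) by simp
  have t: "t \<ge> \<epsilon>" "t > 0"
    using \<epsilon> op_mat_norm_nonneg[OF A] by (auto simp: t_def)
  have upper: "Re (vec_inner n (mat_vec n a x) x) \<le> t * (vec_norm n x)\<^sup>2" for x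
  proof -
    have "Re (vec_inner n (mat_vec n a x) x) \<le> op_mat_norm ?A * (vec_norm n x)\<^sup>2"
      using mat_form_le[OF A, of x x] complex_Re_le_cmod[of "vec_inner n (mat_vec n a x) x"]
      by (simp add: mat_form_scalar[OF a(1)] vec_inner_mat_vec power2_eq_square mult.assoc)
    also have "\<dots> \<le> t * (vec_norm n x)\<^sup>2"
      using \<epsilon> by (intro mult_right_mono) (auto simp: t_def)
    finally show ?thesis .
  qed
  define L where "L = complex_of_real (1 / t) \<cdot>\<^sub>m a"
  define K where "K = 1\<^sub>m n - L"
  have L: "L \<in> carrier_mat n n" and K: "K \<in> carrier_mat n n"
    using a(1) by (simp_all add: L_def K_def minus_carrier_mat)
  have form_K: "vec_inner n (mat_vec n K x) x = vec_inner n x x - vec_inner n (mat_vec n a x) x / t" for x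
  proof -
    have "mat_vec n K x i = x i - mat_vec n a x i / t" if "i < n" for i
    proof -
      have "mat_vec n K x i = (\<Sum>j<n. (if i = j then x j else 0) - a $$ (i, j) * x j / t)"
        unfolding mat_vec_def using that a(1) by (intro sum.cong refl) (auto simp: K_def L_def algebra_simps)
      then show ?thesis
        using that by (simp add: sum_subtractf mat_vec_def sum_divide_distrib)
    qed
    then show ?thesis
      by (simp add: vec_inner_def sum_subtractf sum_divide_distrib left_diff_distrib)
  qed
  define r where "r = 1 - \<epsilon> / t"
  have r: "0 \<le> r" "r < 1"
    using t \<epsilon> by (auto simp: r_def)
  have re: "Re (vec_inner n (mat_vec n K x) x) = (vec_norm n x)\<^sup>2 - Re (vec_inner n (mat_vec n a x) x) / t" for x
    by (simp add: form_K vec_inner_self del: of_real_power)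
  have K_psd: "psd n K"
    unfolding psd_def
  proof
    fix x
    have "Im (vec_inner n (mat_vec n a x) x) = 0"
      using psdD[OF a(2)] by (simp add: complex_nonneg_Reals_iff)
    then have "Im (vec_inner n (mat_vec n K x) x) = 0"
      by (simp add: form_K vec_inner_self del: of_real_power)
    moreover have "0 \<le> Re (vec_inner n (mat_vec n K x) x)"
      using upper[of x] t by (simp add: re field_simps)
    ultimately show "vec_inner n (mat_vec n K x) x \<in> \<real>\<^sub>\<ge>\<^sub>0"
      by (simp add: complex_nonneg_Reals_iff)
  qed
  have "Re (vec_inner n (mat_vec n K x) x) \<le> r * (vec_norm n x)\<^sup>2" for x
    using lower[of x] t by (simp add: re r_def field_simps)
  then have "vec_norm n (mat_vec n K x) \<le> r * vec_norm n x" for x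
    by (rule vec_norm_mat_vec_le[OF K_psd r(1)])
  then obtain b where b: "b \<in> carrier_mat n n" "psd n b" and inv: "(b * b) * (1\<^sub>m n - K) = 1\<^sub>m n"
    using inverse_sqrt_of_one_minus[OF K K_psd r] by blast
  have KL: "1\<^sub>m n - K = L"
    using L by (intro eq_matI) (auto simp: K_def)
  let ?s = "complex_of_real (1 / sqrt t)"
  have "psd n (?s \<cdot>\<^sub>m b)"
    unfolding psd_def
  proof
    fix x
    have "vec_inner n (mat_vec n (?s \<cdot>\<^sub>m b) x) x = ?s * vec_inner n (mat_vec n b x) x"
      unfolding vec_inner_mat_vec sum_distrib_left using b(1) by (intro sum.cong refl) auto
    also have "\<dots> \<in> \<real>\<^sub>\<ge>\<^sub>0"
      using psdD[OF b(2)] t by (intro nonneg_Reals_mult_I) auto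
    finally show "vec_inner n (mat_vec n (?s \<cdot>\<^sub>m b) x) x \<in> \<real>\<^sub>\<ge>\<^sub>0" .
  qed
  moreover have "((?s \<cdot>\<^sub>m b) * (?s \<cdot>\<^sub>m b)) * a = 1\<^sub>m n"
  proof -
    have "?s * ?s = complex_of_real (1 / t)"
      using t by (simp flip: of_real_mult real_sqrt_mult)
    then have "(?s \<cdot>\<^sub>m b) * (?s \<cdot>\<^sub>m b) = complex_of_real (1 / t) \<cdot>\<^sub>m (b * b)"
      using b(1) by (simp add: mult_smult_assoc_mat[of _ n n _ n] mult_smult_distrib[of _ n n _ n])
         (intro eq_matI, auto simp: mult.assoc[symmetric])
    also have "\<dots> * a = (b * b) * L"
      using a(1) b(1) by (simp add: L_def mult_smult_assoc_mat[of _ n n _ n] mult_smult_distrib[of _ n n _ n])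
    finally show ?thesis
      using inv KL by simp
  qed
  ultimately show ?thesis
    using b(1) by (intro bexI[of _ "?s \<cdot>\<^sub>m b"]) auto
qed

lemma inv_sqrt_mat_carrier:
  assumes \<alpha>: "\<alpha> \<in> carrier_mat n n" "mpos scalars \<alpha>" and \<epsilon>: "0 < \<epsilon>"
  shows "inv_sqrt_mat (\<alpha> + complex_of_real \<epsilon> \<cdot>\<^sub>m 1\<^sub>m n) \<in> carrier_mat n n"
proof -
  define a where "a = \<alpha> + complex_of_real \<epsilon> \<cdot>\<^sub>m 1\<^sub>m n"
  have a: "a \<in> carrier_mat n n"
    using \<alpha>(1) by (simp add: a_def)
  have psd_\<alpha>: "psd n \<alpha>"
    using \<alpha> mpos_scalars_iff by blast
  have form: "vec_inner n (mat_vec n a x) x = vec_inner n (mat_vec n \<alpha> x) x + \<epsilon> * vec_inner n x x" for x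
  proof -
    have "mat_vec n a x i = mat_vec n \<alpha> x i + \<epsilon> * x i" if "i < n" for i
    proof -
      have "mat_vec n a x i = (\<Sum>j<n. \<alpha> $$ (i, j) * x j + (if i = j then \<epsilon> * x j else 0))"
        unfolding mat_vec_def using that \<alpha>(1) by (intro sum.cong refl) (auto simp: a_def algebra_simps)
      then show ?thesis
        using that by (simp add: sum.distrib mat_vec_def)
    qed
    then show ?thesis
      by (simp add: vec_inner_def sum.distrib sum_distrib_left distrib_right mult.assoc)
  qed
  have lower: "\<epsilon> * (vec_norm n x)\<^sup>2 \<le> Re (vec_inner n (mat_vec n a x) x)" for x
    using psdD[OF psd_\<alpha>, of x] by (simp add: form vec_inner_self complex_nonneg_Reals_iff del: of_real_power)
  have psd_a: "psd n a"
    unfolding psd_def form using psdD[OF psd_\<alpha>] \<epsilon>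
    by (auto intro!: nonneg_Reals_add_I nonneg_Reals_mult_I simp: vec_inner_self)
  obtain b where b: "b \<in> carrier_mat n n" "psd n b" "(b * b) * a = 1\<^sub>m n"
    using positive_inverse_sqrt_exists[OF a psd_a \<epsilon> lower] by blast
  have ba: "a * (b * b) = 1\<^sub>m n"
    using b a by (intro mat_mult_left_right_inverse[of "b * b" n a]) auto
  have "inv_sqrt_mat a = b"
    unfolding inv_sqrt_mat_def
  proof (rule the_equality)
    show "b \<in> carrier_mat (dim_row a) (dim_row a) \<and> mpos scalars b \<and>
        inverts_mat (b * b) a \<and> inverts_mat a (b * b)"
      using a b ba mpos_scalars_iff[OF b(1)] by (simp add: inverts_mat_def del: scalars_sel)
    fix c assume c: "c \<in> carrier_mat (dim_row a) (dim_row a) \<and> mpos scalars c \<and>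
        inverts_mat (c * c) a \<and> inverts_mat a (c * c)"
    then have "c \<in> carrier_mat n n" "psd n c" "(c * c) * a = 1\<^sub>m n"
      using a mpos_scalars_iff[of c n] by (auto simp: inverts_mat_def simp del: scalars_sel)
    then show "c = b"
      using positive_inverse_sqrt_unique[OF a b(1,2) ba] by simp
  qed
  then show ?thesis
    using b by (simp add: a_def)
qed

section \<open>The inclusion is an embedding\<close>

lemma map_mat_ident: "map_mat (\<lambda>x. x) X = X"
  by (rule eq_matI) auto

lemma map_mat_inv_into_inclusion:
  assumes "X \<in> mats (W\<lparr>elems := E\<rparr>) n"
  shows "map_mat (inv_into E (\<lambda>x. x)) X = X"
proof -
  have "inv_into E (\<lambda>x. x) x = x" if "x \<in> E" for x
    using inv_into_f_f[of "\<lambda>x. x" E x] that by simp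
  then show ?thesis
    using assms by (intro eq_matI) (auto simp: mats_def)
qed

text \<open>The inverse map is the identity only on the carrier of \<open>V\<close>; the closure conditions keep sums,
  multiples and adjoints there.\<close>

lemma inclusion_complete_order_embedding:
  fixes V W :: "('v, 'd) mat_ordered_scheme"
  assumes sub: "elems V \<subseteq> elems W"
    and ops: "vadd V = vadd W" "vscale V = vscale W" "vstar V = vstar W"
    and closed: "\<And>x y. x \<in> elems V \<Longrightarrow> y \<in> elems V \<Longrightarrow> vadd V x y \<in> elems V"
      "\<And>c x. x \<in> elems V \<Longrightarrow> vscale V c x \<in> elems V" "\<And>x. x \<in> elems V \<Longrightarrow> vstar V x \<in> elems V"
    and pos: "\<And>n X. 1 \<le> n \<Longrightarrow> X \<in> mats V n \<Longrightarrow> mpos V X \<longleftrightarrow> mpos W X"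
  shows "complete_order_embedding V W (\<lambda>x. x)"
proof -
  let ?g = "inv_into (elems V) (\<lambda>x. x)"
  let ?W = "W\<lparr>elems := elems V\<rparr>"
  have g: "?g x = x" if "x \<in> elems V" for x
    using inv_into_f_f[of "\<lambda>x. x" "elems V" x] that by simp
  have star: "mstar W X = mstar V X" "mstar ?W X = mstar V X" for X
    by (simp_all add: mstar_def ops)
  have "completely_positive V W (\<lambda>x. x)"
    using sub pos
    by (auto simp: completely_positive_def linear_map_def amplification_positive_def map_mat_ident ops star)
  moreover have "completely_positive ?W V ?g"
    unfolding completely_positive_def amplification_positive_def
  proof (intro conjI allI impI ballI)
    show "linear_map ?W V ?g"
      using closed by (auto simp: linear_map_def g ops)
    fix n :: nat and X assume n: "1 \<le> n" and X: "X \<in> mats ?W n"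
    then have XV: "X \<in> mats V n"
      by (simp add: mats_def)
    have "mstar ?W X \<in> mats ?W n"
      using XV closed(3) by (auto simp: mats_def mstar_def ops)
    then show "map_mat ?g (mstar ?W X) = mstar V (map_mat ?g X)"
      by (simp add: map_mat_inv_into_inclusion[OF X] map_mat_inv_into_inclusion star)
    assume "mpos ?W X"
    then show "mpos V (map_mat ?g X)"
      by (simp add: map_mat_inv_into_inclusion[OF X] pos[OF n XV])
  qed
  ultimately show ?thesis
    by (simp add: complete_order_embedding_def)
qed

lemma compress_mat_op_mats:
  assumes S: "selfadjoint_operator_space S" and "b \<in> carrier_mat n n" "s \<in> op_mats S n"
  shows "compress_mat b s \<in> op_mats S n"
  using assms(2,3) op_mats_carrier[OF assms(3)]
  by (auto simp: op_mats_def compress_mat_def intro!: sa_space_sum[OF S] sa_space_scale[OF S])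

text \<open>Positivity in the unitisation is tested by all completely contractive completely positive
  functionals: restriction of those of \<open>T\<close> gives one direction, extension of those of \<open>S\<close> the other.\<close>

lemma unitisation_pos_extension:
  assumes S: "selfadjoint_operator_space S" and "S \<subseteq> T"
    and ext: "\<And>\<phi>. \<phi> \<in> CCP (matrix_space n (operator_space S)) scalars \<Longrightarrow>
      \<exists>\<psi> \<in> CCP (matrix_space n (operator_space T)) scalars. \<forall>X \<in> op_mats S n. \<psi> X = \<phi> X"
    and s: "s \<in> op_mats S n" and \<alpha>: "\<alpha> \<in> carrier_mat n n"
  shows "unitisation_pos S n s \<alpha> \<longleftrightarrow> unitisation_pos T n s \<alpha>"
proof
  assume "unitisation_pos S n s \<alpha>"
  then show "unitisation_pos T n s \<alpha>"
    using CCP_restrict[OF \<open>S \<subseteq> T\<close>] by (auto simp: unitisation_pos_def simp del: scalars_sel)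
next
  assume T: "unitisation_pos T n s \<alpha>"
  show "unitisation_pos S n s \<alpha>"
    unfolding unitisation_pos_def
  proof (intro conjI allI impI ballI)
    show \<alpha>_pos: "mpos scalars \<alpha>"
      using T by (simp add: unitisation_pos_def del: scalars_sel)
    fix \<epsilon> :: real and \<phi>
    assume \<epsilon>: "0 < \<epsilon>" and "\<phi> \<in> CCP (matrix_space n (operator_space S)) scalars"
    then obtain \<psi> where \<psi>: "\<psi> \<in> CCP (matrix_space n (operator_space T)) scalars"
      and eq: "\<And>X. X \<in> op_mats S n \<Longrightarrow> \<psi> X = \<phi> X"
      using ext by blast
    let ?b = "inv_sqrt_mat (\<alpha> + complex_of_real \<epsilon> \<cdot>\<^sub>m 1\<^sub>m n)"
    have "- 1 \<le> Re (\<psi> (compress_mat ?b s))"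
      using T \<psi> \<epsilon> by (auto simp: unitisation_pos_def simp del: scalars_sel)
    moreover have "compress_mat ?b s \<in> op_mats S n"
      using inv_sqrt_mat_carrier[OF \<alpha> \<alpha>_pos \<epsilon>] s by (rule compress_mat_op_mats[OF S])
    ultimately show "- 1 \<le> Re (\<phi> (compress_mat ?b s))"
      by (simp add: eq)
  qed
qed

theorem inclusion_is_embedding:
  assumes S: "selfadjoint_operator_space S" and "S \<subseteq> T"
    and ext: "\<And>n \<phi>. \<phi> \<in> CCP (matrix_space n (operator_space S)) scalars \<Longrightarrow>
      \<exists>\<psi> \<in> CCP (matrix_space n (operator_space T)) scalars. \<forall>X \<in> op_mats S n. \<psi> X = \<phi> X"
  shows "is_embedding S T (\<lambda>s. s)"
  unfolding is_embedding_def
proof (intro conjI)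
  show "completely_isometric (operator_space S) (operator_space T) (\<lambda>s. s)"
    using \<open>S \<subseteq> T\<close> by (auto simp: completely_isometric_def linear_map_def map_mat_ident)
  show "complete_order_embedding (operator_space S) (operator_space T) (\<lambda>s. s)"
    using \<open>S \<subseteq> T\<close> S
    by (intro inclusion_complete_order_embedding) (auto simp: sa_space_add sa_space_scale sa_space_adj)
  have "unitised_map (\<lambda>s. s) = (\<lambda>x :: ('a \<Rightarrow>\<^sub>L 'a) \<times> complex. x)"
    by (auto simp: unitised_map_def)
  moreover have "complete_order_embedding (unitisation S) (unitisation T) (\<lambda>x. x)"
  proof (rule inclusion_complete_order_embedding)
    fix n X assume X: "X \<in> mats (unitisation S) n"
    have "map_mat fst X \<in> op_mats S n" "map_mat snd X \<in> carrier_mat n n" "dim_row X = n"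
      using X by (auto simp: mats_def unitisation_def op_mats_def mem_Times_iff)
    then show "mpos (unitisation S) X \<longleftrightarrow> mpos (unitisation T) X"
      using unitisation_pos_extension[OF S \<open>S \<subseteq> T\<close> ext] by (simp add: unitisation_def)
  qed (use \<open>S \<subseteq> T\<close> S in \<open>auto simp: unitisation_def unitisation_star_def sa_space_add sa_space_scale sa_space_adj\<close>)
  ultimately show "complete_order_embedding (unitisation S) (unitisation T) (unitised_map (\<lambda>s. s))"
    by simp
qed

theorem proposition2p5:
  fixes S A :: "('h::chilbert_space \<Rightarrow>\<^sub>L 'h) set"
    and u :: "'i \<Rightarrow> ('h \<Rightarrow>\<^sub>L 'h)"
    and F :: "'i filter"
  assumes "selfadjoint_operator_space S"
    and "cstar_algebra A"
    and "A \<subseteq> S"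
    and "\<And>a s. a \<in> A \<Longrightarrow> s \<in> S \<Longrightarrow> a o\<^sub>L s \<in> S"
    and "approximate_unit A F u"
    and "\<And>s. s \<in> S \<Longrightarrow> ((\<lambda>i. u i o\<^sub>L s) \<longlongrightarrow> s) F"
  shows "(\<forall>n\<ge>1. \<forall>\<phi> \<in> CCP (matrix_space n (operator_space S)) scalars.
            \<exists>\<psi> \<in> CCP (matrix_space n (operator_space (cstar_generated S))) scalars.
              (\<forall>X \<in> elems (matrix_space n (operator_space S)). \<psi> X = \<phi> X) \<and>
              map_norm (matrix_space n (operator_space (cstar_generated S))) scalars \<psi>
                = map_norm (matrix_space n (operator_space S)) scalars \<phi>)
         \<and> is_embedding S (cstar_generated S) (\<lambda>s. s)"
proof (intro conjI allI impI ballI)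
  have extension: "\<exists>\<psi> \<in> CCP (matrix_space n (operator_space (cstar_generated S))) scalars.
      (\<forall>X \<in> op_mats S n. \<psi> X = \<phi> X) \<and>
      map_norm (matrix_space n (operator_space (cstar_generated S))) scalars \<psi>
        = map_norm (matrix_space n (operator_space S)) scalars \<phi>"
    if "\<phi> \<in> CCP (matrix_space n (operator_space S)) scalars" for n \<phi>
    using assms(1,3-6) that cstar_generated_superset
      cstar_generated_bounded_ops[OF sa_space_bounded[OF assms(1)]]
    by (rule CCP_extension)
  show "\<exists>\<psi> \<in> CCP (matrix_space n (operator_space (cstar_generated S))) scalars.
      (\<forall>X \<in> elems (matrix_space n (operator_space S)). \<psi> X = \<phi> X) \<and>
      map_norm (matrix_space n (operator_space (cstar_generated S))) scalars \<psi>
        = map_norm (matrix_space n (operator_space S)) scalars \<phi>"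
    if "\<phi> \<in> CCP (matrix_space n (operator_space S)) scalars" for n \<phi>
    using extension[OF that] by simp
  show "is_embedding S (cstar_generated S) (\<lambda>s. s)"
    by (rule inclusion_is_embedding[OF assms(1) cstar_generated_superset]) (use extension in blast)
qed

end
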